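(* Fix $\epsilon>0$ and assume the following hypothesis: for every non-principal Dirichlet character $\chi$ modulo $q$ and every $x$ such that $\log x/\log\log q\rightarrow\infty$, one has $\sum_{n\leqslant x}\chi(n)\ll_{\epsilon} x/(\log x)^{3+\epsilon}$. Then for every non-principal Dirichlet character $\chi$ modulo $q$ and every $x$, \[ \sum_{n\leqslant x}\chi(n)\ll_{\epsilon} \sqrt{q}\,(\log\log q)^{1+\epsilon}. \]
   Context: $A\ll_\epsilon B$ means $|A|\leqslant KB$ with a constant $K$ depending only on $\epsilon$. *)

theory Defs
  imports Complex_Main
begin

definition dirichlet_character :: "nat \<Rightarrow> (int \<Rightarrow> complex) \<Rightarrow> bool" where
  "dirichlet_character q \<chi> \<longleftrightarrow>
     q > 0 \<and>
     (\<forall>a b. \<chi> (a * b) = \<chi> a * \<chi> b) \<and>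
     (\<forall>a. \<chi> (a + int q) = \<chi> a) \<and>
     (\<forall>a. \<chi> a \<noteq> 0 \<longleftrightarrow> coprime a (int q))"

definition principal_character :: "nat \<Rightarrow> int \<Rightarrow> complex" where
  "principal_character q a = (if coprime a (int q) then 1 else 0)"

(* The moduli 1 and 2 admit only the principal character, so this predicate forces q \<ge> 3;
   in particular ln (ln q) > 0. *)
definition nonprincipal_character :: "nat \<Rightarrow> (int \<Rightarrow> complex) \<Rightarrow> bool" where
  "nonprincipal_character q \<chi> \<longleftrightarrow> dirichlet_character q \<chi> \<and> \<chi> \<noteq> principal_character q"

definition character_sum :: "(int \<Rightarrow> complex) \<Rightarrow> real \<Rightarrow> complex" where
  "character_sum \<chi> x = (\<Sum>n\<in>{1..\<lfloor>x\<rfloor>}. \<chi> n)"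

(* "x such that log x / log log q tends to infinity" refers to families of triples (q, \<chi>, x),
   taken here to be arbitrary sequences. The implied constant K precedes the quantification over
   families, so it depends on \<epsilon> only; the bound is then required from some point on in each
   family, as a limit condition says nothing about any finite part of it. *)
definition short_sum_hypothesis :: "real \<Rightarrow> bool" where
  "short_sum_hypothesis \<epsilon> \<longleftrightarrow>
     (\<exists>K::real. \<forall>(q :: nat \<Rightarrow> nat) (\<chi> :: nat \<Rightarrow> int \<Rightarrow> complex) (x :: nat \<Rightarrow> real).
        (\<forall>j. nonprincipal_character (q j) (\<chi> j)) \<longrightarrow>
        (\<forall>j. x j > 0) \<longrightarrow>
        filterlim (\<lambda>j. ln (x j) / ln (ln (real (q j)))) at_top sequentially \<longrightarrow>
        (\<forall>\<^sub>F j in sequentially.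
           norm (character_sum (\<chi> j) (x j)) \<le> K * (x j / ln (x j) powr (3 + \<epsilon>))))"

end

theory Submission
  imports Defs "HOL-Analysis.Kronecker_Approximation_Theorem" "HOL-Number_Theory.Number_Theory"
begin

text \<open>
  For a primitive character the finite Fourier expansion bounds the character sum by \<open>sqrt q\<close> times
  logarithmic sums \<open>\<Sum>n\<le>N. \<chi>(n) e(n \<alpha>) / n\<close> with \<open>N \<le> q\<close>, and partial summation reduces these to
  \<open>S(n) = \<Sum>k\<le>n. \<chi>(k) e(k \<alpha>)\<close>. Terms up to a power of \<open>ln q\<close> are bounded trivially. For larger \<open>n\<close>
  take a Dirichlet approximation \<open>b / r\<close> of \<open>\<alpha>\<close> and put \<open>R = (ln n) powr (4 + 2 * \<epsilon>)\<close>. If \<open>r \<ge> R\<close>, the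
  identity \<open>ln = \<Lambda> * 1\<close> and bilinear estimates save \<open>ln n\<close> up to a power of \<open>ln (ln n)\<close>. If \<open>r < R\<close> and
  \<open>\<alpha>\<close> is within \<open>1 / n\<close> of \<open>b / r\<close>, expand \<open>e(k b / r)\<close> into characters to moduli dividing \<open>r\<close>; by
  primitivity their products with \<open>\<chi>\<close> are nonprincipal, and the exponent \<open>3 + \<epsilon>\<close> of the hypothesis
  compensates the loss \<open>sqrt r\<close>. The remaining \<open>n\<close> lie in an interval of logarithmic length
  \<open>O(ln (ln q))\<close>.
\<close>

text \<open>\<open>HOL-Analysis\<close> uses \<open>\<chi>\<close> as a binder, so it would not parse as a variable.\<close>
unbundle no vec_syntax

section \<open>The exponential kernel and rational approximations\<close>

text \<open>The exponent 4 + 2\<epsilon> of R is fixed from both sides. With l = ln n, the bilinear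
  estimates lose l / R^(1/4) = l^(-\<epsilon>/2), which must beat a factor ln R; the character
  expansion loses sqrt R = l^(2+\<epsilon>), and dividing by the l^(3+\<epsilon>) of the hypothesis
  leaves exactly 1 / l. For r \<ge> R the obstacle is the top of the range of the variable d
  carrying \<Lambda>: when d is within a bounded factor of n, the complementary variable has bounded
  length and nothing can be gained from it. A majorant of \<Lambda> with mean O(ln R) makes every d
  up to n / O(ln R) harmless, so that only about ln (ln R) dyadic blocks are left to the trivial
  bound. Since ln (ln R) is of order ln (ln l), this stays below (ln l)^\<epsilon>. A loss of (ln
  l)^\<epsilon> for each n turns the sum of 1 / (n ln n) over n \<le> q into L^(1+\<epsilon>), where
  L = ln (ln q); the trivial range and the exceptional interval cost only O(L). The hypothesis is
  applied to moduli q s with s < R, whose iterated logarithm is still O(L), so its threshold remains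
  a power of ln q.\<close>

definition ee :: "real \<Rightarrow> complex" where "ee t = cis (2 * pi * t)"

lemma norm_ee [simp]: "norm (ee t) = 1" by (simp add: ee_def)
lemma ee_0 [simp]: "ee 0 = 1" by (simp add: ee_def)
lemma ee_add: "ee (s + t) = ee s * ee t" by (simp add: ee_def cis_mult algebra_simps)
lemma cnj_ee: "cnj (ee t) = ee (- t)" by (simp add: ee_def cis_cnj)
lemma ee_of_int [simp]: "ee (of_int k) = 1"
  unfolding ee_def by (metis cis_multiple_2pi Ints_of_int)
lemma ee_diff: "ee (s - t) = ee s * cnj (ee t)" by (simp add: cnj_ee flip: ee_add)
lemma ee_power: "ee t ^ n = ee (real n * t)" by (simp add: ee_def Complex.DeMoivre mult_ac)
lemma ee_add_int: "ee (t + of_int k) = ee t" by (simp add: ee_add)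

section \<open>Distance to the nearest integer and geometric sums\<close>

definition int_dist :: "real \<Rightarrow> real" where "int_dist t = min (frac t) (1 - frac t)"

lemma int_dist_nonneg: "int_dist t \<ge> 0" 
  using frac_lt_1[of t] by (simp add: int_dist_def)

lemma int_dist_le: "int_dist t \<le> \<bar>t - of_int k\<bar>"
proof (cases "k \<le> \<lfloor>t\<rfloor>")
  case True
  then have "of_int k \<le> (of_int \<lfloor>t\<rfloor> :: real)" by simp
  then show ?thesis unfolding int_dist_def frac_def by linarith
next
  case False
  then have "of_int k \<ge> (of_int (\<lfloor>t\<rfloor> + 1) :: real)" by (subst of_int_le_iff) simp
  then show ?thesis unfolding int_dist_def frac_def by linarith
qed

lemma int_dist_attained: "\<exists>k. int_dist t = \<bar>t - of_int k\<bar>"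
proof (cases "frac t \<le> 1 - frac t")
  case True
  then show ?thesis by (intro exI[of _ "\<lfloor>t\<rfloor>"]) (simp add: int_dist_def frac_def)
next
  case False
  then show ?thesis using frac_lt_1[of t]
    by (intro exI[of _ "\<lfloor>t\<rfloor> + 1"]) (simp add: int_dist_def frac_def)
qed

lemma int_dist_geI: "(\<And>k. c \<le> \<bar>t - of_int k\<bar>) \<Longrightarrow> c \<le> int_dist t"
  using int_dist_attained[of t] by auto

lemma int_dist_minus: "int_dist (- t) = int_dist t"
proof (rule antisym)
  show "int_dist (- t) \<le> int_dist t"
  proof (rule int_dist_geI)
    fix k show "int_dist (- t) \<le> \<bar>t - of_int k\<bar>" using int_dist_le[of "-t" "-k"] by simp
  qed
  show "int_dist t \<le> int_dist (- t)"
  proof (rule int_dist_geI)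
    fix k show "int_dist t \<le> \<bar>- t - of_int k\<bar>" using int_dist_le[of t "-k"] by simp
  qed
qed

text \<open>Half of Jordan's inequality, enough for \<open>norm_1_minus_ee_ge\<close>. Up to pi / 3
  the mean value theorem with cos \<ge> 1 / 2 gives x \<le> 2 sin x; beyond that sin x \<ge> 1 / 2
  while x \<le> pi / 2.\<close>

lemma sin_ge_linear:
  assumes "0 \<le> x" "x \<le> pi / 2" shows "x / pi \<le> sin x"
proof -
  have "x \<le> pi * sin x"
  proof (cases "x \<le> pi / 3")
    case True
    have "1/2 * x \<le> sin x"
    proof (cases "x = 0")
      case False
      then have "0 < x" using assms by simp
      then obtain z where z: "0 < z" "z < x" "sin x - sin 0 = (x - 0) * cos z"
        using MVT2[of 0 x sin cos] by (auto intro: derivative_eq_intros)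
      have "cos (pi/3) \<le> cos z" using z True by (subst cos_mono_le_eq) auto
      then have "1/2 \<le> cos z" by (simp add: cos_60)
      then show ?thesis using z \<open>0 < x\<close> by (simp add: mult.commute)
    qed simp
    moreover have "2 * sin x \<le> pi * sin x"
      using pi_ge_two assms by (intro mult_right_mono sin_ge_zero) auto
    ultimately show ?thesis by simp
  next
    case False
    have "sin (pi/3) \<le> sin x" using False assms by (subst sin_mono_le_eq) auto
    moreover have "1 \<le> sqrt (3::real)" by simp
    ultimately have "1/2 \<le> sin x" unfolding sin_60 by linarith
    then have "pi * (1/2) \<le> pi * sin x" by (intro mult_left_mono) auto
    then show ?thesis using assms by linarith
  qed
  then show ?thesis by (simp add: field_simps)
qed

lemma norm_1_minus_ee: "norm (1 - ee t) = 2 * \<bar>sin (pi * t)\<bar>"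
proof -
  have "(norm (1 - ee t))\<^sup>2 = (2 * \<bar>sin (pi * t)\<bar>)\<^sup>2"
    unfolding cmod_power2 ee_def
    using sin_cos_squared_add[of "2*pi*t"] cos_double_sin[of "pi * t"]
    by (simp add: power2_eq_square algebra_simps)
  then show ?thesis by (subst (asm) power2_eq_iff_nonneg) auto
qed

lemma norm_1_minus_ee_ge: "norm (1 - ee t) \<ge> 2 * int_dist t"
proof -
  have *: "ee t = ee (frac t)" using ee_add_int[of "frac t" "\<lfloor>t\<rfloor>"] by (simp add: frac_def)
  have "int_dist t \<le> \<bar>sin (pi * frac t)\<bar>"
  proof (cases "frac t \<le> 1/2")
    case True
    have "pi * frac t / pi \<le> sin (pi * frac t)"
      using True by (intro sin_ge_linear) (auto simp: field_simps)
    then show ?thesis by (simp add: int_dist_def)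
  next
    case False
    have "pi * (1 - frac t) / pi \<le> sin (pi * (1 - frac t))"
      using False frac_lt_1[of t] by (intro sin_ge_linear) (auto simp: field_simps)
    also have "sin (pi * (1 - frac t)) = sin (pi * frac t)"
      by (simp add: right_diff_distrib sin_diff)
    finally show ?thesis by (simp add: int_dist_def)
  qed
  then show ?thesis unfolding * norm_1_minus_ee by simp
qed

lemma norm_1_minus_ee_le: "norm (1 - ee t) \<le> 2 * pi * \<bar>t\<bar>"
  unfolding norm_1_minus_ee using abs_sin_x_le_abs_x[of "pi * t"] by (simp add: abs_mult)

text \<open>The case distinction keeps the junk value \<open>1 / 0 = 0\<close> out of the kernel.\<close>
definition gmaj :: "real \<Rightarrow> real \<Rightarrow> real" where
  "gmaj N t = (if int_dist t = 0 then N else min N (1 / int_dist t))"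

lemma gmaj_le: "gmaj N t \<le> N" by (simp add: gmaj_def)
lemma gmaj_nonneg: "N \<ge> 0 \<Longrightarrow> gmaj N t \<ge> 0" using int_dist_nonneg[of t] by (simp add: gmaj_def)
lemma gmaj_mono: "N \<le> N' \<Longrightarrow> gmaj N t \<le> gmaj N' t" by (auto simp: gmaj_def)
lemma gmaj_minus: "gmaj N (- t) = gmaj N t" by (simp add: gmaj_def int_dist_minus)
lemma gmaj_le_inverse: "c > 0 \<Longrightarrow> c \<le> int_dist t \<Longrightarrow> gmaj N t \<le> 1 / c"
  by (auto simp: gmaj_def intro!: min.coboundedI2 divide_left_mono)

text \<open>Multiplication by 1 - e(t) telescopes the sum to two unimodular terms. The cap N is a
  bound for the length rather than the length itself, so that one majorant serves sums with varying
  end points.\<close>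

lemma norm_geometric_ee:
  fixes a b :: nat
  assumes "real b - real a \<le> N" "N \<ge> 0"
  shows "norm (\<Sum>n\<in>{a<..b}. ee (real n * t)) \<le> gmaj N t"
proof (cases "a \<le> b")
  case True
  have "norm (\<Sum>n\<in>{a<..b}. ee (real n * t)) \<le> (\<Sum>n\<in>{a<..b}. 1)"
    by (rule sum_norm_le) simp
  also have "\<dots> = real b - real a" using True by (simp add: of_nat_diff)
  finally have 1: "norm (\<Sum>n\<in>{a<..b}. ee (real n * t)) \<le> N" using assms by simp
  have "(1 - ee t) * (\<Sum>n\<in>{a<..b}. ee (real n * t)) = ee (real (Suc a) * t) - ee (real (Suc b) * t)"
    using True
  proof (induction b rule: dec_induct)
    case (step n)
    have "{a<..Suc n} = insert (Suc n) {a<..n}" using step by auto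
    then have "(1 - ee t) * (\<Sum>n\<in>{a<..Suc n}. ee (real n * t)) =
        (1 - ee t) * ee (real (Suc n) * t) + (1 - ee t) * (\<Sum>n\<in>{a<..n}. ee (real n * t))"
      by (simp add: distrib_left)
    also have "(1 - ee t) * ee (real (Suc n) * t) = ee (real (Suc n) * t) - ee (real (Suc (Suc n)) * t)"
      using ee_add[of t "real (Suc n) * t"] by (simp add: algebra_simps)
    finally show ?case using step.IH by simp
  qed simp
  then have "norm (1 - ee t) * norm (\<Sum>n\<in>{a<..b}. ee (real n * t)) =
      norm (ee (real (Suc a) * t) - ee (real (Suc b) * t))"
    by (metis norm_mult)
  also have "\<dots> \<le> 2" by (rule order_trans[OF norm_triangle_ineq4]) simp
  finally have 2: "norm (1 - ee t) * norm (\<Sum>n\<in>{a<..b}. ee (real n * t)) \<le> 2" .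
  have "2 * int_dist t * norm (\<Sum>n\<in>{a<..b}. ee (real n * t)) \<le> 2"
    using norm_1_minus_ee_ge[of t] by (intro order_trans[OF _ 2] mult_right_mono) auto
  then have "norm (\<Sum>n\<in>{a<..b}. ee (real n * t)) \<le> 1 / int_dist t" if "int_dist t \<noteq> 0"
    using that int_dist_nonneg[of t] by (simp add: field_simps)
  then show ?thesis using 1 by (auto simp: gmaj_def)
qed (use gmaj_nonneg assms in auto)

section \<open>Sums of the majorant over multiples of a real number with a given rational
  approximation\<close>

lemma sum_inverse_le: "(\<Sum>i=1..n. 1 / real i) \<le> 1 + ln (real (max 1 n))"
proof (induction n)
  case (Suc n)
  show ?case
  proof (cases "n = 0")
    case False
    have "1 / real (Suc n) \<le> ln (real (Suc n)) - ln (real n)"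
      using ln_diff_le[of "real n" "real (Suc n)"] False by (simp add: field_simps)
    then show ?thesis using Suc False by (simp add: max_def split: if_splits)
  qed simp
qed simp

text \<open>Cut the circle into 2r cells of width 1 / (2r). By the spacing each cell contains at
  most one h. The two cells adjacent to 0 cost N each; cell t has distance at least min t (2r - 1 -
  t) / (2r) from the integers, and the reflection of cells reduces the rest to twice a harmonic
  sum.\<close>

lemma sum_gmaj_spaced:
  fixes H :: "nat set" and r :: nat
  assumes "r \<ge> 1" "N \<ge> 0" "finite H"
    and spaced: "\<And>h h'. h \<in> H \<Longrightarrow> h' \<in> H \<Longrightarrow> h' < h \<Longrightarrow> int_dist (real (h - h') * \<alpha>) \<ge> 1 / (2 * real r)"
  shows "(\<Sum>h\<in>H. gmaj N (real h * \<alpha>)) \<le> 2 * N + 4 * real r * (1 + ln (real r))"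
proof -
  define T where "T h = nat \<lfloor>2 * real r * frac (real h * \<alpha>)\<rfloor>" for h
  define G where "G t = (if t = 0 \<or> t = 2 * r - 1 then N else 2 * real r / real (min t (2 * r - 1 - t)))" for t
  have T: "real (T h) \<le> 2 * real r * frac (real h * \<alpha>)" 
     "2 * real r * frac (real h * \<alpha>) < real (T h) + 1" for h
    unfolding T_def by (auto simp: of_nat_nat)
  have T_lt: "T h < 2 * r" for h
  proof -
    have "real (T h) < 2 * real r" using T(1)[of h] frac_lt_1[of "real h * \<alpha>"] assms(1)
      by (smt (verit) mult_less_cancel_left2 of_nat_1 of_nat_le_iff)
    then show ?thesis by linarith
  qed
  have inj: "inj_on T H"
  proof (rule ccontr)
    assume "\<not> inj_on T H"
    then obtain h h' where h: "h \<in> H" "h' \<in> H" "h' < h" "T h = T h'"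
      by (metis inj_onI linorder_neqE_nat)
    have "\<bar>2 * real r * frac (real h * \<alpha>) - 2 * real r * frac (real h' * \<alpha>)\<bar> < 1"
      using T[of h] T[of h'] h(4) by linarith
    then have "2 * real r * \<bar>frac (real h * \<alpha>) - frac (real h' * \<alpha>)\<bar> < 1"
      by (simp add: abs_mult flip: right_diff_distrib)
    then have "\<bar>frac (real h * \<alpha>) - frac (real h' * \<alpha>)\<bar> < 1 / (2 * real r)"
      using assms(1) by (simp add: field_simps)
    moreover have "int_dist (real (h - h') * \<alpha>) \<le> \<bar>frac (real h * \<alpha>) - frac (real h' * \<alpha>)\<bar>"
      using int_dist_le[of "real (h - h') * \<alpha>" "\<lfloor>real h * \<alpha>\<rfloor> - \<lfloor>real h' * \<alpha>\<rfloor>"] h(3)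
      by (simp add: of_nat_diff frac_def algebra_simps)
    ultimately show False using spaced[OF h(1-3)] by linarith
  qed
  have gmaj_G: "gmaj N (real h * \<alpha>) \<le> G (T h)" for h
  proof (cases "T h = 0 \<or> T h = 2 * r - 1")
    case False
    let ?s = "min (T h) (2 * r - 1 - T h)"
    have s: "?s > 0" using False T_lt[of h] by auto
    have "real ?s / (2 * real r) \<le> int_dist (real h * \<alpha>)"
    proof -
      have "real ?s \<le> real (T h)" by simp
      moreover have "real ?s \<le> 2 * real r - 1 - real (T h)" using T_lt[of h] by linarith
      ultimately have "real ?s \<le> 2 * real r * frac (real h * \<alpha>)" 
        "real ?s \<le> 2 * real r * (1 - frac (real h * \<alpha>))" using T[of h]
        unfolding right_diff_distrib by linarith+
      then show ?thesis using assms(1) by (simp add: int_dist_def field_simps)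
    qed
    then have "gmaj N (real h * \<alpha>) \<le> 1 / (real ?s / (2 * real r))"
      using s assms(1) by (intro gmaj_le_inverse) auto
    then show ?thesis using False by (simp add: G_def)
  qed (auto simp: G_def gmaj_le)
  have G0: "G t \<ge> 0" for t using assms by (simp add: G_def)
  have "(\<Sum>h\<in>H. gmaj N (real h * \<alpha>)) \<le> (\<Sum>h\<in>H. G (T h))" by (intro sum_mono gmaj_G)
  also have "\<dots> = (\<Sum>t\<in>T ` H. G t)" by (simp add: sum.reindex[OF inj])
  also have "\<dots> \<le> (\<Sum>t<2*r. G t)" using T_lt G0 by (intro sum_mono2) auto
  also have "{..<2*r} = {..<r} \<union> (\<lambda>t. 2 * r - 1 - t) ` {..<r}"
  proof (intro equalityI subsetI)
    fix t assume "t \<in> {..<2*r}"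
    then show "t \<in> {..<r} \<union> (\<lambda>t. 2 * r - 1 - t) ` {..<r}"
      by (cases "t < r") (auto intro!: image_eqI[of _ _ "2*r-1-t"])
  qed auto
  also have "(\<Sum>t\<in>\<dots>. G t) \<le> (\<Sum>t<r. G t) + (\<Sum>t\<in>(\<lambda>t. 2 * r - 1 - t) ` {..<r}. G t)"
    using G0 by (simp add: sum_Un sum_nonneg)
  also have "(\<Sum>t\<in>(\<lambda>t. 2 * r - 1 - t) ` {..<r}. G t) = (\<Sum>t<r. G (2 * r - 1 - t))"
    by (subst sum.reindex) (auto simp: inj_on_def)
  also have "\<dots> = (\<Sum>t<r. G t)" 
    by (intro sum.cong) (auto simp: G_def min_def)
  also have "(\<Sum>t<r. G t) = N + (\<Sum>t=1..r-1. 2 * real r * (1 / real t))"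
  proof -
    have "{..<r} = insert 0 {1..r-1}" using assms(1) by auto
    moreover have "G t = 2 * real r / real t" if "t \<in> {1..r-1}" for t 
      using that by (auto simp: G_def min_def)
    moreover have "G 0 = N" by (simp add: G_def)
    ultimately show ?thesis by simp
  qed
  also have "(\<Sum>t=1..r-1. 2 * real r * (1 / real t)) = 2 * real r * (\<Sum>t=1..r-1. 1 / real t)"
    by (rule sum_distrib_left[symmetric])
  finally have "(\<Sum>h\<in>H. gmaj N (real h * \<alpha>)) \<le> 2 * N + 2 * (2 * real r * (\<Sum>t=1..r-1. 1 / real t))"
    by simp
  moreover have "(\<Sum>t=1..r-1. 1 / real t) \<le> (\<Sum>t=1..r. 1 / real t)"
    by (intro sum_mono2) auto
  moreover have "(\<Sum>t=1..r. 1 / real t) \<le> 1 + ln (real r)" 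
    using sum_inverse_le[of r] assms(1) by (simp add: max_def)
  ultimately have "(\<Sum>h\<in>H. gmaj N (real h * \<alpha>)) \<le> 2 * N + 2 * (2 * real r * (1 + ln (real r)))"
    by (smt (verit) mult_left_mono of_nat_0_le_iff)
  then show ?thesis by simp
qed

text \<open>As r does not divide h b, the number h b / r is at distance at least 1 / r from every
  integer. Replacing b / r by \<alpha> costs at most h / r^2, which is half of that because 2 h
  \<le> r.\<close>

lemma int_dist_multiple_ge:
  fixes r h :: nat and b :: int
  assumes "coprime b (int r)" "\<bar>\<alpha> - of_int b / real r\<bar> \<le> 1 / (real r)\<^sup>2" "0 < h" "2 * h \<le> r"
  shows "int_dist (real h * \<alpha>) \<ge> 1 / (2 * real r)"
proof (rule int_dist_geI)
  fix k :: int
  have r: "r > 0" using assms by auto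
  have "int h * b - k * int r \<noteq> 0"
  proof
    assume "int h * b - k * int r = 0"
    then have "int r dvd int h * b" by (metis dvd_triv_right eq_iff_diff_eq_0)
    then have "int r dvd int h" using assms(1) by (simp add: coprime_dvd_mult_left_iff coprime_commute)
    then show False using assms by (auto dest!: zdvd_imp_le)
  qed
  then have "1 \<le> \<bar>int h * b - k * int r\<bar>" by linarith
  then have "of_int 1 \<le> (of_int \<bar>int h * b - k * int r\<bar> :: real)" by (subst of_int_le_iff)
  then have "1 \<le> \<bar>real h * of_int b - of_int k * real r\<bar>" by simp
  then have "1 / real r \<le> \<bar>real h * of_int b - of_int k * real r\<bar> / real r"
    by (intro divide_right_mono) auto
  also have "\<dots> = \<bar>(real h * of_int b - of_int k * real r) / real r\<bar>" by simp
  also have "(real h * of_int b - of_int k * real r) / real r = real h * (of_int b / real r) - of_int k"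
    using r by (simp add: field_simps)
  finally have 1: "1 / real r \<le> \<bar>real h * (of_int b / real r) - of_int k\<bar>" .
  have "\<bar>real h * \<alpha> - real h * (of_int b / real r)\<bar> = real h * \<bar>\<alpha> - of_int b / real r\<bar>"
    by (metis abs_mult abs_of_nat right_diff_distrib)
  also have "\<dots> \<le> (real r / 2) * (1 / (real r)\<^sup>2)"
    using assms by (intro mult_mono) auto
  also have "\<dots> = 1 / (2 * real r)" using r by (simp add: power2_eq_square)
  finally have "\<bar>real h * \<alpha> - real h * (of_int b / real r)\<bar> \<le> 1 / (2 * real r)" .
  moreover have "1 / real r = 1 / (2 * real r) + 1 / (2 * real r)" by (simp add: field_simps)
  moreover have "e \<le> \<bar>x - z\<bar>" if "\<bar>x - y\<bar> \<le> e" "d = e + e" "d \<le> \<bar>y - z\<bar>" for x y z d e :: real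
    using that by linarith
  ultimately show "1 / (2 * real r) \<le> \<bar>real h * \<alpha> - of_int k\<bar>" using 1 by blast
qed

lemma sum_blocks:
  fixes f :: "nat \<Rightarrow> real"
  shows "(\<Sum>h\<in>{0<..m*L}. f h) = (\<Sum>i<m. \<Sum>h\<in>{i*L<..Suc i*L}. f h)"
proof (induction m)
  case (Suc m)
  have "{0<..Suc m*L} = {0<..m*L} \<union> {m*L<..Suc m*L}" by auto
  then have "(\<Sum>h\<in>{0<..Suc m*L}. f h) = (\<Sum>h\<in>{0<..m*L}. f h) + (\<Sum>h\<in>{m*L<..Suc m*L}. f h)"
    by (simp add: sum.union_disjoint)
  then show ?case using Suc by simp
qed simp

lemma ln2_ge_half: "ln (2::real) \<ge> 1 / 2"
  using ln_le_minus_one[of "1 / 2 :: real"] by (simp add: ln_div)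

text \<open>With r \<ge> 2 the blocks of length \<open>r div 2\<close> are nonempty; within one
  block differences are at most r / 2, so \<open>int_dist_multiple_ge\<close> spaces the multiples
  of \<alpha>.\<close>

locale rational_approx =
  fixes \<alpha> :: real and b :: int and r :: nat
  assumes r2: "r \<ge> 2" and cop: "coprime b (int r)" 
    and approx: "\<bar>\<alpha> - of_int b / real r\<bar> \<le> 1 / (real r)\<^sup>2"
begin

lemma sum_gmaj_block:
  assumes "N \<ge> 0"
  shows "(\<Sum>h\<in>{i * (r div 2)<..Suc i * (r div 2)}. gmaj N (real h * \<alpha>)) \<le> 2 * N + 4 * real r * (1 + ln (real r))"
proof (rule sum_gmaj_spaced)
  fix h h' assume "h \<in> {i * (r div 2)<..Suc i * (r div 2)}" "h' \<in> {i * (r div 2)<..Suc i * (r div 2)}" "h' < h"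
  then have "h - h' \<le> r div 2" by auto
  then show "1 / (2 * real r) \<le> int_dist (real (h - h') * \<alpha>)"
    using \<open>h' < h\<close> by (intro int_dist_multiple_ge[OF cop approx]) auto
qed (use r2 assms in auto)

lemma div2_ge: "real r / 3 \<le> real (r div 2)"
proof -
  have "r \<le> 3 * (r div 2)" using r2 by linarith
  then have "real r \<le> 3 * real (r div 2)" by (metis of_nat_le_iff of_nat_mult of_nat_numeral)
  then show ?thesis by simp
qed

lemma div_block: "real (H div (r div 2)) \<le> 3 * real H / real r"
proof -
  have "real (H div (r div 2)) \<le> real H / real (r div 2)" by (simp add: of_nat_div_le_of_nat)
  also have "\<dots> \<le> real H / (real r / 3)"
  proof (intro divide_left_mono)
    show "real r / 3 \<le> real (r div 2)" by (rule div2_ge)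
  qed (use r2 in auto)
  finally show ?thesis by (simp add: mult.commute)
qed

lemma sum_gmaj:
  assumes "N \<ge> 0"
  shows "(\<Sum>h\<in>{0<..H}. gmaj N (real h * \<alpha>)) \<le> (3 * real H / real r + 1) * (2 * N + 4 * real r * (1 + ln (real r)))"
proof -
  define L where "L = r div 2"
  have L: "L > 0" using r2 by (simp add: L_def)
  have "H \<le> Suc (H div L) * L" 
    by (metis L div_mult_mod_eq less_or_eq_imp_le mod_less_divisor mult_Suc nat_add_left_cancel_less add.commute)
  then have "(\<Sum>h\<in>{0<..H}. gmaj N (real h * \<alpha>)) \<le> (\<Sum>h\<in>{0<..Suc (H div L) * L}. gmaj N (real h * \<alpha>))"
    using assms by (intro sum_mono2) (auto intro: gmaj_nonneg)
  also have "\<dots> \<le> (\<Sum>i<Suc (H div L). 2 * N + 4 * real r * (1 + ln (real r)))"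
    unfolding sum_blocks L_def using assms by (intro sum_mono sum_gmaj_block)
  also have "\<dots> = (real (H div L) + 1) * (2 * N + 4 * real r * (1 + ln (real r)))" by simp
  also have "\<dots> \<le> (3 * real H / real r + 1) * (2 * N + 4 * real r * (1 + ln (real r)))"
    using assms r2 div_block[of H] by (intro mult_right_mono add_mono) (auto simp: L_def intro!: add_nonneg_nonneg)
  finally show ?thesis .
qed

text \<open>In block i \<ge> 1 the cap X / k is at most X / (i L) with L about r / 2, and these caps
  add up to a harmonic sum of size (X / r) ln K. Only the block i = 0 needs another
  argument.\<close>

lemma sum_gmaj_hyperbola:
  assumes "X \<ge> 0" "K \<ge> 1"
  shows "(\<Sum>k\<in>{0<..K}. gmaj (X / real k) (real k * \<alpha>)) \<le>
    4 * real r + (3 * real K / real r + 1) * (4 * real r * (1 + ln (real r))) + (6 * X / real r) * (1 + ln (real K))"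
proof -
  define L where "L = r div 2"
  define E where "E = 4 * real r * (1 + ln (real r))"
  have L: "L > 0" using r2 by (simp add: L_def)
  have E: "E \<ge> 0" using r2 by (simp add: E_def)
  have "K \<le> Suc (K div L) * L" 
    by (metis L div_mult_mod_eq less_or_eq_imp_le mod_less_divisor mult_Suc nat_add_left_cancel_less add.commute)
  then have "(\<Sum>k\<in>{0<..K}. gmaj (X / real k) (real k * \<alpha>)) \<le> (\<Sum>k\<in>{0<..Suc (K div L) * L}. gmaj (X / real k) (real k * \<alpha>))"
    using assms by (intro sum_mono2) (auto intro: gmaj_nonneg)
  also have "\<dots> = (\<Sum>i<Suc (K div L). \<Sum>k\<in>{i*L<..Suc i*L}. gmaj (X / real k) (real k * \<alpha>))"
    unfolding sum_blocks ..
  also have "\<dots> = (\<Sum>k\<in>{0*L<..Suc 0*L}. gmaj (X / real k) (real k * \<alpha>)) +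
       (\<Sum>i=1..K div L. \<Sum>k\<in>{i*L<..Suc i*L}. gmaj (X / real k) (real k * \<alpha>))"
  proof -
    have "{..<Suc (K div L)} = insert 0 {1..K div L}" by auto
    then show ?thesis by simp
  qed
  \<comment> \<open>For small k the cap X / k is useless. But every k of the first block is itself a
    nonzero difference of size at most r / 2, so its distance to the integers is at least 1 / (2r)
    and the cap can be lowered to 2r.\<close>
  also have "(\<Sum>k\<in>{0*L<..Suc 0*L}. gmaj (X / real k) (real k * \<alpha>)) \<le> (\<Sum>k\<in>{0*L<..Suc 0*L}. gmaj (2 * real r) (real k * \<alpha>))"
  proof (rule sum_mono)
    fix k assume "k \<in> {0*L<..Suc 0*L}"
    then have k: "1 / (2 * real r) \<le> int_dist (real k * \<alpha>)"
      by (intro int_dist_multiple_ge[OF cop approx]) (auto simp: L_def)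
    moreover have "0 < 1 / (2 * real r)" using r2 by simp
    ultimately have "int_dist (real k * \<alpha>) > 0" by linarith
    moreover have "1 / int_dist (real k * \<alpha>) \<le> 1 / (1 / (2 * real r))"
      using k r2 calculation by (intro divide_left_mono) auto
    ultimately show "gmaj (X / real k) (real k * \<alpha>) \<le> gmaj (2 * real r) (real k * \<alpha>)"
      by (auto simp: gmaj_def)
  qed
  also have "\<dots> \<le> 2 * (2 * real r) + E" unfolding L_def E_def by (rule sum_gmaj_block) auto
  also have "(\<Sum>i=1..K div L. \<Sum>k\<in>{i*L<..Suc i*L}. gmaj (X / real k) (real k * \<alpha>)) \<le>
     (\<Sum>i=1..K div L. 2 * (X / (real i * real L)) + E)"
  proof (rule sum_mono)
    fix i assume i: "i \<in> {1..K div L}"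
    have "(\<Sum>k\<in>{i*L<..Suc i*L}. gmaj (X / real k) (real k * \<alpha>)) \<le> (\<Sum>k\<in>{i*L<..Suc i*L}. gmaj (X / (real i * real L)) (real k * \<alpha>))"
    proof (intro sum_mono gmaj_mono divide_left_mono)
      fix k assume "k \<in> {i*L<..Suc i*L}"
      then have "i * L \<le> k" "k > 0" by auto
      then show "real i * real L \<le> real k" "0 < real k * (real i * real L)" using i L 
        by (metis of_nat_le_iff of_nat_mult) (use i L \<open>k > 0\<close> in auto)
    qed (use assms in auto)
    also have "\<dots> \<le> 2 * (X / (real i * real L)) + E"
      unfolding L_def E_def by (rule sum_gmaj_block) (use assms in auto)
    finally show "(\<Sum>k\<in>{i*L<..Suc i*L}. gmaj (X / real k) (real k * \<alpha>)) \<le> 2 * (X / (real i * real L)) + E" .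
  qed
  also have "\<dots> = real (K div L) * E + (2 * X / real L) * (\<Sum>i=1..K div L. 1 / real i)"
    by (simp add: sum.distrib sum_distrib_left field_simps)
  also have "\<dots> \<le> real (K div L) * E + (6 * X / real r) * (1 + ln (real K))"
  proof (intro add_left_mono mult_mono)
    have "real L \<ge> real r / 3" unfolding L_def by (rule div2_ge)
    then have "2 * X / real L \<le> 2 * X / (real r / 3)" using r2 assms by (intro divide_left_mono) auto
    then show "2 * X / real L \<le> 6 * X / real r" by simp
    have "(\<Sum>i=1..K div L. 1 / real i) \<le> (\<Sum>i=1..K. 1 / real i)"
      by (intro sum_mono2) (auto intro: order_trans[OF _ div_le_dividend])
    also have "\<dots> \<le> 1 + ln (real K)" using sum_inverse_le[of K] assms by (simp add: max_def)
    finally show "(\<Sum>i=1..K div L. 1 / real i) \<le> 1 + ln (real K)" .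
  qed (use assms in \<open>auto intro!: sum_nonneg\<close>)
  finally have "(\<Sum>k\<in>{0<..K}. gmaj (X / real k) (real k * \<alpha>)) \<le>
    2 * (2 * real r) + E + (real (K div L) * E + (6 * X / real r) * (1 + ln (real K)))" by simp
  moreover have "real (K div L) * E \<le> (3 * real K / real r) * E"
    using E div_block[of K] by (intro mult_right_mono) (auto simp: L_def)
  ultimately show ?thesis unfolding E_def[symmetric] by (simp add: distrib_right)
qed

end

section \<open>Chebyshev and Mertens bounds, bilinear forms\<close>

lemma multiples_greaterThanAtMost:
  fixes a b d :: nat assumes "d > 0"
  shows "{k \<in> {a<..b}. d dvd k} = (\<lambda>k. d * k) ` {a div d<..b div d}"
proof (intro equalityI subsetI)
  fix k assume "k \<in> {k \<in> {a<..b}. d dvd k}"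
  then obtain j where "k = d * j" "a < d * j" "d * j \<le> b" by auto
  then show "k \<in> (\<lambda>k. d * k) ` {a div d<..b div d}" using assms
    by (auto simp: div_less_iff_less_mult less_eq_div_iff_mult_less_eq mult.commute)
next
  fix k assume "k \<in> (\<lambda>k. d * k) ` {a div d<..b div d}"
  then show "k \<in> {k \<in> {a<..b}. d dvd k}" using assms
    by (auto simp: div_less_iff_less_mult less_eq_div_iff_mult_less_eq mult.commute)
qed

lemma sum_multiples:
  fixes a b d :: nat and f :: "nat \<Rightarrow> 'a::comm_monoid_add" assumes "d > 0"
  shows "(\<Sum>k\<in>{k \<in> {a<..b}. d dvd k}. f k) = (\<Sum>j\<in>{a div d<..b div d}. f (d * j))"
  unfolding multiples_greaterThanAtMost[OF assms] using assms
  by (subst sum.reindex) (auto simp: inj_on_def)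

lemma sum_divisors_swap:
  fixes f :: "nat \<Rightarrow> nat \<Rightarrow> 'a::comm_monoid_add"
  shows "(\<Sum>k\<in>{a<..b}. \<Sum>d | d \<in> {0<..D} \<and> d dvd k. f d k) = 
    (\<Sum>d\<in>{0<..D}. \<Sum>j\<in>{a div d<..b div d}. f d (d * j))"
proof -
  have "(\<Sum>k\<in>{a<..b}. \<Sum>d | d \<in> {0<..D} \<and> d dvd k. f d k) = 
      (\<Sum>d\<in>{0<..D}. \<Sum>k | k \<in> {a<..b} \<and> d dvd k. f d k)"
    by (rule sum.swap_restrict) auto
  also have "\<dots> = (\<Sum>d\<in>{0<..D}. \<Sum>j\<in>{a div d<..b div d}. f d (d * j))"
    by (intro sum.cong refl sum_multiples) auto
  finally show ?thesis .
qed

section \<open>The von Mangoldt function: Chebyshev's upper bound and Mertens' lower bound\<close>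

lemma ln_conv_sum_mangoldt:
  assumes "0 < n" "n \<le> N"
  shows "ln (real n) = (\<Sum>d | d \<in> {0<..N} \<and> d dvd n. mangoldt d)"
proof -
  have "{d. d \<in> {0<..N} \<and> d dvd n} = {d. d dvd n}" using assms by (auto dest: dvd_imp_le intro: Nat.gr0I)
  then show ?thesis using mangoldt_sum[of n, where ?'a = real] assms by simp
qed

text \<open>The range bound N may exceed n, so that the logarithms of n! and (2n)! can be expanded
  over the same d.\<close>

lemma ln_fact_mangoldt:
  assumes "n \<le> N"
  shows "ln (fact n :: real) = (\<Sum>d\<in>{0<..N}. mangoldt d * real (n div d))"
proof -
  have *: "{1..n} = {0<..n}" by auto
  have "ln (fact n :: real) = (\<Sum>k\<in>{0<..n}. ln (real k))"
    unfolding fact_prod * of_nat_prod by (rule ln_prod) auto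
  also have "\<dots> = (\<Sum>k\<in>{0<..n}. \<Sum>d | d \<in> {0<..N} \<and> d dvd k. mangoldt d)"
    using assms by (intro sum.cong ln_conv_sum_mangoldt) auto
  also have "\<dots> = (\<Sum>d\<in>{0<..N}. mangoldt d * real (n div d))"
    by (subst sum_divisors_swap) (simp add: mult.commute)
  finally show ?thesis .
qed

definition psi_sum :: "nat \<Rightarrow> real" where "psi_sum n = (\<Sum>d\<in>{0<..n}. mangoldt d)"

lemma psi_sum_mono: "m \<le> n \<Longrightarrow> psi_sum m \<le> psi_sum n"
  unfolding psi_sum_def by (intro sum_mono2) (auto simp: mangoldt_nonneg)

text \<open>The logarithm of the central binomial coefficient is the sum of \<Lambda>(d) times the
  difference of (2n) div d and 2 (n div d). This factor is never negative and equals 1 for n < d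
  \<le> 2n, while the coefficient is at most 4^n.\<close>

lemma psi_sum_double: "psi_sum (2 * n) - psi_sum n \<le> 2 * real n"
proof -
  have "psi_sum (2 * n) - psi_sum n = (\<Sum>d\<in>{n<..2*n}. mangoldt d)"
  proof -
    have "{0<..2*n} = {0<..n} \<union> {n<..2*n}" by auto
    then have "psi_sum (2 * n) = psi_sum n + (\<Sum>d\<in>{n<..2*n}. mangoldt d)"
      unfolding psi_sum_def by (simp add: sum.union_disjoint)
    then show ?thesis by simp
  qed
  also have "\<dots> \<le> (\<Sum>d\<in>{n<..2*n}. mangoldt d * (real (2 * n div d) - 2 * real (n div d)))"
  proof (rule sum_mono)
    fix d assume d: "d \<in> {n<..2*n}"
    then have "2 * n div d \<ge> 1" "n div d = 0" by (auto simp: less_eq_div_iff_mult_less_eq)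
    then show "mangoldt d \<le> mangoldt d * (real (2 * n div d) - 2 * real (n div d))"
      using mult_left_mono[of 1 "real (2 * n div d)" "mangoldt d"] by (simp add: mangoldt_nonneg)
  qed
  also have "\<dots> \<le> (\<Sum>d\<in>{0<..2*n}. mangoldt d * (real (2 * n div d) - 2 * real (n div d)))"
  proof (intro sum_mono2 mult_nonneg_nonneg mangoldt_nonneg)
    fix d :: nat
    have "d * (2 * (n div d)) \<le> 2 * n" using times_div_less_eq_dividend[of d n] by linarith
    then have "2 * (n div d) \<le> 2 * n div d" 
      by (cases "d = 0") (auto simp: less_eq_div_iff_mult_less_eq mult.commute)
    then show "0 \<le> real (2 * n div d) - 2 * real (n div d)" by linarith
  qed auto
  also have "\<dots> = ln (fact (2 * n) :: real) - 2 * ln (fact n)"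
    by (simp add: ln_fact_mangoldt[of _ "2 * n"] right_diff_distrib sum_subtractf sum_distrib_left mult_ac)
  also have "\<dots> = ln (fact (2 * n) / (fact n * fact n))"
    by (simp add: ln_div ln_mult)
  also have "fact (2 * n) / (fact n * fact n) = real (2 * n choose n)"
    by (simp add: binomial_fact)
  also have "ln (real (2 * n choose n)) \<le> ln (2 ^ (2 * n))"
  proof (subst ln_le_cancel_iff)
    show "real (2 * n choose n) \<le> 2 ^ (2 * n)"
      by (metis binomial_le_pow2 of_nat_le_iff of_nat_numeral of_nat_power)
  qed auto
  also have "\<dots> = 2 * real n * ln 2" by (simp add: ln_realpow)
  also have "\<dots> \<le> 2 * real n * 1" using ln_2_less_1 by (intro mult_left_mono) auto
  finally show ?thesis by simp
qed

lemma psi_sum_le: "psi_sum n \<le> 4 * real n"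
proof (induction n rule: less_induct)
  case (less n)
  show ?case
  proof (cases "n \<le> 1")
    case True
    then have "(\<Sum>d\<in>{0<..n}. mangoldt d :: real) = 0"
      by (intro sum.neutral) (metis One_nat_def greaterThanAtMost_iff le_antisym le_trans mangoldt_Suc_0 Suc_leI)
    then show ?thesis by (simp add: psi_sum_def)
  next
    case False
    \<comment> \<open>Rounding up gives n \<le> 2m \<le> n + 1, so the induction yields 6m \<le> 3(n
      + 1). This is at most 4n from n = 3 on, and n = 2 is checked directly.\<close>
    define m where "m = (n + 1) div 2"
    have m: "m < n" "n \<le> 2 * m" "2 * m \<le> n + 1" using False by (auto simp: m_def)
    have "psi_sum n \<le> psi_sum (2 * m)" using m by (intro psi_sum_mono)
    also have "\<dots> \<le> psi_sum m + 2 * real m" using psi_sum_double[of m] by simp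
    also have "\<dots> \<le> 6 * real m" using less[OF m(1)] by simp
    also have "\<dots> \<le> 3 * (real n + 1)" using m(3) using of_nat_mono[OF m(3), where ?'a = real] by simp
    finally have *: "psi_sum n \<le> 3 * (real n + 1)" .
    show ?thesis
    proof (cases "n = 2")
      case True
      have "{0<..2::nat} = {1, 2}" by auto
      then have "psi_sum n = ln 2" using True by (simp add: psi_sum_def)
      then show ?thesis using True ln_2_less_1 by simp
    next
      case n2: False
      then show ?thesis using * False by simp
    qed
  qed
qed

text \<open>The lower half of Stirling's formula; the induction step amounts to n (ln (n + 1) - ln
  n) \<le> 1.\<close>

lemma ln_fact_ge: "ln (fact n :: real) \<ge> real n * ln (real n) - real n"
proof (induction n)
  case (Suc n)
  show ?case
  proof (cases "n = 0")
    case False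
    have "ln (real (Suc n)) - ln (real n) \<le> (real (Suc n) - real n) / real n"
      using False by (intro ln_diff_le) auto
    then have "real n * (ln (real (Suc n)) - ln (real n)) \<le> 1" using False by (simp add: field_simps)
    moreover have "ln (fact (Suc n) :: real) = ln (real (Suc n)) + ln (fact n)"
      unfolding fact_Suc of_nat_mult by (subst ln_mult) auto
    ultimately show ?thesis using Suc by (simp add: algebra_simps)
  qed simp
qed simp

lemma mertens_lower:
  assumes "D > 0"
  shows "(\<Sum>e\<in>{0<..D}. mangoldt e / real e) \<ge> ln (real D) - 1"
proof -
  have "real D * ln (real D) - real D \<le> ln (fact D)" by (rule ln_fact_ge)
  also have "\<dots> = (\<Sum>e\<in>{0<..D}. mangoldt e * real (D div e))" by (rule ln_fact_mangoldt) simp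
  also have "\<dots> \<le> (\<Sum>e\<in>{0<..D}. mangoldt e * (real D / real e))"
    by (intro sum_mono mult_left_mono of_nat_div_le_of_nat mangoldt_nonneg)
  also have "\<dots> = real D * (\<Sum>e\<in>{0<..D}. mangoldt e / real e)" by (simp add: sum_distrib_left mult_ac)
  finally have "real D * (ln (real D) - 1) \<le> real D * (\<Sum>e\<in>{0<..D}. mangoldt e / real e)"
    by (simp add: algebra_simps)
  then show ?thesis using assms by simp
qed

section \<open>Partial summation and bilinear forms\<close>

lemma abel_summation:
  fixes g z :: "nat \<Rightarrow> complex"
  assumes "a \<le> b"
  shows "(\<Sum>n\<in>{a<..b}. g n * z n) =
    g b * (\<Sum>n\<in>{a<..b}. z n) - (\<Sum>n\<in>{a..<b}. (g (Suc n) - g n) * (\<Sum>k\<in>{a<..n}. z k))"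
  using assms
proof (induction b rule: dec_induct)
  case (step n)
  have "{a<..Suc n} = insert (Suc n) {a<..n}" using step by auto
  then show ?case using step by (simp add: algebra_simps)
qed simp

text \<open>The boundary term and the total variation g b - g a contribute g b * B each.\<close>

lemma norm_sum_monotone_weight:
  fixes g :: "nat \<Rightarrow> real" and z :: "nat \<Rightarrow> complex"
  assumes "a \<le> b" "g a \<ge> 0" and mono: "\<And>n. a \<le> n \<Longrightarrow> n < b \<Longrightarrow> g n \<le> g (Suc n)"
    and B: "\<And>n. n \<le> b \<Longrightarrow> norm (\<Sum>k\<in>{a<..n}. z k) \<le> B"
  shows "norm (\<Sum>n\<in>{a<..b}. of_real (g n) * z n) \<le> 2 * g b * B"
proof -
  have tele: "(\<Sum>n\<in>{a..<b}. g (Suc n) - g n) = g b - g a"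
    using assms(1) by (rule sum_Suc_diff')
  have gb: "g a \<le> g b" 
  proof -
    have "0 \<le> (\<Sum>n\<in>{a..<b}. g (Suc n) - g n)" using mono by (intro sum_nonneg) auto
    then show ?thesis using tele by simp
  qed
  have B0: "B \<ge> 0" using B[of b] norm_ge_zero order_trans by blast
  have "norm (\<Sum>n\<in>{a..<b}. (of_real (g (Suc n)) - of_real (g n)) * (\<Sum>k\<in>{a<..n}. z k)) \<le>
     (\<Sum>n\<in>{a..<b}. (g (Suc n) - g n) * B)"
  proof (rule sum_norm_le)
    fix n assume n: "n \<in> {a..<b}"
    have "norm ((of_real (g (Suc n)) - of_real (g n)) * (\<Sum>k\<in>{a<..n}. z k)) = 
       \<bar>g (Suc n) - g n\<bar> * norm (\<Sum>k\<in>{a<..n}. z k)"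
      by (metis norm_mult norm_of_real of_real_diff)
    also have "\<dots> \<le> (g (Suc n) - g n) * B"
      using mono[of n] B[of n] n by (intro mult_mono) auto
    finally show "norm ((of_real (g (Suc n)) - of_real (g n)) * (\<Sum>k\<in>{a<..n}. z k)) \<le> (g (Suc n) - g n) * B" .
  qed
  also have "\<dots> = (g b - g a) * B" unfolding tele[symmetric] by (simp add: sum_distrib_right)
  also have "\<dots> \<le> g b * B" using assms B0 by (intro mult_right_mono) auto
  finally have 1: "norm (\<Sum>n\<in>{a..<b}. (of_real (g (Suc n)) - of_real (g n)) * (\<Sum>k\<in>{a<..n}. z k)) \<le> g b * B" .
  have "norm (of_real (g b) * (\<Sum>n\<in>{a<..b}. z n)) \<le> g b * B"
    using B[of b] gb assms(2) by (simp add: norm_mult mult_left_mono)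
  then show ?thesis using 1 
    unfolding abel_summation[OF assms(1)] by (intro order_trans[OF norm_triangle_ineq4]) simp
qed

text \<open>Absolute difference of natural numbers: truncated subtraction makes one of the two
  summands vanish.\<close>

abbreviation ndist :: "nat \<Rightarrow> nat \<Rightarrow> nat" where "ndist d d' \<equiv> (d - d') + (d' - d)"

lemma gmaj_ndist: "gmaj N ((real d - real d') * \<alpha>) = gmaj N (real (ndist d d') * \<alpha>)"
proof (cases "d' \<le> d")
  case False
  then have "(real d - real d') * \<alpha> = - (real (ndist d d') * \<alpha>)" by (simp add: of_nat_diff algebra_simps)
  then show ?thesis by (simp only: gmaj_minus)
qed (simp add: of_nat_diff)

text \<open>A positive distance h is attained at most twice, once on each side of d; the diagonal
  gives G 0.\<close>

lemma sum_ndist_le: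
  fixes G :: "nat \<Rightarrow> real"
  assumes G: "\<And>h. G h \<ge> 0" and d: "d \<in> {A<..B}"
  shows "(\<Sum>d'\<in>{A<..B}. G (ndist d d')) \<le> G 0 + 2 * (\<Sum>h\<in>{0<..B-A}. G h)"
proof -
  have *: "{A<..B} = insert d ({A<..<d} \<union> {d<..B})" using d by auto
  have "(\<Sum>d'\<in>{A<..B}. G (ndist d d')) = G 0 + ((\<Sum>d'\<in>{A<..<d}. G (d - d')) + (\<Sum>d'\<in>{d<..B}. G (d' - d)))"
  proof -
    have "(\<Sum>d'\<in>{A<..B}. G (ndist d d')) = G 0 + ((\<Sum>d'\<in>{A<..<d}. G (ndist d d')) + (\<Sum>d'\<in>{d<..B}. G (ndist d d')))"
      unfolding * by (subst sum.insert, simp, simp, subst sum.union_disjoint) auto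
    also have "(\<Sum>d'\<in>{A<..<d}. G (ndist d d')) = (\<Sum>d'\<in>{A<..<d}. G (d - d'))" by (intro sum.cong) auto
    also have "(\<Sum>d'\<in>{d<..B}. G (ndist d d')) = (\<Sum>d'\<in>{d<..B}. G (d' - d))" by (intro sum.cong) auto
    finally show ?thesis .
  qed
  moreover have "(\<Sum>d'\<in>{A<..<d}. G (d - d')) \<le> (\<Sum>h\<in>{0<..B-A}. G h)"
  proof -
    have "(\<Sum>d'\<in>{A<..<d}. G (d - d')) = (\<Sum>h\<in>(\<lambda>d'. d - d') ` {A<..<d}. G h)"
      by (subst sum.reindex) (auto simp: inj_on_def)
    also have "\<dots> \<le> (\<Sum>h\<in>{0<..B-A}. G h)" using d G by (intro sum_mono2) auto
    finally show ?thesis .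
  qed
  moreover have "(\<Sum>d'\<in>{d<..B}. G (d' - d)) \<le> (\<Sum>h\<in>{0<..B-A}. G h)"
  proof -
    have "(\<Sum>d'\<in>{d<..B}. G (d' - d)) = (\<Sum>h\<in>(\<lambda>d'. d' - d) ` {d<..B}. G h)"
      by (subst sum.reindex) (auto simp: inj_on_def)
    also have "\<dots> \<le> (\<Sum>h\<in>{0<..B-A}. G h)" using d G by (intro sum_mono2) auto
    finally show ?thesis .
  qed
  ultimately show ?thesis by simp
qed

text \<open>Turns a range depending on d into a fixed range with the symmetric condition m d \<le>
  x, so that double sums can be interchanged.\<close>

lemma quotient_interval:
  fixes d x M :: nat
  assumes "d > 0" "x div d \<le> M"
  shows "{0<..x div d} = {m \<in> {0<..M}. m * d \<le> x}"
proof (rule Set.set_eqI)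
  fix m
  have "m \<le> x div d \<longleftrightarrow> m * d \<le> x" using assms(1) by (rule less_eq_div_iff_mult_less_eq)
  moreover have "m \<le> x div d \<Longrightarrow> m \<le> M" using assms(2) by (rule order_trans[rotated])
  ultimately show "m \<in> {0<..x div d} \<longleftrightarrow> m \<in> {m \<in> {0<..M}. m * d \<le> x}"
    by (simp only: greaterThanAtMost_iff mem_Collect_eq) blast
qed

text \<open>Cauchy-Schwarz over m removes the coefficients c, of which only the bound 1 is used.
  Expanding the square of the sum over d leaves geometric sums in m of length at most M, with
  frequency (d - d') \<alpha>.\<close>

lemma bilinear_bound:
  fixes a c :: "nat \<Rightarrow> complex" and P x :: nat
  assumes c: "\<And>m. norm (c m) \<le> 1" and P: "P > 0"
  defines "M \<equiv> x div P"
  shows "(norm (\<Sum>d\<in>{P<..2*P}. \<Sum>m\<in>{0<..x div d}. a d * c m * ee (real (m * d) * \<alpha>)))\<^sup>2 \<le>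
    real M * (\<Sum>d\<in>{P<..2*P}. (norm (a d))\<^sup>2) * (real M + 2 * (\<Sum>h\<in>{0<..P}. gmaj (real M) (real h * \<alpha>)))"
proof -
  define V where "V m = (\<Sum>d\<in>{P<..2*P}. if m * d \<le> x then a d * ee (real (m * d) * \<alpha>) else 0)" for m
  define E where "E = real M + 2 * (\<Sum>h\<in>{0<..P}. gmaj (real M) (real h * \<alpha>))"
  have *: "{0<..x div d} = {m \<in> {0<..M}. m * d \<le> x}" if "d \<in> {P<..2*P}" for d
  proof -
    have "x div d \<le> M" using that P unfolding M_def by (intro div_le_mono2) auto
    then show ?thesis using that by (intro quotient_interval) auto
  qed
  have "(\<Sum>d\<in>{P<..2*P}. \<Sum>m\<in>{0<..x div d}. a d * c m * ee (real (m * d) * \<alpha>)) =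
     (\<Sum>d\<in>{P<..2*P}. \<Sum>m\<in>{0<..M}. if m * d \<le> x then a d * c m * ee (real (m * d) * \<alpha>) else 0)"
  proof (rule sum.cong[OF refl])
    fix d assume d: "d \<in> {P<..2*P}"
    show "(\<Sum>m\<in>{0<..x div d}. a d * c m * ee (real (m * d) * \<alpha>)) =
        (\<Sum>m\<in>{0<..M}. if m * d \<le> x then a d * c m * ee (real (m * d) * \<alpha>) else 0)"
      unfolding *[OF d] by (rule sum.inter_filter) simp
  qed
  also have "\<dots> = (\<Sum>m\<in>{0<..M}. \<Sum>d\<in>{P<..2*P}. if m * d \<le> x then a d * c m * ee (real (m * d) * \<alpha>) else 0)"
    by (rule sum.swap)
  also have "\<dots> = (\<Sum>m\<in>{0<..M}. c m * V m)"
    by (auto simp: V_def sum_distrib_left intro!: sum.cong)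
  finally have "norm (\<Sum>d\<in>{P<..2*P}. \<Sum>m\<in>{0<..x div d}. a d * c m * ee (real (m * d) * \<alpha>)) \<le> (\<Sum>m\<in>{0<..M}. norm (V m))"
    using c by (auto simp: norm_mult intro!: order_trans[OF norm_sum] sum_mono mult_left_le_one_le)
  then have "(norm (\<Sum>d\<in>{P<..2*P}. \<Sum>m\<in>{0<..x div d}. a d * c m * ee (real (m * d) * \<alpha>)))\<^sup>2 \<le> (\<Sum>m\<in>{0<..M}. norm (V m))\<^sup>2"
    by (intro power_mono) auto
  also have "\<dots> \<le> (\<Sum>m\<in>{0<..M}. (norm (V m))\<^sup>2) * real M"
    using sum_squared_le_sum_of_squares[of "\<lambda>m. norm (V m)" "{0<..M}"] by simp
  also have "(\<Sum>m\<in>{0<..M}. (norm (V m))\<^sup>2) \<le> (\<Sum>d\<in>{P<..2*P}. (norm (a d))\<^sup>2) * E"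
  proof -
    define U where "U d d' = (\<Sum>m\<in>{0<..min (x div d) (x div d')}. ee (real m * ((real d - real d') * \<alpha>)))" for d d'
    have U: "norm (U d d') \<le> gmaj (real M) (real (ndist d d') * \<alpha>)" if "d \<in> {P<..2*P}" "d' \<in> {P<..2*P}" for d d'
    proof -
      have "x div d \<le> M" using that P unfolding M_def by (intro div_le_mono2) auto
      then show ?thesis unfolding U_def gmaj_ndist[symmetric] by (intro norm_geometric_ee) auto
    qed
    have "complex_of_real (\<Sum>m\<in>{0<..M}. (norm (V m))\<^sup>2) = (\<Sum>m\<in>{0<..M}. V m * cnj (V m))"
      by (simp add: complex_norm_square[symmetric] of_real_sum of_real_power)
    also have "\<dots> = (\<Sum>m\<in>{0<..M}. \<Sum>d\<in>{P<..2*P}. \<Sum>d'\<in>{P<..2*P}. 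
        if m * d \<le> x \<and> m * d' \<le> x then a d * cnj (a d') * ee (real m * ((real d - real d') * \<alpha>)) else 0)"
      unfolding V_def cnj_sum sum_product
    proof (intro sum.cong refl)
      fix m d d' :: nat
      have "real m * ((real d - real d') * \<alpha>) = real (m * d) * \<alpha> - real (m * d') * \<alpha>" 
        by (simp add: algebra_simps)
      then have "ee (real m * ((real d - real d') * \<alpha>)) = ee (real (m * d) * \<alpha>) * cnj (ee (real (m * d') * \<alpha>))"
        by (simp only: ee_diff)
      then show "(if m * d \<le> x then a d * ee (real (m * d) * \<alpha>) else 0) * cnj (if m * d' \<le> x then a d' * ee (real (m * d') * \<alpha>) else 0) =
          (if m * d \<le> x \<and> m * d' \<le> x then a d * cnj (a d') * ee (real m * ((real d - real d') * \<alpha>)) else 0)"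
        by (cases "m * d \<le> x"; cases "m * d' \<le> x") (simp_all only: if_True if_False complex_cnj_mult complex_cnj_zero mult_zero_left mult_zero_right mult_ac simp_thms)
    qed
    also have "\<dots> = (\<Sum>d\<in>{P<..2*P}. \<Sum>m\<in>{0<..M}. \<Sum>d'\<in>{P<..2*P}. 
        if m * d \<le> x \<and> m * d' \<le> x then a d * cnj (a d') * ee (real m * ((real d - real d') * \<alpha>)) else 0)"
      by (rule sum.swap)
    also have "\<dots> = (\<Sum>d\<in>{P<..2*P}. \<Sum>d'\<in>{P<..2*P}. \<Sum>m\<in>{0<..M}. 
        if m * d \<le> x \<and> m * d' \<le> x then a d * cnj (a d') * ee (real m * ((real d - real d') * \<alpha>)) else 0)"
      by (intro sum.cong refl sum.swap)
    also have "\<dots> = (\<Sum>d\<in>{P<..2*P}. \<Sum>d'\<in>{P<..2*P}. a d * cnj (a d') * U d d')"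
    proof (intro sum.cong refl)
      fix d d' assume d: "d \<in> {P<..2*P}" "d' \<in> {P<..2*P}"
      have **: "{0<..min (x div d) (x div d')} = {m \<in> {0<..M}. m * d \<le> x \<and> m * d' \<le> x}"
      proof -
        have "{0<..min (x div d) (x div d')} = {0<..x div d} \<inter> {0<..x div d'}" by auto
        then show ?thesis unfolding *[OF d(1)] *[OF d(2)] by blast
      qed
      show "(\<Sum>m\<in>{0<..M}. if m * d \<le> x \<and> m * d' \<le> x then a d * cnj (a d') * ee (real m * ((real d - real d') * \<alpha>)) else 0) =
        a d * cnj (a d') * U d d'"
        unfolding U_def ** sum_distrib_left by (rule sum.inter_filter[symmetric]) auto
    qed
    finally have eq: "complex_of_real (\<Sum>m\<in>{0<..M}. (norm (V m))\<^sup>2) = (\<Sum>d\<in>{P<..2*P}. \<Sum>d'\<in>{P<..2*P}. a d * cnj (a d') * U d d')" .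
    have "(\<Sum>m\<in>{0<..M}. (norm (V m))\<^sup>2) = norm (complex_of_real (\<Sum>m\<in>{0<..M}. (norm (V m))\<^sup>2))"
      unfolding norm_of_real by (rule abs_of_nonneg[symmetric]) (intro sum_nonneg zero_le_power2)
    also have "\<dots> = norm (\<Sum>d\<in>{P<..2*P}. \<Sum>d'\<in>{P<..2*P}. a d * cnj (a d') * U d d')" by (simp only: eq)
    also have "\<dots> \<le> (\<Sum>d\<in>{P<..2*P}. \<Sum>d'\<in>{P<..2*P}. norm (a d) * norm (a d') * gmaj (real M) (real (ndist d d') * \<alpha>))"
      using U by (intro order_trans[OF norm_sum] sum_mono) (auto simp: norm_mult intro!: mult_left_mono)
    \<comment> \<open>The inequality between means separates d from d'. Both halves are equal
      because the kernel is symmetric, so for each d only a sum of the kernel over d'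
      remains.\<close>
    also have "\<dots> \<le> (\<Sum>d\<in>{P<..2*P}. \<Sum>d'\<in>{P<..2*P}. ((norm (a d))\<^sup>2 + (norm (a d'))\<^sup>2) / 2 * gmaj (real M) (real (ndist d d') * \<alpha>))"
    proof (intro sum_mono mult_right_mono gmaj_nonneg)
      fix d d' show "norm (a d) * norm (a d') \<le> ((norm (a d))\<^sup>2 + (norm (a d'))\<^sup>2) / 2"
        using sum_squares_bound[of "norm (a d)" "norm (a d')"] by simp
    qed auto
    also have "\<dots> = (\<Sum>d\<in>{P<..2*P}. \<Sum>d'\<in>{P<..2*P}. (norm (a d))\<^sup>2 / 2 * gmaj (real M) (real (ndist d d') * \<alpha>)) +
        (\<Sum>d\<in>{P<..2*P}. \<Sum>d'\<in>{P<..2*P}. (norm (a d'))\<^sup>2 / 2 * gmaj (real M) (real (ndist d d') * \<alpha>))"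
      by (simp add: add_divide_distrib distrib_right sum.distrib)
    also have "(\<Sum>d\<in>{P<..2*P}. \<Sum>d'\<in>{P<..2*P}. (norm (a d'))\<^sup>2 / 2 * gmaj (real M) (real (ndist d d') * \<alpha>)) = 
       (\<Sum>d\<in>{P<..2*P}. \<Sum>d'\<in>{P<..2*P}. (norm (a d))\<^sup>2 / 2 * gmaj (real M) (real (ndist d d') * \<alpha>))"
      by (subst sum.swap) (simp add: add.commute)
    also have "(\<Sum>d\<in>{P<..2*P}. \<Sum>d'\<in>{P<..2*P}. (norm (a d))\<^sup>2 / 2 * gmaj (real M) (real (ndist d d') * \<alpha>)) + 
      (\<Sum>d\<in>{P<..2*P}. \<Sum>d'\<in>{P<..2*P}. (norm (a d))\<^sup>2 / 2 * gmaj (real M) (real (ndist d d') * \<alpha>)) =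
      (\<Sum>d\<in>{P<..2*P}. (norm (a d))\<^sup>2 * (\<Sum>d'\<in>{P<..2*P}. gmaj (real M) (real (ndist d d') * \<alpha>)))"
      by (simp add: sum_distrib_left flip: sum.distrib)
    also have "\<dots> \<le> (\<Sum>d\<in>{P<..2*P}. (norm (a d))\<^sup>2 * E)"
    proof (intro sum_mono mult_left_mono)
      fix d assume "d \<in> {P<..2*P}"
      then have "(\<Sum>d'\<in>{P<..2*P}. gmaj (real M) (real (ndist d d') * \<alpha>)) \<le> gmaj (real M) (real 0 * \<alpha>) + 2 * (\<Sum>h\<in>{0<..2*P-P}. gmaj (real M) (real h * \<alpha>))"
        by (intro sum_ndist_le[where G = "\<lambda>h. gmaj (real M) (real h * \<alpha>)"] gmaj_nonneg) auto
      also have "\<dots> \<le> E" unfolding E_def using gmaj_le[of "real M"] by (intro add_mono) auto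
      finally show "(\<Sum>d'\<in>{P<..2*P}. gmaj (real M) (real (ndist d d') * \<alpha>)) \<le> E" .
    qed auto
    finally show ?thesis by (simp add: sum_distrib_right)
  qed
  finally show ?thesis unfolding E_def by (simp add: mult_ac mult_right_mono)
qed

text \<open>Dual to \<open>bilinear_bound\<close>: the square over m is expanded and the weighted
  sum over n is done inside. The diagonal gives M times the total weight, the at most M^2 other
  pairs give \<open>G0\<close> each. The conditions m n \<le> x and m' n \<le> x merge into n \<le>
  x div max m m', which is why \<open>G\<close> is required for all end points Y.\<close>

lemma weighted_square_bound:
  fixes c :: "nat \<Rightarrow> complex" and w :: "nat \<Rightarrow> real" and P x :: nat
  assumes c: "\<And>m. norm (c m) \<le> 1" and P: "P > 0" and w: "\<And>n. n \<in> {P<..2*P} \<Longrightarrow> w n \<ge> 0"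
  defines "M \<equiv> x div P"
  assumes G: "\<And>h Y. 0 < h \<Longrightarrow> h \<le> M \<Longrightarrow> Y \<le> 2 * P \<Longrightarrow>
     norm (\<Sum>n\<in>{P<..Y}. of_real (w n) * ee (real n * (real h * \<alpha>))) \<le> G0" and G0: "G0 \<ge> 0"
  shows "(\<Sum>n\<in>{P<..2*P}. w n * (norm (\<Sum>m\<in>{0<..x div n}. c m * ee (real (m * n) * \<alpha>)))\<^sup>2) \<le>
    real M * (\<Sum>n\<in>{P<..2*P}. w n) + (real M)\<^sup>2 * G0"
proof -
  define A where "A n = (\<Sum>m\<in>{0<..x div n}. c m * ee (real (m * n) * \<alpha>))" for n
  define W0 where "W0 = (\<Sum>n\<in>{P<..2*P}. w n)"
  define U where "U m m' = (\<Sum>n\<in>{P<..min (2*P) (x div max m m')}. of_real (w n) * ee (real n * ((real m - real m') * \<alpha>)))" for m m'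
  have W0: "W0 \<ge> 0" unfolding W0_def using w by (intro sum_nonneg) auto
  have *: "{0<..x div n} = {m \<in> {0<..M}. m * n \<le> x}" if "n \<in> {P<..2*P}" for n
  proof -
    have "x div n \<le> M" using that P unfolding M_def by (intro div_le_mono2) auto
    then show ?thesis using that by (intro quotient_interval) auto
  qed
  have A: "A n = (\<Sum>m\<in>{0<..M}. if m * n \<le> x then c m * ee (real (m * n) * \<alpha>) else 0)" if "n \<in> {P<..2*P}" for n
    unfolding A_def *[OF that] by (rule sum.inter_filter) auto
  have U_le: "norm (U m m') \<le> (if m = m' then W0 else G0)" if "m \<in> {0<..M}" "m' \<in> {0<..M}" for m m'
  proof -
    consider "m = m'" | "m' < m" | "m < m'" by linarith
    then show ?thesis
    proof cases
      case 1
      have "norm (U m m') \<le> (\<Sum>n\<in>{P<..min (2*P) (x div max m m')}. w n)"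
        unfolding U_def using w by (intro sum_norm_le) (auto simp: norm_mult)
      also have "\<dots> \<le> W0" unfolding W0_def using w by (intro sum_mono2) auto
      finally show ?thesis using 1 by simp
    next
      case 2
      then have "real m - real m' = real (m - m')" by (simp add: of_nat_diff)
      then have "norm (U m m') \<le> G0" unfolding U_def using 2 that by (simp only:) (intro G, auto)
      then show ?thesis using 2 by simp
    next
      \<comment> \<open>Interchanging m and m' conjugates the sum, so \<open>G\<close> is assumed
        for positive h only.\<close>
      case 3
      then have "real m - real m' = - real (m' - m)" by (simp add: of_nat_diff)
      then have "U m m' = cnj (\<Sum>n\<in>{P<..min (2*P) (x div max m m')}. of_real (w n) * ee (real n * (real (m' - m) * \<alpha>)))"
        unfolding U_def cnj_sum by (simp only: complex_cnj_mult complex_cnj_complex_of_real cnj_ee mult_minus_left mult_minus_right)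
      then have "norm (U m m') = norm (\<Sum>n\<in>{P<..min (2*P) (x div max m m')}. of_real (w n) * ee (real n * (real (m' - m) * \<alpha>)))"
        by (simp only: complex_mod_cnj)
      also have "\<dots> \<le> G0" using 3 that by (intro G) auto
      finally show ?thesis using 3 by simp
    qed
  qed
  have "complex_of_real (\<Sum>n\<in>{P<..2*P}. w n * (norm (A n))\<^sup>2) = (\<Sum>n\<in>{P<..2*P}. of_real (w n) * (A n * cnj (A n)))"
    by (simp add: complex_norm_square[symmetric] of_real_sum of_real_power)
  also have "\<dots> = (\<Sum>n\<in>{P<..2*P}. \<Sum>m\<in>{0<..M}. \<Sum>m'\<in>{0<..M}. 
      if m * n \<le> x \<and> m' * n \<le> x then c m * cnj (c m') * (of_real (w n) * ee (real n * ((real m - real m') * \<alpha>))) else 0)"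
  proof (intro sum.cong refl)
    fix n assume "n \<in> {P<..2*P}"
    show "of_real (w n) * (A n * cnj (A n)) = (\<Sum>m\<in>{0<..M}. \<Sum>m'\<in>{0<..M}. 
      if m * n \<le> x \<and> m' * n \<le> x then c m * cnj (c m') * (of_real (w n) * ee (real n * ((real m - real m') * \<alpha>))) else 0)"
      unfolding A[OF \<open>n \<in> _\<close>] cnj_sum sum_product unfolding sum_distrib_left
    proof (intro sum.cong refl)
      fix m m' :: nat
      have "real n * ((real m - real m') * \<alpha>) = real (m * n) * \<alpha> - real (m' * n) * \<alpha>" 
        by (simp add: algebra_simps)
      then have "ee (real n * ((real m - real m') * \<alpha>)) = ee (real (m * n) * \<alpha>) * cnj (ee (real (m' * n) * \<alpha>))"
        by (simp only: ee_diff)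
      then show "of_real (w n) * ((if m * n \<le> x then c m * ee (real (m * n) * \<alpha>) else 0) * cnj (if m' * n \<le> x then c m' * ee (real (m' * n) * \<alpha>) else 0)) =
          (if m * n \<le> x \<and> m' * n \<le> x then c m * cnj (c m') * (of_real (w n) * ee (real n * ((real m - real m') * \<alpha>))) else 0)"
        by (cases "m * n \<le> x"; cases "m' * n \<le> x") (simp_all only: if_True if_False complex_cnj_mult complex_cnj_zero mult_zero_left mult_zero_right mult_ac simp_thms)
    qed
  qed
  also have "\<dots> = (\<Sum>m\<in>{0<..M}. \<Sum>n\<in>{P<..2*P}. \<Sum>m'\<in>{0<..M}. 
      if m * n \<le> x \<and> m' * n \<le> x then c m * cnj (c m') * (of_real (w n) * ee (real n * ((real m - real m') * \<alpha>))) else 0)"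
    by (rule sum.swap)
  also have "\<dots> = (\<Sum>m\<in>{0<..M}. \<Sum>m'\<in>{0<..M}. \<Sum>n\<in>{P<..2*P}. 
      if m * n \<le> x \<and> m' * n \<le> x then c m * cnj (c m') * (of_real (w n) * ee (real n * ((real m - real m') * \<alpha>))) else 0)"
    by (intro sum.cong refl sum.swap)
  also have "\<dots> = (\<Sum>m\<in>{0<..M}. \<Sum>m'\<in>{0<..M}. c m * cnj (c m') * U m m')"
  proof (intro sum.cong refl)
    fix m m' assume m: "m \<in> {0<..M}" "m' \<in> {0<..M}"
    have **: "{P<..min (2*P) (x div max m m')} = {n \<in> {P<..2*P}. m * n \<le> x \<and> m' * n \<le> x}"
    proof -
      have "n \<le> x div max m m' \<longleftrightarrow> m * n \<le> x \<and> m' * n \<le> x" for n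
      proof -
        have "(n \<le> x div max m m') = (n * max m m' \<le> x)" using m by (intro less_eq_div_iff_mult_less_eq) auto
        also have "n * max m m' = max (m * n) (m' * n)" by (simp add: nat_mult_max_right mult.commute)
        finally show ?thesis by (simp only: max.bounded_iff)
      qed
      then show ?thesis
        by (intro Set.set_eqI) (simp only: greaterThanAtMost_iff min.bounded_iff mem_Collect_eq, blast)
    qed
    show "(\<Sum>n\<in>{P<..2*P}. if m * n \<le> x \<and> m' * n \<le> x then c m * cnj (c m') * (of_real (w n) * ee (real n * ((real m - real m') * \<alpha>))) else 0) =
      c m * cnj (c m') * U m m'"
      unfolding U_def ** sum_distrib_left by (rule sum.inter_filter[symmetric]) auto
  qed
  finally have eq: "complex_of_real (\<Sum>n\<in>{P<..2*P}. w n * (norm (A n))\<^sup>2) = (\<Sum>m\<in>{0<..M}. \<Sum>m'\<in>{0<..M}. c m * cnj (c m') * U m m')" .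
  have "(\<Sum>n\<in>{P<..2*P}. w n * (norm (A n))\<^sup>2) = norm (complex_of_real (\<Sum>n\<in>{P<..2*P}. w n * (norm (A n))\<^sup>2))"
    unfolding norm_of_real using w by (intro abs_of_nonneg[symmetric] sum_nonneg mult_nonneg_nonneg) auto
  also have "\<dots> = norm (\<Sum>m\<in>{0<..M}. \<Sum>m'\<in>{0<..M}. c m * cnj (c m') * U m m')" by (simp only: eq)
  also have "\<dots> \<le> (\<Sum>m\<in>{0<..M}. \<Sum>m'\<in>{0<..M}. norm (c m) * norm (c m') * norm (U m m'))"
    by (intro order_trans[OF norm_sum] sum_mono) (auto simp: norm_mult)
  also have "\<dots> \<le> (\<Sum>m\<in>{0<..M}. \<Sum>m'\<in>{0<..M}. 1 * 1 * (if m = m' then W0 else G0))"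
    using c U_le by (intro sum_mono mult_mono) auto
  also have "\<dots> \<le> (\<Sum>m\<in>{0<..M}. \<Sum>m'\<in>{0<..M}. (if m = m' then W0 else 0) + G0)"
    using W0 G0 by (intro sum_mono) auto
  also have "\<dots> = real M * W0 + (real M)\<^sup>2 * G0"
    by (simp add: sum.distrib power2_eq_square algebra_simps)
  finally show ?thesis unfolding A_def W0_def .
qed

section \<open>Exponential sums with a majorised von Mangoldt weight\<close>

definition exp_sum :: "(nat \<Rightarrow> complex) \<Rightarrow> real \<Rightarrow> nat \<Rightarrow> complex" where
  "exp_sum f \<alpha> x = (\<Sum>n\<in>{0<..x}. f n * ee (real n * \<alpha>))"

lemma norm_exp_sum_le:
  assumes "\<And>n. norm (f n) \<le> 1" shows "norm (exp_sum f \<alpha> x) \<le> real x"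
proof -
  have "norm (exp_sum f \<alpha> x) \<le> (\<Sum>n\<in>{0<..x}. 1)"
    unfolding exp_sum_def using assms by (intro sum_norm_le) (auto simp: norm_mult)
  then show ?thesis by simp
qed

lemma ln_ge_1: "x \<ge> (3::nat) \<Longrightarrow> ln (real x) \<ge> 1"
  using exp_le by (subst ln_ge_iff) auto

text \<open>The tail \<open>\<Sum>e | e dvd n \<and> e > D. \<Lambda>(e)\<close> dominates \<open>\<Lambda>(n)\<close> for \<open>n > D\<close>. Extending a sum over primes to
  integers with this weight costs only \<open>ln (P / D)\<close> instead of \<open>ln P\<close>, so it replaces an upper bound sieve.\<close>
definition mangoldt_tail :: "nat \<Rightarrow> nat \<Rightarrow> real" where
  "mangoldt_tail D n = ln (real n) - (\<Sum>e | e \<in> {0<..D} \<and> e dvd n. mangoldt e)"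

text \<open>The divisor e = n of n exceeds D, so \<Lambda>(n) is one of the terms of the
  tail.\<close>

lemma mangoldt_le_tail:
  assumes "D < n" shows "mangoldt n \<le> mangoldt_tail D n"
proof -
  have "mangoldt n + (\<Sum>e | e \<in> {0<..D} \<and> e dvd n. mangoldt e) = 
      (\<Sum>e\<in>insert n {e. e \<in> {0<..D} \<and> e dvd n}. mangoldt e :: real)"
    using assms by (subst sum.insert) auto
  also have "\<dots> \<le> (\<Sum>e | e \<in> {0<..n} \<and> e dvd n. mangoldt e)"
    using assms by (intro sum_mono2) (auto simp: mangoldt_nonneg)
  also have "\<dots> = ln (real n)" using assms by (intro ln_conv_sum_mangoldt[symmetric]) auto
  finally show ?thesis by (simp add: mangoldt_tail_def)
qed

text \<open>The removed divisors e \<le> D contribute at least P (ln D - 1) - \<psi>(D) by Mertens,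
  and \<psi>(D) \<le> 4D \<le> 4P by Chebyshev; hence the constant 5 = 1 + 4.\<close>

lemma sum_mangoldt_tail_le:
  assumes "0 < D" "D \<le> P"
  shows "(\<Sum>n\<in>{P<..2*P}. mangoldt_tail D n) \<le> real P * (ln (2 * real P) - ln (real D) + 5)"
proof -
  have "(\<Sum>n\<in>{P<..2*P}. mangoldt_tail D n) = (\<Sum>n\<in>{P<..2*P}. ln (real n)) - 
      (\<Sum>n\<in>{P<..2*P}. \<Sum>e | e \<in> {0<..D} \<and> e dvd n. mangoldt e)"
    by (simp add: mangoldt_tail_def sum_subtractf)
  also have "(\<Sum>n\<in>{P<..2*P}. \<Sum>e | e \<in> {0<..D} \<and> e dvd n. mangoldt e :: real) = 
      (\<Sum>e\<in>{0<..D}. mangoldt e * real (2 * P div e - P div e))"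
    by (subst sum_divisors_swap) (simp add: mult.commute)
  also have "(\<Sum>n\<in>{P<..2*P}. ln (real n)) \<le> (\<Sum>n\<in>{P<..2*P}. ln (2 * real P))"
    by (intro sum_mono) auto
  also have "\<dots> = real P * ln (2 * real P)" by simp
  finally have 1: "(\<Sum>n\<in>{P<..2*P}. mangoldt_tail D n) \<le> real P * ln (2 * real P) - (\<Sum>e\<in>{0<..D}. mangoldt e * real (2 * P div e - P div e))"
    by simp
  have "real P * (ln (real D) - 1) - 4 * real P \<le> real P * (\<Sum>e\<in>{0<..D}. mangoldt e / real e) - psi_sum D"
    using mertens_lower[OF assms(1)] psi_sum_le[of D] assms(2) by (intro diff_mono mult_left_mono) auto
  also have "\<dots> = (\<Sum>e\<in>{0<..D}. mangoldt e * (real P / real e - 1))"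
    by (simp add: psi_sum_def right_diff_distrib sum_subtractf sum_distrib_left mult_ac)
  also have "\<dots> \<le> (\<Sum>e\<in>{0<..D}. mangoldt e * real (2 * P div e - P div e))"
  proof (intro sum_mono mult_left_mono mangoldt_nonneg)
    fix e assume e: "e \<in> {0<..D}"
    have "real (2 * P div e) \<ge> 2 * real P / real e - 1"
    proof -
      have "2 * P < e + e * (2 * P div e)" using e by (intro dividend_less_times_div) auto
      then have "real (2 * P) < real (e + e * (2 * P div e))" by (simp only: of_nat_less_iff)
      then show ?thesis using e by (simp add: field_simps)
    qed
    moreover have "real (P div e) \<le> real P / real e" by (rule of_nat_div_le_of_nat)
    ultimately show "real P / real e - 1 \<le> real (2 * P div e - P div e)"
      by (simp add: of_nat_diff div_le_mono)
  qed
  finally show ?thesis using 1 by (simp add: algebra_simps)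
qed

text \<open>The part with weight ln n is monotone and costs a factor 2; each \<Lambda>(e) leaves a
  geometric sum over the multiples of e, which together cost a factor 1. The frequencies are k
  \<alpha> with k = h e. As P h \<le> x, the cap 2P / e is at most 2x / k, so the total is
  controlled by \<open>sum_gmaj_hyperbola\<close>.\<close>

lemma norm_sum_mangoldt_tail_le:
  assumes "0 < D" "D \<le> P" "Y \<le> 2 * P" "0 < h" "h \<le> x div P"
  shows "norm (\<Sum>n\<in>{P<..Y}. of_real (mangoldt_tail D n) * ee (real n * (real h * \<alpha>))) \<le> 
    3 * ln (2 * real P) * (\<Sum>k\<in>{0<..(x div P) * D}. gmaj (2 * real x / real k) (real k * \<alpha>))"
proof -
  define \<beta> where "\<beta> = real h * \<alpha>"
  define Z where "Z = (\<Sum>e\<in>{0<..D}. gmaj (2 * real P / real e) (real e * \<beta>))"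
  have Ph: "real P * real h \<le> real x"
  proof -
    have "P * h \<le> P * (x div P)" using assms by simp
    also have "\<dots> \<le> x" by simp
    finally show ?thesis by (metis of_nat_le_iff of_nat_mult)
  qed
  have l: "ln (2 * real P) \<ge> 0" using assms by simp
  have gm0: "gmaj (2 * real P / real e) (real e * \<beta>) \<ge> 0" for e by (rule gmaj_nonneg) simp
  have 1: "norm (\<Sum>n\<in>{P<..Y}. of_real (ln (real n)) * ee (real n * \<beta>)) \<le> 2 * ln (2 * real P) * Z"
  proof (cases "P \<le> Y")
    case True
    have "norm (\<Sum>n\<in>{P<..Y}. of_real (ln (real n)) * ee (real n * \<beta>)) \<le> 2 * ln (real Y) * gmaj (real P) \<beta>"
      using assms True by (intro norm_sum_monotone_weight norm_geometric_ee) auto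
    \<comment> \<open>The logarithmic part is dominated by the single term e = 1 of
      \<open>Z\<close>.\<close>
    also have "\<dots> \<le> 2 * ln (2 * real P) * Z"
    proof (rule mult_mono)
      show "2 * ln (real Y) \<le> 2 * ln (2 * real P)" using assms True by simp
      have "gmaj (real P) \<beta> \<le> gmaj (2 * real P / real 1) (real 1 * \<beta>)" by (simp add: gmaj_mono)
      also have "\<dots> \<le> Z" unfolding Z_def using assms gm0 by (intro member_le_sum) auto
      finally show "gmaj (real P) \<beta> \<le> Z" .
    qed (use l in \<open>auto intro: gmaj_nonneg\<close>)
    finally show ?thesis .
  qed (use l gm0 in \<open>auto simp: Z_def intro!: mult_nonneg_nonneg sum_nonneg\<close>)
  have "(\<Sum>n\<in>{P<..Y}. of_real (\<Sum>e | e \<in> {0<..D} \<and> e dvd n. mangoldt e) * ee (real n * \<beta>)) = 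
      (\<Sum>n\<in>{P<..Y}. \<Sum>e | e \<in> {0<..D} \<and> e dvd n. of_real (mangoldt e) * ee (real n * \<beta>))"
    by (simp only: of_real_sum sum_distrib_right)
  also have "\<dots> = (\<Sum>e\<in>{0<..D}. \<Sum>j\<in>{P div e<..Y div e}. of_real (mangoldt e) * ee (real (e * j) * \<beta>))"
    by (rule sum_divisors_swap)
  also have "\<dots> = (\<Sum>e\<in>{0<..D}. of_real (mangoldt e) * (\<Sum>j\<in>{P div e<..Y div e}. ee (real j * (real e * \<beta>))))"
    by (simp add: sum_distrib_left mult_ac)
  also have "norm \<dots> \<le> (\<Sum>e\<in>{0<..D}. ln (2 * real P) * gmaj (2 * real P / real e) (real e * \<beta>))"
  proof (rule sum_norm_le)
    fix e assume e: "e \<in> {0<..D}"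
    have "norm (\<Sum>j\<in>{P div e<..Y div e}. ee (real j * (real e * \<beta>))) \<le> gmaj (2 * real P / real e) (real e * \<beta>)"
    proof (rule norm_geometric_ee)
      have "real (Y div e) \<le> real Y / real e" by (rule of_nat_div_le_of_nat)
      also have "\<dots> \<le> 2 * real P / real e" using assms(3) by (intro divide_right_mono) auto
      finally have "real (Y div e) \<le> 2 * real P / real e" .
      then show "real (Y div e) - real (P div e) \<le> 2 * real P / real e" by simp
    qed simp
    moreover have "mangoldt e \<le> ln (2 * real P)"
      using mangoldt_le[of e] e assms(2) by (intro order_trans[OF mangoldt_le]) auto
    ultimately show "norm (of_real (mangoldt e) * (\<Sum>j\<in>{P div e<..Y div e}. ee (real j * (real e * \<beta>)))) \<le> ln (2 * real P) * gmaj (2 * real P / real e) (real e * \<beta>)"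
      unfolding norm_mult norm_of_real using l by (intro mult_mono) (auto simp: mangoldt_nonneg)
  qed
  also have "\<dots> = ln (2 * real P) * Z" by (simp add: Z_def sum_distrib_left)
  finally have 2: "norm (\<Sum>n\<in>{P<..Y}. of_real (\<Sum>e | e \<in> {0<..D} \<and> e dvd n. mangoldt e) * ee (real n * \<beta>)) \<le> ln (2 * real P) * Z" .
  have "(\<Sum>n\<in>{P<..Y}. of_real (mangoldt_tail D n) * ee (real n * \<beta>)) =
     (\<Sum>n\<in>{P<..Y}. of_real (ln (real n)) * ee (real n * \<beta>)) - (\<Sum>n\<in>{P<..Y}. of_real (\<Sum>e | e \<in> {0<..D} \<and> e dvd n. mangoldt e) * ee (real n * \<beta>))"
    unfolding mangoldt_tail_def of_real_diff left_diff_distrib sum_subtractf ..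
  then have "norm (\<Sum>n\<in>{P<..Y}. of_real (mangoldt_tail D n) * ee (real n * \<beta>)) \<le> 2 * ln (2 * real P) * Z + ln (2 * real P) * Z"
    using order_trans[OF norm_triangle_ineq4 add_mono[OF 1 2]] by simp
  also have "\<dots> = 3 * ln (2 * real P) * Z" by simp
  also have "\<dots> \<le> 3 * ln (2 * real P) * (\<Sum>k\<in>{0<..(x div P) * D}. gmaj (2 * real x / real k) (real k * \<alpha>))"
  proof (rule mult_left_mono)
    have "Z \<le> (\<Sum>e\<in>{0<..D}. gmaj (2 * real x / real (h * e)) (real (h * e) * \<alpha>))"
      unfolding Z_def
    proof (rule sum_mono)
      fix e assume e: "e \<in> {0<..D}"
      have "2 * real P / real e = 2 * (real P * real h) / real (h * e)" using assms e by simp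
      also have "\<dots> \<le> 2 * real x / real (h * e)" using Ph by (intro divide_right_mono) auto
      finally show "gmaj (2 * real P / real e) (real e * \<beta>) \<le> gmaj (2 * real x / real (h * e)) (real (h * e) * \<alpha>)"
        unfolding \<beta>_def by (simp add: gmaj_mono mult_ac)
    qed
    also have "\<dots> = (\<Sum>k\<in>(\<lambda>e. h * e) ` {0<..D}. gmaj (2 * real x / real k) (real k * \<alpha>))"
      using assms by (subst sum.reindex) (auto simp: inj_on_def)
    also have "\<dots> \<le> (\<Sum>k\<in>{0<..(x div P) * D}. gmaj (2 * real x / real k) (real k * \<alpha>))"
      using assms by (intro sum_mono2 gmaj_nonneg) (auto intro!: mult_le_mono)
    finally show "Z \<le> \<dots>" .
  qed (use l in simp)
  finally show ?thesis unfolding \<beta>_def .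
qed

text \<open>The denominator r lies between R and x / R. Assumption \<open>lR\<close> makes every
  loss l / R^(1/4) at most 1, and \<open>RR\<close> makes the level x / R^(3/2) of the majorant in
  \<open>B_sieve\<close> at least 1.\<close>

locale mult_exp_sum = rational_approx +
  fixes f :: "nat \<Rightarrow> complex" and x :: nat and R :: real
  assumes f_mult: "\<And>m n. f (m * n) = f m * f n" and f_le: "\<And>n. norm (f n) \<le> 1"
    and x3: "x \<ge> 3" and R1: "R \<ge> 1" and Rr: "R \<le> real r" and rR: "real r * R \<le> real x"
    and lR: "ln (real x) \<le> sqrt (sqrt R)" and RR: "R * sqrt R \<le> real x"
begin

definition "l = ln (real x)"

text \<open>The part d in (P, 2P] of the sum over m d \<le> x that arises from ln = \<Lambda> * 1.
  Complete multiplicativity makes its coefficients a product of a function of d and one of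
  m.\<close>

definition "B P = (\<Sum>d\<in>{P<..2*P}. \<Sum>m\<in>{0<..x div d}. (mangoldt d * f d) * f m * ee (real (m * d) * \<alpha>))"

lemma l1: "l \<ge> 1" unfolding l_def using x3 by (rule ln_ge_1)

lemma xpos: "real x > 0" using x3 by simp

lemma r_le: "real r \<le> real x / R" and x_div_r_le: "real x / real r \<le> real x / R"
proof -
  show "real r \<le> real x / R" using rR R1 by (simp add: field_simps)
  show "real x / real r \<le> real x / R" using Rr R1 by (intro divide_left_mono) auto
qed

lemma ln_r: "1 + ln (real r) \<le> 2 * l"
proof -
  have "real r \<le> real x" using r_le R1 xpos
    by (smt (verit, ccfv_SIG) divide_le_eq mult_le_cancel_left1)
  then have "ln (real r) \<le> l" unfolding l_def using r2 by simp
  then show ?thesis using l1 by simp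
qed

lemma ln_2P: "0 < P \<Longrightarrow> P \<le> x \<Longrightarrow> ln (2 * real P) \<le> 2 * l"
proof -
  assume P: "0 < P" "P \<le> x"
  have "ln (2 * real P) = ln 2 + ln (real P)" using P by (subst ln_mult) auto
  also have "\<dots> \<le> 1 + l" unfolding l_def using P ln_2_less_1 by (intro add_mono) auto
  finally show ?thesis using l1 by simp
qed

lemma quotient_le: "real (x div P) * real P \<le> real x"
  using div_times_less_eq_dividend[of x P] by (metis of_nat_le_iff of_nat_mult)

lemma B_trivial:
  assumes "P > 0" shows "norm (B P) \<le> 8 * real x"
proof -
  have "norm (B P) \<le> (\<Sum>d\<in>{P<..2*P}. mangoldt d * (real x / real P))"
    unfolding B_def
  proof (rule sum_norm_le)
    fix d assume d: "d \<in> {P<..2*P}"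
    have "norm (\<Sum>m\<in>{0<..x div d}. (mangoldt d * f d) * f m * ee (real (m * d) * \<alpha>)) \<le> (\<Sum>m\<in>{0<..x div d}. mangoldt d)"
    proof (rule sum_norm_le)
      fix m
      have "norm ((mangoldt d * f d) * f m * ee (real (m * d) * \<alpha>)) = mangoldt d * (norm (f d) * norm (f m))"
        by (simp add: norm_mult)
      also have "\<dots> \<le> mangoldt d * (1 * 1)"
        using f_le by (intro mult_left_mono mult_mono mangoldt_nonneg) auto
      finally show "norm ((mangoldt d * f d) * f m * ee (real (m * d) * \<alpha>)) \<le> mangoldt d" by simp
    qed
    also have "\<dots> = mangoldt d * real (x div d)" by simp
    also have "\<dots> \<le> mangoldt d * (real x / real P)"
    proof (intro mult_left_mono mangoldt_nonneg)
      have "real (x div d) \<le> real x / real d" by (rule of_nat_div_le_of_nat)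
      also have "\<dots> \<le> real x / real P" using d assms by (intro divide_left_mono) auto
      finally show "real (x div d) \<le> real x / real P" .
    qed
    finally show "norm (\<Sum>m\<in>{0<..x div d}. (mangoldt d * f d) * f m * ee (real (m * d) * \<alpha>)) \<le> mangoldt d * (real x / real P)" .
  qed
  also have "\<dots> = (\<Sum>d\<in>{P<..2*P}. mangoldt d) * (real x / real P)" by (rule sum_distrib_right[symmetric])
  also have "\<dots> \<le> psi_sum (2 * P) * (real x / real P)"
    unfolding psi_sum_def by (intro mult_right_mono sum_mono2) (auto simp: mangoldt_nonneg)
  also have "\<dots> \<le> (8 * real P) * (real x / real P)"
    using psi_sum_le[of "2 * P"] by (intro mult_right_mono) auto
  also have "\<dots> = 8 * real x" using assms by simp
  finally show ?thesis .
qed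

text \<open>Effective up to P about x / sqrt R, where the last term is of size x l / R^(1/4). In the
  first term ln (2P) is not enlarged to l: over dyadic P the sum of sqrt (ln (2P) / P) is bounded,
  whereas l would cost sqrt l at P = 1.\<close>

lemma B_bilinear:
  assumes P: "P > 0" "P \<le> x"
  shows "norm (B P) \<le> real x * sqrt (40 * ln (2 * real P) / real P) + 22 * real x * l / sqrt R + 28 * l * sqrt (real x * real P)"
proof -
  define M where "M = real (x div P)"
  have M: "M * real P \<le> real x" "M \<ge> 0" using quotient_le by (auto simp: M_def)
  have MP: "M \<le> real x / real P" using M P by (simp add: field_simps)
  have lP: "ln (2 * real P) \<ge> 0" "ln (2 * real P) \<le> 2 * l" using P ln_2P by auto
  have nn: "0 \<le> 40 * ln (2 * real P) / real P"
    using lP(1) by (metis divide_nonneg_nonneg mult_nonneg_nonneg of_nat_0_le_iff zero_le_numeral)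
  have "(\<Sum>d\<in>{P<..2*P}. (norm (mangoldt d * f d))\<^sup>2) \<le> (\<Sum>d\<in>{P<..2*P}. ln (2 * real P) * mangoldt d)"
  proof (rule sum_mono)
    fix d assume d: "d \<in> {P<..2*P}"
    have "mangoldt d \<le> ln (real d)" using d by (intro mangoldt_le) auto
    also have "\<dots> \<le> ln (2 * real P)" using d by simp
    finally have 1: "mangoldt d \<le> ln (2 * real P)" .
    have "norm (mangoldt d * f d) \<le> mangoldt d"
      using f_le[of d] mangoldt_nonneg[of d] by (simp add: norm_mult mult_left_le)
    then have "(norm (mangoldt d * f d))\<^sup>2 \<le> (mangoldt d)\<^sup>2" by (intro power_mono) auto
    also have "\<dots> \<le> ln (2 * real P) * mangoldt d"
      unfolding power2_eq_square using 1 by (intro mult_right_mono) (auto simp: mangoldt_nonneg)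
    finally show "(norm (mangoldt d * f d))\<^sup>2 \<le> ln (2 * real P) * mangoldt d" .
  qed
  also have "\<dots> = ln (2 * real P) * (\<Sum>d\<in>{P<..2*P}. mangoldt d)" by (simp add: sum_distrib_left)
  also have "\<dots> \<le> ln (2 * real P) * (8 * real P)"
  proof (intro mult_left_mono)
    have "(\<Sum>d\<in>{P<..2*P}. mangoldt d) \<le> psi_sum (2 * P)"
      unfolding psi_sum_def by (intro sum_mono2) (auto simp: mangoldt_nonneg)
    then show "(\<Sum>d\<in>{P<..2*P}. mangoldt d) \<le> 8 * real P" using psi_sum_le[of "2 * P"] by simp
  qed (use lP in auto)
  finally have a2: "(\<Sum>d\<in>{P<..2*P}. (norm (mangoldt d * f d))\<^sup>2) \<le> ln (2 * real P) * (8 * real P)" .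
  have "(norm (B P))\<^sup>2 \<le> M * (\<Sum>d\<in>{P<..2*P}. (norm (mangoldt d * f d))\<^sup>2) * (M + 2 * (\<Sum>h\<in>{0<..P}. gmaj M (real h * \<alpha>)))"
    unfolding B_def M_def using f_le P by (intro bilinear_bound) auto
  also have "\<dots> \<le> M * (ln (2 * real P) * (8 * real P)) * (M + 2 * ((3 * real P / real r + 1) * (2 * M + 8 * real r * l)))"
  proof (intro mult_mono add_left_mono)
    have "(\<Sum>h\<in>{0<..P}. gmaj M (real h * \<alpha>)) \<le> (3 * real P / real r + 1) * (2 * M + 4 * real r * (1 + ln (real r)))"
      using M by (intro sum_gmaj)
    also have "\<dots> \<le> (3 * real P / real r + 1) * (2 * M + 4 * real r * (2 * l))"
      using ln_r by (intro mult_left_mono add_left_mono) auto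
    finally show "(\<Sum>h\<in>{0<..P}. gmaj M (real h * \<alpha>)) \<le> (3 * real P / real r + 1) * (2 * M + 8 * real r * l)" by (simp add: mult.assoc)
  qed (use M a2 lP in \<open>auto intro!: add_nonneg_nonneg sum_nonneg gmaj_nonneg mult_nonneg_nonneg\<close>)
  also have "M + 2 * ((3 * real P / real r + 1) * (2 * M + 8 * real r * l)) = 5 * M + 12 * (M * real P) / real r + 48 * real P * l + 16 * real r * l"
    using r2 by (simp add: field_simps)
  also have "\<dots> \<le> 5 * (real x / real P) + 12 * real x / real r + 48 * real P * l + 16 * real r * l"
    using M MP by (intro add_mono mult_left_mono divide_right_mono) auto
  also have "\<dots> \<le> 5 * (real x / real P) + (28 * (real x / R) * l + 48 * real P * l)"
  proof -
    have "12 * (real x / real r) \<le> 12 * (real x / R * l)"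
      using x_div_r_le l1 mult_mono[of "real x / real r" "real x / R" 1 l] R1 by simp
    moreover have "16 * (real r * l) \<le> 16 * (real x / R * l)"
      using r_le l1 by (intro mult_left_mono mult_right_mono) auto
    moreover have "28 * (real x / R) * l = 12 * (real x / R * l) + 16 * (real x / R * l)" by simp
    moreover have "12 * real x / real r = 12 * (real x / real r)" "16 * real r * l = 16 * (real r * l)" by simp_all
    moreover have "y + a + c + d \<le> y + (e + c)" if "a0 \<le> a'" "d0 \<le> d'" "e = a' + d'" "a = a0" "d = d0" for y a c d e a' d' a0 d0 :: real
      using that by linarith
    ultimately show ?thesis by blast
  qed
  finally have "(norm (B P))\<^sup>2 \<le> M * (ln (2 * real P) * (8 * real P)) * (5 * (real x / real P) + (28 * (real x / R) * l + 48 * real P * l))"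
    using M lP by (smt (verit, best) mult_left_mono mult_nonneg_nonneg of_nat_0_le_iff)
  also have "\<dots> = (M * real P) * (8 * ln (2 * real P)) * (5 * (real x / real P) + (28 * (real x / R) * l + 48 * real P * l))"
    by (simp only: mult_ac)
  also have "\<dots> \<le> real x * (8 * ln (2 * real P)) * (5 * (real x / real P) + (28 * (real x / R) * l + 48 * real P * l))"
    using M lP l1 R1 by (intro mult_right_mono mult_nonneg_nonneg add_nonneg_nonneg) auto
  also have "\<dots> = (real x)\<^sup>2 * (40 * ln (2 * real P) / real P) + real x * (8 * ln (2 * real P)) * (28 * (real x / R) * l + 48 * real P * l)"
    by (simp add: algebra_simps power2_eq_square)
  also have "\<dots> \<le> (real x)\<^sup>2 * (40 * ln (2 * real P) / real P) + real x * (8 * (2 * l)) * (28 * (real x / R) * l + 48 * real P * l)"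
    using lP l1 R1 by (intro add_left_mono mult_right_mono mult_left_mono add_nonneg_nonneg) auto
  also have "\<dots> = (real x)\<^sup>2 * (40 * ln (2 * real P) / real P) + (448 * (real x * l)\<^sup>2 / R + 768 * l\<^sup>2 * (real x * real P))"
    by (simp add: algebra_simps power2_eq_square)
  \<comment> \<open>The constants 448 = 16 * 28 and 768 = 16 * 48 are raised to the squares 22^2 =
    484 and 28^2 = 784 before the root is taken.\<close>
  also have "\<dots> \<le> (real x)\<^sup>2 * (40 * ln (2 * real P) / real P) + ((22 * (real x * l))\<^sup>2 / R + (28 * l)\<^sup>2 * (real x * real P))"
    using R1 by (intro add_left_mono add_mono divide_right_mono mult_right_mono) (auto simp: power_mult_distrib)
  finally have "norm (B P) \<le> sqrt ((real x)\<^sup>2 * (40 * ln (2 * real P) / real P) + ((22 * (real x * l))\<^sup>2 / R + (28 * l)\<^sup>2 * (real x * real P)))"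
    by (rule real_le_rsqrt)
  also have "\<dots> \<le> sqrt ((real x)\<^sup>2 * (40 * ln (2 * real P) / real P)) + sqrt ((22 * (real x * l))\<^sup>2 / R + (28 * l)\<^sup>2 * (real x * real P))"
    using R1 by (intro sqrt_add_le_add_sqrt mult_nonneg_nonneg nn add_nonneg_nonneg) auto
  also have "sqrt ((22 * (real x * l))\<^sup>2 / R + (28 * l)\<^sup>2 * (real x * real P)) \<le> sqrt ((22 * (real x * l))\<^sup>2 / R) + sqrt ((28 * l)\<^sup>2 * (real x * real P))"
    using R1 by (intro sqrt_add_le_add_sqrt mult_nonneg_nonneg nn add_nonneg_nonneg) auto
  finally show ?thesis using l1 by (simp add: real_sqrt_mult real_sqrt_divide)
qed

text \<open>Mean of the weight \<open>mangoldt_tail D\<close> over a block: for the D of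
  \<open>B_sieve\<close> the ratio 2P / D is at most 4 R sqrt R, and 5 is the constant of
  \<open>sum_mangoldt_tail_le\<close>.\<close>

definition "lam = ln (4 * R * sqrt R) + 5"

lemma lam_ge: "lam \<ge> 5"
proof -
  have "1 \<le> sqrt R" using R1 by simp
  then have "1 * 1 \<le> R * sqrt R" using R1 by (intro mult_mono) auto
  then have "1 \<le> 4 * R * sqrt R" by simp
  then show ?thesis unfolding lam_def by simp
qed

text \<open>Cauchy-Schwarz with \<Lambda> split into two square roots. Chebyshev bounds one factor;
  in the other \<Lambda> is enlarged to \<open>mangoldt_tail D\<close>, so that the variable d runs
  over integers. The diagonal then costs \<open>lam\<close> where the logarithm of P would otherwise
  appear, and the first term is O(x) once P \<le> x / \<open>lam\<close>.\<close>

lemma B_sieve: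
  assumes P: "P > 0" "P \<le> x" "real x < real P * sqrt R"
  shows "norm (B P) \<le> sqrt (8 * real x * real P * lam) + 59 * real x * l / sqrt (sqrt R)"
proof -
  define M where "M = x div P"
  \<comment> \<open>As M = x div P is at most sqrt R, the products k = h e below stay under M D
    \<le> x / R, short enough for \<open>sum_gmaj_hyperbola\<close> to give O(x l / R).\<close>
  define D where "D = nat \<lfloor>real x / (R * sqrt R)\<rfloor>"
  define A where "A d = (\<Sum>m\<in>{0<..x div d}. f m * ee (real (m * d) * \<alpha>))" for d
  define Z where "Z = (\<Sum>k\<in>{0<..M * D}. gmaj (2 * real x / real k) (real k * \<alpha>))"
  define G0 where "G0 = 3 * ln (2 * real P) * Z"
  have sR: "sqrt R \<ge> 1" using R1 by simp
  have M: "real M * real P \<le> real x" using quotient_le by (auto simp: M_def)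
  have MR: "real M \<le> sqrt R"
  proof -
    have "real M * real P \<le> sqrt R * real P" using M P(3) by (metis less_imp_le mult.commute order_trans)
    then show ?thesis by (rule mult_right_le_imp_le) (use P in simp)
  qed
  have quot1: "1 \<le> real x / (R * sqrt R)" using RR R1 sR by (simp add: field_simps)
  have D_le: "real D \<le> real x / (R * sqrt R)" and D_gt: "real x / (R * sqrt R) < real D + 1"
    unfolding D_def using quot1 by (auto simp: of_nat_nat)
  have D1: "D \<ge> 1" using quot1 unfolding D_def by (simp add: le_nat_floor)
  have D_ge: "real D \<ge> real x / (2 * R * sqrt R)"
    using D_gt D1 by (simp add: field_simps)
  have DP: "D \<le> P"
  proof -
    have "real D \<le> real x / (R * sqrt R)" by fact
    also have "\<dots> \<le> real x / (1 * sqrt R)" using R1 sR by (intro divide_left_mono mult_mono) auto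
    also have "\<dots> \<le> real P" using P(3) sR by (simp add: field_simps)
    finally show ?thesis by simp
  qed
  have lP: "ln (2 * real P) \<ge> 0" "ln (2 * real P) \<le> 2 * l" using P ln_2P by auto
  have M1: "M \<ge> 1" unfolding M_def using P by (simp add: less_eq_div_iff_mult_less_eq)
  have MD1: "M * D \<ge> 1" using M1 D1 by simp
  have MDx: "real (M * D) \<le> real x"
  proof -
    have "M * D \<le> M * P" using DP by simp
    then have "real (M * D) \<le> real M * real P" by (metis of_nat_le_iff of_nat_mult)
    then show ?thesis using M by simp
  qed
  have MD: "real M * real D \<le> real x / R"
  proof -
    have "real M * real D \<le> sqrt R * (real x / (R * sqrt R))" using MR D_le sR by (intro mult_mono) auto
    also have "\<dots> = real x / R" using sR by simp
    finally show ?thesis .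
  qed
  have Z: "Z \<le> 72 * (real x / R) * l"
  proof -
    have "Z \<le> 4 * real r + (3 * real (M * D) / real r + 1) * (4 * real r * (1 + ln (real r))) + (6 * (2 * real x) / real r) * (1 + ln (real (M * D)))"
      unfolding Z_def using MD1 by (intro sum_gmaj_hyperbola) auto
    also have "\<dots> \<le> 4 * real r * l + (3 * real (M * D) / real r + 1) * (4 * real r * (2 * l)) + (6 * (2 * real x) / real r) * (2 * l)"
    proof (intro add_mono mult_left_mono)
      show "4 * real r \<le> 4 * real r * l" using l1 mult_left_mono[of 1 l "4 * real r"] by simp
      have "ln (real (M * D)) \<le> l" unfolding l_def using MDx MD1 xpos by (subst ln_le_cancel_iff) (use xpos in auto)
      then show "1 + ln (real (M * D)) \<le> 2 * l" using l1 by simp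
    qed (use ln_r in auto)
    also have "\<dots> = 12 * (real r * l) + 24 * (real M * real D * l) + 24 * (real x / real r * l)"
      using r2 by (simp add: field_simps)
    also have "\<dots> \<le> 12 * (real x / R * l) + 24 * (real x / R * l) + 24 * (real x / R * l)"
      using r_le x_div_r_le MD l1 by (intro add_mono mult_left_mono mult_right_mono) auto
    also have "\<dots> = 60 * (real x / R * l)" by simp
    also have "\<dots> \<le> 72 * (real x / R * l)" using l1 R1 by (intro mult_right_mono mult_nonneg_nonneg) auto
    also have "\<dots> = 72 * (real x / R) * l" by simp
    finally show ?thesis .
  qed
  have Z0: "Z \<ge> 0" unfolding Z_def by (intro sum_nonneg gmaj_nonneg) auto
  have G0: "G0 \<ge> 0" "G0 \<le> 432 * (real x / R) * l\<^sup>2"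
  proof -
    show "G0 \<ge> 0" unfolding G0_def using Z0 lP by simp
    have "G0 \<le> 3 * (2 * l) * (72 * (real x / R) * l)"
      unfolding G0_def using Z Z0 lP by (intro mult_mono) auto
    then show "G0 \<le> 432 * (real x / R) * l\<^sup>2" by (simp add: power2_eq_square mult_ac)
  qed
  have W0: "(\<Sum>n\<in>{P<..2*P}. mangoldt_tail D n) \<le> real P * lam"
  proof -
    have "(\<Sum>n\<in>{P<..2*P}. mangoldt_tail D n) \<le> real P * (ln (2 * real P) - ln (real D) + 5)"
      using D1 DP by (intro sum_mangoldt_tail_le) auto
    also have "ln (2 * real P) - ln (real D) = ln (2 * real P / real D)" using P D1 by (simp add: ln_div)
    also have "\<dots> \<le> ln (4 * R * sqrt R)"
    proof (subst ln_le_cancel_iff)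
      have "2 * real P / real D \<le> 2 * real x / (real x / (2 * R * sqrt R))"
        using D_ge D1 P xpos R1 sR by (intro frac_le) auto
      then show "2 * real P / real D \<le> 4 * R * sqrt R" using xpos by simp
    qed (use P D1 R1 in auto)
    finally show ?thesis unfolding lam_def by (simp add: mult_left_mono)
  qed
  have "norm (B P) \<le> (\<Sum>d\<in>{P<..2*P}. sqrt (mangoldt d) * (sqrt (mangoldt d) * norm (A d)))"
  proof -
    have "B P = (\<Sum>d\<in>{P<..2*P}. mangoldt d * f d * A d)"
      unfolding B_def A_def by (simp add: sum_distrib_left mult_ac)
    also have "norm \<dots> \<le> (\<Sum>d\<in>{P<..2*P}. sqrt (mangoldt d) * (sqrt (mangoldt d) * norm (A d)))"
    proof (rule sum_norm_le)
      fix d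
      have "norm (mangoldt d * f d * A d) = (mangoldt d * norm (A d)) * norm (f d)"
        by (simp add: norm_mult)
      also have "\<dots> \<le> mangoldt d * norm (A d)"
        using f_le[of d] by (intro mult_left_le mult_nonneg_nonneg) (auto simp: mangoldt_nonneg)
      finally show "norm (mangoldt d * f d * A d) \<le> sqrt (mangoldt d) * (sqrt (mangoldt d) * norm (A d))"
        using mangoldt_nonneg[of d] by (simp add: mult.assoc[symmetric])
    qed
    finally show ?thesis .
  qed
  then have "(norm (B P))\<^sup>2 \<le> (\<Sum>d\<in>{P<..2*P}. sqrt (mangoldt d) * (sqrt (mangoldt d) * norm (A d)))\<^sup>2"
    by (intro power_mono) auto
  also have "\<dots> \<le> (\<Sum>d\<in>{P<..2*P}. (sqrt (mangoldt d))\<^sup>2) * (\<Sum>d\<in>{P<..2*P}. (sqrt (mangoldt d) * norm (A d))\<^sup>2)"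
    by (rule Cauchy_Schwarz_ineq_sum)
  also have "(\<Sum>d\<in>{P<..2*P}. (sqrt (mangoldt d))\<^sup>2) = (\<Sum>d\<in>{P<..2*P}. mangoldt d)"
    by (simp add: mangoldt_nonneg)
  also have "(\<Sum>d\<in>{P<..2*P}. (sqrt (mangoldt d) * norm (A d))\<^sup>2) = (\<Sum>d\<in>{P<..2*P}. mangoldt d * (norm (A d))\<^sup>2)"
    by (simp add: mangoldt_nonneg power_mult_distrib)
  also have "(\<Sum>d\<in>{P<..2*P}. mangoldt d) * (\<Sum>d\<in>{P<..2*P}. mangoldt d * (norm (A d))\<^sup>2) \<le> 
     (8 * real P) * (real M * (real P * lam) + (real M)\<^sup>2 * (432 * (real x / R) * l\<^sup>2))"
  proof (intro mult_mono)
    have "(\<Sum>d\<in>{P<..2*P}. mangoldt d) \<le> psi_sum (2 * P)"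
      unfolding psi_sum_def by (intro sum_mono2) (auto simp: mangoldt_nonneg)
    then show "(\<Sum>d\<in>{P<..2*P}. mangoldt d) \<le> 8 * real P" using psi_sum_le[of "2 * P"] by simp
    have le: "mangoldt d \<le> mangoldt_tail D d" if "d \<in> {P<..2*P}" for d
      using that DP by (intro mangoldt_le_tail) auto
    have "(\<Sum>d\<in>{P<..2*P}. mangoldt d * (norm (A d))\<^sup>2) \<le> (\<Sum>d\<in>{P<..2*P}. mangoldt_tail D d * (norm (A d))\<^sup>2)"
      using le by (intro sum_mono mult_right_mono) auto
    also have "\<dots> \<le> real M * (\<Sum>n\<in>{P<..2*P}. mangoldt_tail D n) + (real M)\<^sup>2 * G0"
      unfolding A_def M_def
    proof (rule weighted_square_bound)
      show "0 \<le> mangoldt_tail D n" if "n \<in> {P<..2*P}" for n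
        using le[OF that] mangoldt_nonneg[of n] by linarith
      show "norm (\<Sum>n\<in>{P<..Y}. of_real (mangoldt_tail D n) * ee (real n * (real h * \<alpha>))) \<le> G0"
        if "0 < h" "h \<le> x div P" "Y \<le> 2 * P" for h Y
        unfolding G0_def Z_def M_def using that D1 DP by (intro norm_sum_mangoldt_tail_le) auto
    qed (use f_le P G0 in auto)
    also have "\<dots> \<le> real M * (real P * lam) + (real M)\<^sup>2 * (432 * (real x / R) * l\<^sup>2)"
      using W0 G0 by (intro add_mono mult_left_mono) auto
    finally show "(\<Sum>d\<in>{P<..2*P}. mangoldt d * (norm (A d))\<^sup>2) \<le> \<dots>" .
  qed (auto intro!: sum_nonneg mult_nonneg_nonneg mangoldt_nonneg)
  also have "\<dots> = 8 * (real M * real P) * real P * lam + 3456 * (real M * real P) * real M * (real x / R) * l\<^sup>2"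
    by (simp add: algebra_simps power2_eq_square)
  also have "\<dots> \<le> 8 * real x * real P * lam + 3456 * real x * sqrt R * (real x / R) * l\<^sup>2"
    using M MR lam_ge R1 by (intro add_mono mult_right_mono mult_mono) auto
  also have "3456 * real x * sqrt R * (real x / R) * l\<^sup>2 = 3456 * (real x * l)\<^sup>2 / sqrt R"
    using R1 by (simp add: field_simps power2_eq_square)
  \<comment> \<open>Here 3456 = 8 * 432 is raised to the square 59^2 = 3481.\<close>
  also have "\<dots> \<le> (59 * (real x * l))\<^sup>2 / sqrt R"
    using R1 by (intro divide_right_mono) (auto simp: power_mult_distrib)
  finally have "(norm (B P))\<^sup>2 \<le> 8 * real x * real P * lam + (59 * (real x * l))\<^sup>2 / sqrt R" by simp
  then have "norm (B P) \<le> sqrt (8 * real x * real P * lam + (59 * (real x * l))\<^sup>2 / sqrt R)"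
    by (rule real_le_rsqrt)
  also have "\<dots> \<le> sqrt (8 * real x * real P * lam) + sqrt ((59 * (real x * l))\<^sup>2 / sqrt R)"
    using lam_ge R1 by (intro sqrt_add_le_add_sqrt) auto
  also have "sqrt ((59 * (real x * l))\<^sup>2 / sqrt R) = 59 * real x * l / sqrt (sqrt R)"
    using l1 by (simp add: real_sqrt_divide real_sqrt_mult)
  finally show ?thesis .
qed

end

section \<open>Completely multiplicative exponential sums at large denominators\<close>

text \<open>A geometric series of ratio sqrt 2 is at most four times its last term; the induction
  step needs 4 \<le> 3 sqrt 2.\<close>

lemma sum_sqrt_pow2_le:
  fixes A :: "nat set"
  assumes "finite A" "Y \<ge> 0" "\<And>j. j \<in> A \<Longrightarrow> real (2 ^ j) \<le> Y"
  shows "(\<Sum>j\<in>A. sqrt (real (2 ^ j))) \<le> 4 * sqrt Y"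
proof (cases "A = {}")
  case False
  define k where "k = Max A"
  have k: "k \<in> A" "A \<subseteq> {..k}" using assms False by (auto simp: k_def)
  have s: "4 \<le> 3 * sqrt (2::real)" by (rule power2_le_imp_le) (auto simp: power_mult_distrib)
  have geo: "(\<Sum>j\<le>n. sqrt 2 ^ j) \<le> 4 * sqrt (2::real) ^ n" for n
  proof (induction n)
    case (Suc n)
    have "(\<Sum>j\<le>Suc n. sqrt 2 ^ j) \<le> 4 * sqrt (2::real) ^ n + sqrt 2 ^ Suc n" using Suc by simp
    also have "4 * sqrt (2::real) ^ n \<le> (3 * sqrt 2) * sqrt 2 ^ n" using s by (intro mult_right_mono) auto
    finally show ?case by simp
  qed simp
  have "(\<Sum>j\<in>A. sqrt (real (2 ^ j))) = (\<Sum>j\<in>A. sqrt 2 ^ j)" by (simp add: real_sqrt_power)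
  also have "\<dots> \<le> (\<Sum>j\<le>k. sqrt 2 ^ j)" using k by (intro sum_mono2) auto
  also have "\<dots> \<le> 4 * sqrt 2 ^ k" by (rule geo)
  also have "\<dots> = 4 * sqrt (real (2 ^ k))" by (simp add: real_sqrt_power)
  also have "\<dots> \<le> 4 * sqrt Y" using assms(3)[OF k(1)] by simp
  finally show ?thesis .
qed (use assms in auto)

text \<open>At most ln c / ln 2 + 1 powers of 2 fit into the interval, and 1 / ln 2 \<le> 2.\<close>

lemma card_pow2_range_le:
  fixes A :: "nat set"
  assumes "finite A" "y > 0" "c \<ge> 1" "\<And>j. j \<in> A \<Longrightarrow> y < real (2 ^ j) \<and> real (2 ^ j) \<le> y * c"
  shows "real (card A) \<le> 2 * ln c + 1"
proof (cases "A = {}")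
  case False
  define a b where "a = Min A" and "b = Max A"
  have ab: "a \<in> A" "b \<in> A" "A \<subseteq> {a..b}" using assms False by (auto simp: a_def b_def)
  then have "a \<le> b" by auto
  have "real (2 ^ (b - a)) * y \<le> c * y"
  proof -
    have "real (2 ^ (b - a)) * y \<le> real (2 ^ (b - a)) * real (2 ^ a)" 
      using assms(4)[OF ab(1)] by (intro mult_left_mono) auto
    also have "\<dots> = real (2 ^ b)" using \<open>a \<le> b\<close> by (simp flip: power_add)
    also have "\<dots> \<le> c * y" using assms(4)[OF ab(2)] by (simp add: mult.commute)
    finally show ?thesis .
  qed
  then have "2 ^ (b - a) \<le> c" using assms(2) by simp
  then have "ln (2 ^ (b - a)) \<le> ln c" using assms(3) by (subst ln_le_cancel_iff) auto
  then have "real (b - a) * ln 2 \<le> ln c" by (simp add: ln_realpow)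
  moreover have "real (b - a) * (1/2) \<le> real (b - a) * ln 2" using ln2_ge_half by (intro mult_left_mono) auto
  ultimately have "real (b - a) \<le> 2 * ln c" by simp
  moreover have "card A \<le> b - a + 1" using card_mono[OF _ ab(3)] \<open>a \<le> b\<close> by simp
  then have "real (card A) \<le> real (b - a + 1)" by (simp only: of_nat_le_iff)
  ultimately show ?thesis by simp
qed (use assms in auto)

text \<open>From j + 1 \<le> 2 (3/2)^j the radicand is at most 80 (3/4)^j, hence at most 81
  (49/64)^j = (9 (7/8)^j)^2; the geometric series then sums to 9 * 8 = 72.\<close>

lemma sum_sqrt_ln_pow2_le:
  fixes A :: "nat set"
  assumes "finite A"
  shows "(\<Sum>j\<in>A. sqrt (40 * ln (2 * real (2 ^ j)) / real (2 ^ j))) \<le> 72"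
proof -
  have pw: "real n + 1 \<le> 2 * (3/2) ^ n" for n
  proof (induction n)
    case (Suc n)
    then show ?case 
    proof (cases "n = 0")
      case False
      then have "real (Suc n) + 1 \<le> (real n + 1) * (3/2)" by (simp add: field_simps)
      then show ?thesis using Suc by simp
    qed simp
  qed simp
  have "(\<Sum>j\<in>A. sqrt (40 * ln (2 * real (2 ^ j)) / real (2 ^ j))) \<le> (\<Sum>j\<in>A. 9 * (7/8) ^ j)"
  proof (rule sum_mono)
    fix j
    have "ln (2 * real (2 ^ j)) = ln (2 ^ Suc j)" by simp
    also have "\<dots> = real (Suc j) * ln 2" by (rule ln_realpow)
    also have "\<dots> \<le> real (Suc j) * 1" using ln_2_less_1 by (intro mult_left_mono) auto
    also have "\<dots> \<le> 2 * (3/2) ^ j" using pw[of j] by simp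
    finally have "40 * ln (2 * real (2 ^ j)) / real (2 ^ j) \<le> 40 * (2 * (3/2) ^ j) / real (2 ^ j)"
      by (intro divide_right_mono) auto
    also have "\<dots> = 80 * (3/4) ^ j" by (simp add: power_divide flip: power_mult_distrib)
    also have "\<dots> \<le> 81 * (49/64) ^ j" by (intro mult_mono power_mono) auto
    also have "\<dots> = (9 * (7/8) ^ j)\<^sup>2" 
    proof -
      have "(49/64::real) = (7/8)\<^sup>2" by (simp add: power2_eq_square)
      then show ?thesis by (simp only: power_mult_distrib power_mult[symmetric] mult.commute) simp
    qed
    finally show "sqrt (40 * ln (2 * real (2 ^ j)) / real (2 ^ j)) \<le> 9 * (7/8) ^ j"
      by (intro real_le_lsqrt) auto
  qed
  also have "\<dots> = 9 * (\<Sum>j\<in>A. (7/8) ^ j)" by (simp add: sum_distrib_left)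
  also have "\<dots> \<le> 9 * (\<Sum>j. (7/8) ^ j)"
    using assms by (intro mult_left_mono sum_le_suminf summable_geometric) auto
  also have "\<dots> = 72" by (simp add: suminf_geometric)
  finally show ?thesis .
qed

context mult_exp_sum
begin

text \<open>Replacing the factor ln x by ln n costs the sum of ln x - ln n, which is at most x by
  Stirling. Then ln n is written as a divisor sum of \<Lambda> and the divisor is cut
  dyadically.\<close>

lemma exp_sum_le_blocks:
  assumes J: "real x \<le> real (2 ^ J)"
  shows "norm (exp_sum f \<alpha> x) * l \<le> real x + (\<Sum>j<J. norm (B (2 ^ j)))"
proof -
  define T where "T d = (\<Sum>m\<in>{0<..x div d}. (mangoldt d * f d) * f m * ee (real (m * d) * \<alpha>))" for d
  have "(\<Sum>n\<in>{0<..x}. of_real (ln (real n)) * (f n * ee (real n * \<alpha>))) = 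
      (\<Sum>n\<in>{0<..x}. of_real (\<Sum>d | d \<in> {0<..x} \<and> d dvd n. mangoldt d) * (f n * ee (real n * \<alpha>)))"
    using ln_conv_sum_mangoldt[of _ x] by (intro sum.cong refl) simp
  also have "\<dots> = (\<Sum>n\<in>{0<..x}. \<Sum>d | d \<in> {0<..x} \<and> d dvd n. mangoldt d * (f n * ee (real n * \<alpha>)))"
    by (simp only: of_real_sum sum_distrib_right of_real_mangoldt)
  also have "\<dots> = (\<Sum>d\<in>{0<..x}. \<Sum>j\<in>{0 div d<..x div d}. mangoldt d * (f (d * j) * ee (real (d * j) * \<alpha>)))"
    by (rule sum_divisors_swap)
  also have "\<dots> = (\<Sum>d\<in>{0<..x}. T d)"
    unfolding T_def by (intro sum.cong refl) (simp_all add: f_mult mult_ac)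
  also have "\<dots> = (\<Sum>d\<in>{0<..2^J}. T d)"
  proof (rule sum.mono_neutral_left)
    show "{0<..x} \<subseteq> {0<..2^J}" using J by (auto simp: of_nat_le_iff[symmetric, where ?'a = real] simp del: of_nat_power of_nat_le_iff intro: order_trans)
    show "\<forall>d\<in>{0<..2^J} - {0<..x}. T d = 0" by (auto simp: T_def)
  qed simp
  also have "\<dots> = (\<Sum>j<J. B (2 ^ j))"
  proof (induction J)
    case 0
    have "{0<..2^0} = {Suc 0}" by auto
    then show ?case by (simp add: T_def)
  next
    case (Suc J)
    have "{0<..2^Suc J} = {0<..2^J} \<union> {2^J<..2*2^J::nat}" by auto
    then have "(\<Sum>d\<in>{0<..2^Suc J}. T d) = (\<Sum>d\<in>{0<..2^J}. T d) + (\<Sum>d\<in>{2^J<..2*2^J}. T d)"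
      by (simp add: sum.union_disjoint)
    then show ?case using Suc by (simp add: B_def T_def)
  qed
  finally have 1: "(\<Sum>n\<in>{0<..x}. of_real (ln (real n)) * (f n * ee (real n * \<alpha>))) = (\<Sum>j<J. B (2 ^ j))" .
  have "of_real l * exp_sum f \<alpha> x = (\<Sum>n\<in>{0<..x}. of_real (ln (real n)) * (f n * ee (real n * \<alpha>))) + 
     (\<Sum>n\<in>{0<..x}. of_real (l - ln (real n)) * (f n * ee (real n * \<alpha>)))"
    unfolding exp_sum_def sum_distrib_left sum.distrib[symmetric] by (intro sum.cong) (auto simp: algebra_simps)
  then have "norm (of_real l * exp_sum f \<alpha> x) \<le> norm (\<Sum>j<J. B (2 ^ j)) + norm (\<Sum>n\<in>{0<..x}. of_real (l - ln (real n)) * (f n * ee (real n * \<alpha>)))"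
    unfolding 1 by (simp only: norm_triangle_ineq)
  also have "norm (\<Sum>n\<in>{0<..x}. of_real (l - ln (real n)) * (f n * ee (real n * \<alpha>))) \<le> (\<Sum>n\<in>{0<..x}. l - ln (real n))"
  proof (rule sum_norm_le)
    fix n assume n: "n \<in> {0<..x}"
    then have "l - ln (real n) \<ge> 0" by (simp add: l_def)
    then show "norm (of_real (l - ln (real n)) * (f n * ee (real n * \<alpha>))) \<le> l - ln (real n)"
      unfolding norm_mult norm_of_real norm_ee using f_le[of n] by (simp add: mult_left_le)
  qed
  also have "(\<Sum>n\<in>{0<..x}. l - ln (real n)) = real x * l - ln (fact x)"
  proof -
    have *: "{1..x} = {0<..x}" by auto
    have "ln (fact x :: real) = (\<Sum>k\<in>{0<..x}. ln (real k))"
      unfolding fact_prod * of_nat_prod by (rule ln_prod) auto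
    then show ?thesis by (simp add: sum_subtractf)
  qed
  also have "\<dots> \<le> real x" using ln_fact_ge[of x] by (simp add: l_def)
  also have "norm (\<Sum>j<J. B (2 ^ j)) \<le> (\<Sum>j<J. norm (B (2 ^ j)))" by (rule norm_sum)
  finally show ?thesis using l1 by (simp add: norm_mult mult.commute)
qed

text \<open>The dyadic P are cut at x / sqrt R and x / \<open>lam\<close>: \<open>B_bilinear\<close>
  below, \<open>B_sieve\<close> between, \<open>B_trivial\<close> above. The middle range has about
  ln R blocks, each with an error l / R^(1/4); the top range has at most 2 ln \<open>lam\<close> + 1
  blocks, each costing 8x.\<close>

theorem norm_exp_sum_large_denominator:
  "norm (exp_sum f \<alpha> x) * l \<le> real x * (271 + 59 * (l / sqrt (sqrt R)) * (ln R + 1) + 16 * ln lam)"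
proof -
  \<comment> \<open>Here \<open>q\<close> is the fourth root of R, not a modulus; \<open>lR\<close>
    says that l \<le> \<open>q\<close>.\<close>
  define q where "q = sqrt (sqrt R)"
  define J where "J = (LEAST J. x \<le> 2 ^ J)"
  have "x \<le> 2 ^ J" unfolding J_def by (rule LeastI[of _ x]) simp
  then have J: "real x \<le> real (2 ^ J)" by (simp only: of_nat_le_iff)
  have Jx: "2 ^ j \<le> x" if "j < J" for j
    using not_less_Least[of j "\<lambda>J. x \<le> 2 ^ J"] that by (simp add: J_def)
  have Jx': "real (2 ^ j) \<le> real x" if "j < J" for j
    using Jx[OF that] by (simp only: of_nat_le_iff)
  have q1: "q \<ge> 1" using R1 by (simp add: q_def)
  have qq: "q * q = sqrt R" using R1 by (simp add: q_def)
  have lq: "l / q \<le> 1" using lR q1 by (simp add: l_def q_def)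
  have lq0: "l / q \<ge> 0" using l1 q1 by simp
  define J1 where "J1 = {j\<in>{..<J}. real (2 ^ j) \<le> real x / sqrt R}"
  define J2 where "J2 = {j\<in>{..<J}. \<not> real (2 ^ j) \<le> real x / sqrt R \<and> real (2 ^ j) \<le> real x / lam}"
  define J3 where "J3 = {j\<in>{..<J}. \<not> real (2 ^ j) \<le> real x / sqrt R \<and> \<not> real (2 ^ j) \<le> real x / lam}"
  have fin: "finite J1" "finite J2" "finite J3" by (auto simp: J1_def J2_def J3_def)
  have sR: "sqrt R \<ge> 1" using R1 by simp
  have un: "{..<J} = J1 \<union> (J2 \<union> J3)" by (auto simp: J1_def J2_def J3_def)
  have cJ: "real J \<le> 3 * l"
  proof -
    have "real J \<le> 3 * l" if "J \<ge> 1"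
    proof -
      have "real (2 ^ (J - 1)) \<le> real x" using that by (intro Jx') auto
      then have "ln (real (2 ^ (J - 1))) \<le> l" unfolding l_def using x3 by (subst ln_le_cancel_iff) auto
      then have "real (J - 1) * ln 2 \<le> l" by (simp add: ln_realpow)
      moreover have "real (J - 1) * (1/2) \<le> real (J - 1) * ln 2" using ln2_ge_half by (intro mult_left_mono) auto
      ultimately have "real (J - 1) \<le> 2 * l" by simp
      then show ?thesis using that l1 by (simp add: of_nat_diff)
    qed
    then show ?thesis using l1 by (cases "J = 0") auto
  qed
  \<comment> \<open>The constant is 72 + 66 + 112: the convergent series, 22 times the 3l blocks,
    and 28 times the factor 4 of the geometric series, all with l / \<open>q\<close> \<le>
    1.\<close>
  have S1: "(\<Sum>j\<in>J1. norm (B (2 ^ j))) \<le> 250 * real x"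
  proof -
    have "(\<Sum>j\<in>J1. norm (B (2 ^ j))) \<le> (\<Sum>j\<in>J1. real x * sqrt (40 * ln (2 * real (2 ^ j)) / real (2 ^ j)) + 22 * real x * l / sqrt R + 28 * l * sqrt (real x * real (2 ^ j)))"
      using Jx by (intro sum_mono B_bilinear) (auto simp: J1_def)
    also have "\<dots> = real x * (\<Sum>j\<in>J1. sqrt (40 * ln (2 * real (2 ^ j)) / real (2 ^ j))) + real (card J1) * (22 * real x * l / sqrt R) + 28 * l * sqrt (real x) * (\<Sum>j\<in>J1. sqrt (real (2 ^ j)))"
      by (simp only: sum.distrib sum_distrib_left sum_constant real_sqrt_mult mult.assoc)
    also have "\<dots> \<le> real x * 72 + (3 * l) * (22 * real x * l / sqrt R) + 28 * l * sqrt (real x) * (4 * sqrt (real x / sqrt R))"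
    proof (intro add_mono mult_left_mono mult_right_mono)
      show "(\<Sum>j\<in>J1. sqrt (40 * ln (2 * real (2 ^ j)) / real (2 ^ j))) \<le> 72" using fin(1) by (rule sum_sqrt_ln_pow2_le)
      show "(\<Sum>j\<in>J1. sqrt (real (2 ^ j))) \<le> 4 * sqrt (real x / sqrt R)"
        using fin sR by (intro sum_sqrt_pow2_le) (auto simp: J1_def)
      have "card J1 \<le> card {..<J}" by (intro card_mono) (auto simp: J1_def)
      then show "real (card J1) \<le> 3 * l" using cJ by simp
    qed (use l1 sR in auto)
    also have "\<dots> = real x * 72 + 66 * real x * (l / q)\<^sup>2 + 112 * real x * (l / q)"
    proof -
      have "(l / q)\<^sup>2 = l * l / sqrt R" by (simp add: power2_eq_square qq)
      moreover have st: "sqrt (real x) * sqrt (real x / sqrt R) = real x / q"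
        by (simp add: real_sqrt_divide q_def)
      have "28 * l * s * (4 * t) = 112 * l * (s * t)" for s t :: real by simp
      then have "28 * l * sqrt (real x) * (4 * sqrt (real x / sqrt R)) = 112 * l * (real x / q)"
        by (simp only: st)
      ultimately show ?thesis by (simp add: mult_ac)
    qed
    also have "\<dots> \<le> real x * 72 + 66 * real x * 1 + 112 * real x * 1"
      using lq lq0 by (intro add_mono mult_left_mono) (auto simp: power_le_one)
    finally show ?thesis by simp
  qed
  have S2: "(\<Sum>j\<in>J2. norm (B (2 ^ j))) \<le> 12 * real x + 59 * real x * (l / q) * (ln R + 1)"
  proof -
    have lam0: "lam > 0" using lam_ge by simp
    have "(\<Sum>j\<in>J2. norm (B (2 ^ j))) \<le> (\<Sum>j\<in>J2. sqrt (8 * real x * lam) * sqrt (real (2 ^ j)) + 59 * real x * (l / q))"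
    proof (rule sum_mono)
      fix j assume j: "j \<in> J2"
      then have "norm (B (2 ^ j)) \<le> sqrt (8 * real x * real (2 ^ j) * lam) + 59 * real x * l / sqrt (sqrt R)"
        using Jx sR by (intro B_sieve) (auto simp: J2_def field_simps)
      moreover have "sqrt (8 * real x * real (2 ^ j) * lam) = sqrt (8 * real x * lam) * sqrt (real (2 ^ j))"
        by (simp add: real_sqrt_mult mult_ac)
      moreover have "59 * real x * l / sqrt (sqrt R) = 59 * real x * (l / q)" by (simp add: q_def)
      ultimately show "norm (B (2 ^ j)) \<le> sqrt (8 * real x * lam) * sqrt (real (2 ^ j)) + 59 * real x * (l / q)"
        by simp
    qed
    also have "\<dots> = sqrt (8 * real x * lam) * (\<Sum>j\<in>J2. sqrt (real (2 ^ j))) + real (card J2) * (59 * real x * (l / q))"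
      by (simp only: sum.distrib sum_distrib_left sum_constant)
    also have "\<dots> \<le> sqrt (8 * real x * lam) * (4 * sqrt (real x / lam)) + (ln R + 1) * (59 * real x * (l / q))"
    proof (intro add_mono mult_left_mono mult_right_mono)
      show "(\<Sum>j\<in>J2. sqrt (real (2 ^ j))) \<le> 4 * sqrt (real x / lam)"
        using fin lam0 by (intro sum_sqrt_pow2_le) (auto simp: J2_def)
      have "real (card J2) \<le> 2 * ln (sqrt R) + 1"
        using fin sR xpos Jx' by (intro card_pow2_range_le[where y = "real x / sqrt R"]) (auto simp: J2_def)
      then show "real (card J2) \<le> ln R + 1" using R1 by (simp add: ln_sqrt)
    qed (use lam0 l1 q1 in auto)
    also have "sqrt (8 * real x * lam) * (4 * sqrt (real x / lam)) = 4 * sqrt (8 * (real x)\<^sup>2)"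
      using lam0 by (simp add: real_sqrt_mult[symmetric] power2_eq_square)
    also have "\<dots> \<le> 4 * sqrt ((3 * real x)\<^sup>2)" by (simp add: power_mult_distrib)
    also have "\<dots> = 12 * real x" by (simp only: real_sqrt_abs)
    finally show ?thesis by (simp only: mult_ac)
  qed
  have S3: "(\<Sum>j\<in>J3. norm (B (2 ^ j))) \<le> 8 * real x + 16 * real x * ln lam"
  proof -
    have "(\<Sum>j\<in>J3. norm (B (2 ^ j))) \<le> (\<Sum>j\<in>J3. 8 * real x)"
      by (intro sum_mono B_trivial) auto
    also have "\<dots> = real (card J3) * (8 * real x)" by simp
    also have "\<dots> \<le> (2 * ln lam + 1) * (8 * real x)"
    proof (intro mult_right_mono card_pow2_range_le[where y = "real x / lam"])
      show "\<And>j. j \<in> J3 \<Longrightarrow> real x / lam < real (2 ^ j) \<and> real (2 ^ j) \<le> real x / lam * lam"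
        using Jx' lam_ge by (auto simp: J3_def)
    qed (use fin lam_ge xpos in auto)
    finally show ?thesis by (simp add: algebra_simps)
  qed
  have "norm (exp_sum f \<alpha> x) * l \<le> real x + (\<Sum>j<J. norm (B (2 ^ j)))"
    using J by (rule exp_sum_le_blocks)
  also have "(\<Sum>j<J. norm (B (2 ^ j))) = (\<Sum>j\<in>J1. norm (B (2 ^ j))) + ((\<Sum>j\<in>J2. norm (B (2 ^ j))) + (\<Sum>j\<in>J3. norm (B (2 ^ j))))"
  proof -
    have "J1 \<inter> (J2 \<union> J3) = {}" "J2 \<inter> J3 = {}" by (auto simp: J1_def J2_def J3_def)
    then show ?thesis unfolding un using fin by (simp add: sum.union_disjoint)
  qed
  finally have "norm (exp_sum f \<alpha> x) * l \<le> real x + (250 * real x + (12 * real x + 59 * real x * (l / q) * (ln R + 1)) + (8 * real x + 16 * real x * ln lam))"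
    using S1 S2 S3 by linarith
  \<comment> \<open>271 = 1 + 250 + 12 + 8, from the passage to ln n and from the three
    ranges.\<close>
  also have "\<dots> = real x * (271 + 59 * (l / q) * (ln R + 1) + 16 * ln lam)"
    by (simp add: algebra_simps)
  finally show ?thesis unfolding q_def .
qed

end

section \<open>Dirichlet characters\<close>

lemma dirichlet_character_cong:
  assumes "dirichlet_character q \<chi>" "[a = b] (mod int q)" shows "\<chi> a = \<chi> b"
proof -
  have per: "\<chi> (x + int q) = \<chi> x" for x using assms(1) by (simp add: dirichlet_character_def)
  have nat_per: "\<chi> (x + int n * int q) = \<chi> x" for x n
  proof (induction n)
    case (Suc n)
    have "x + int (Suc n) * int q = (x + int n * int q) + int q" by (simp add: algebra_simps)
    then show ?case using per[of "x + int n * int q"] Suc by (simp only:)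
  qed simp
  have "\<exists>k. a = b + int q * k" using assms(2) by (metis cong_iff_lin cong_sym)
  then obtain k where k: "a = b + int q * k" by blast
  show ?thesis
  proof (cases "k \<ge> 0")
    case True
    then show ?thesis using nat_per[of b "nat k"] k by (simp add: mult.commute)
  next
    case False
    then have "b = a + int (nat (- k)) * int q" using k by (simp add: algebra_simps)
    then show ?thesis using nat_per[of a "nat (- k)"] by simp
  qed
qed

lemma dirichlet_character_simps:
  assumes "dirichlet_character q \<chi>"
  shows "q > 0" "\<chi> (a * b) = \<chi> a * \<chi> b" "\<chi> a = 0 \<longleftrightarrow> \<not> coprime a (int q)" "\<chi> 1 = 1"
proof -
  show "q > 0" "\<chi> (a * b) = \<chi> a * \<chi> b" "\<chi> a = 0 \<longleftrightarrow> \<not> coprime a (int q)" 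
    using assms by (auto simp: dirichlet_character_def)
  have "\<chi> (1 * 1) = \<chi> 1 * \<chi> 1" "\<chi> 1 \<noteq> 0" using assms unfolding dirichlet_character_def by (blast, simp)
  then show "\<chi> 1 = 1" by simp
qed

lemma dirichlet_character_power:
  assumes "dirichlet_character q \<chi>" shows "\<chi> (a ^ n) = \<chi> a ^ n"
  by (induction n) (simp_all add: dirichlet_character_simps[OF assms])

lemma unit_power_totient:
  assumes "q > 0" "coprime a (int q)" shows "[a ^ totient q = 1] (mod int q)"
proof -
  have *: "[int (nat (a mod int q)) = a] (mod int q)" using assms by (simp add: cong_def)
  have "coprime (int (nat (a mod int q))) (int q)" using assms cong_imp_coprime[OF cong_sym[OF *]] by simp
  then have "coprime (nat (a mod int q)) q" by (simp only: coprime_int_iff)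
  then have "[nat (a mod int q) ^ totient q = 1] (mod q)" by (rule euler_theorem)
  then have "[int (nat (a mod int q)) ^ totient q = 1] (mod int q)"
    by (metis cong_int_iff of_nat_1 of_nat_power)
  then show ?thesis using cong_pow[OF *] cong_sym cong_trans by blast
qed

lemma dirichlet_character_power_totient:
  assumes "dirichlet_character q \<chi>" "coprime a (int q)" shows "\<chi> a ^ totient q = 1"
  using dirichlet_character_cong[OF assms(1) unit_power_totient[OF _ assms(2)]] assms(1)
  by (simp add: dirichlet_character_simps dirichlet_character_power)

lemma norm_dirichlet_character:
  assumes "dirichlet_character q \<chi>" shows "norm (\<chi> a) = (if coprime a (int q) then 1 else 0)"
proof (cases "coprime a (int q)")
  case True
  have "norm (\<chi> a) ^ totient q = 1"
    using dirichlet_character_power_totient[OF assms True] by (metis norm_one norm_power)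
  moreover have "totient q > 0" using dirichlet_character_simps(1)[OF assms] by simp
  ultimately have "norm (\<chi> a) = 1"
    using power_eq_iff_eq_base[of "totient q" "norm (\<chi> a)" 1] by simp
  then show ?thesis using True by simp
qed (use dirichlet_character_simps(3)[OF assms] in auto)

lemma norm_dirichlet_character_le: "dirichlet_character q \<chi> \<Longrightarrow> norm (\<chi> a) \<le> 1"
  by (simp add: norm_dirichlet_character)

section \<open>Existence of characters by simultaneous diagonalisation of shifts\<close>

lemma ee_fraction_neq_1:
  fixes i n :: nat assumes "0 < i" "i < n" shows "ee (real i / real n) \<noteq> 1"
proof
  assume "ee (real i / real n) = 1"
  then have "int_dist (real i / real n) \<le> 0" using norm_1_minus_ee_ge[of "real i / real n"] by simp
  moreover have 1: "0 < real i / real n" "real i / real n < 1" using assms by auto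
  then have "frac (real i / real n) = real i / real n" by (simp add: frac_eq)
  ultimately show False using 1 by (simp add: int_dist_def)
qed

lemma sum_roots_of_unity:
  fixes n i :: nat
  assumes "n > 0" "i < n"
  shows "(\<Sum>k<n. ee (- (real i * real k / real n))) = (if i = 0 then of_nat n else 0)"
proof (cases "i = 0")
  case False
  define w where "w = ee (- (real i / real n))"
  have "(\<Sum>k<n. ee (- (real i * real k / real n))) = (\<Sum>k<n. w ^ k)"
    unfolding w_def ee_power by (intro sum.cong) (auto simp: mult_ac)
  moreover have "w ^ n = 1"
  proof -
    have "w ^ n = ee (of_int (- int i))" unfolding w_def ee_power using assms by simp
    then show ?thesis by (simp only: ee_of_int)
  qed
  moreover have "w \<noteq> 1"
    using ee_fraction_neq_1[of i n] False assms unfolding w_def cnj_ee[symmetric]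
    by (metis complex_cnj_cnj complex_cnj_one gr0I)
  ultimately show ?thesis using False geometric_sum[of w n] by simp
qed simp

text \<open>Projection onto an eigenspace of the shift \<open>f \<mapsto> (\<lambda>x. f (g * x))\<close>, an operator of finite order. A common
  eigenfunction of all shifts by units is, up to scaling, a character.\<close>
definition shift_filter :: "int \<Rightarrow> nat \<Rightarrow> nat \<Rightarrow> (int \<Rightarrow> complex) \<Rightarrow> int \<Rightarrow> complex" where
  "shift_filter g n k f x = (\<Sum>i<n. ee (- (real i * real k / real n)) * f (g ^ i * x)) / of_nat n"

text \<open>The shift moves the index i to i + 1; the term that leaves and the term that enters
  agree, since g^n acts trivially and the phase has period n.\<close>

lemma shift_filter_eigen:
  assumes "n > 0" and per: "\<And>x. f (g ^ n * x) = f x"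
  shows "shift_filter g n k f (g * x) = ee (real k / real n) * shift_filter g n k f x"
proof -
  define F where "F i = ee (- (real i * real k / real n)) * f (g ^ i * x)" for i
  have *: "ee (- (real i * real k / real n)) * f (g ^ i * (g * x)) = ee (real k / real n) * F (Suc i)" for i
  proof -
    have "- (real i * real k / real n) = real k / real n + - (real (Suc i) * real k / real n)"
      using assms by (simp add: field_simps)
    then have "ee (- (real i * real k / real n)) = ee (real k / real n) * ee (- (real (Suc i) * real k / real n))"
      by (simp only: ee_add)
    then show ?thesis by (simp add: F_def mult_ac)
  qed
  have "F n = F 0"
  proof -
    have "ee (- (real n * real k / real n)) = ee (of_int (- int k))" using assms by simp
    then show ?thesis using per by (simp only: F_def ee_of_int) simp
  qed
  then have "(\<Sum>i<n. F (Suc i)) = (\<Sum>i<n. F i)"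
    using sum.lessThan_Suc_shift[of F n] by simp
  then show ?thesis unfolding shift_filter_def * by (simp add: F_def sum_distrib_left[symmetric])
qed

lemma sum_shift_filter:
  assumes "n > 0" shows "(\<Sum>k<n. shift_filter g n k f x) = f x"
proof -
  have "(\<Sum>k<n. shift_filter g n k f x) = (\<Sum>k<n. \<Sum>i<n. ee (- (real i * real k / real n)) * f (g ^ i * x)) / of_nat n"
    by (simp add: shift_filter_def sum_divide_distrib)
  also have "(\<Sum>k<n. \<Sum>i<n. ee (- (real i * real k / real n)) * f (g ^ i * x)) = (\<Sum>i<n. (\<Sum>k<n. ee (- (real i * real k / real n))) * f (g ^ i * x))"
    by (subst sum.swap) (simp add: sum_distrib_right)
  also have "\<dots> = (\<Sum>i<n. if i = 0 then of_nat n * f x else 0)"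
    using assms by (intro sum.cong refl, subst sum_roots_of_unity) auto
  also have "\<dots> = of_nat n * f x" using assms by simp
  finally show ?thesis using assms by simp
qed

text \<open>Functions on the unit group modulo s, extended by zero to the integers; the space is
  stable under shifts by units.\<close>

definition unit_function :: "nat \<Rightarrow> (int \<Rightarrow> complex) \<Rightarrow> bool" where
  "unit_function s f \<longleftrightarrow> (\<forall>x y. [x = y] (mod int s) \<longrightarrow> f x = f y) \<and> (\<forall>x. \<not> coprime x (int s) \<longrightarrow> f x = 0)"

definition shift_eigen :: "(int \<Rightarrow> complex) \<Rightarrow> int \<Rightarrow> complex \<Rightarrow> bool" where
  "shift_eigen f g c \<longleftrightarrow> (\<forall>x. f (g * x) = c * f x)"

text \<open>The projections of f sum to f, so one of them is nonzero. Shifts commute, hence the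
  eigenvalues that f already has survive the projection.\<close>

lemma shift_filter_step:
  assumes s: "s > 0" "coprime g (int s)" and f: "unit_function s f" "f x0 \<noteq> 0"
  obtains k y where "unit_function s (shift_filter g (totient s) k f)" "shift_filter g (totient s) k f y \<noteq> 0"
    "shift_eigen (shift_filter g (totient s) k f) g (ee (real k / real (totient s)))" "k < totient s"
    "\<And>h c. shift_eigen f h c \<Longrightarrow> shift_eigen (shift_filter g (totient s) k f) h c"
proof -
  define n where "n = totient s"
  have n: "n > 0" using s by (simp add: n_def)
  have per: "f (g ^ n * x) = f x" for x
    using f(1) cong_mult[OF unit_power_totient[OF s] cong_refl[of x]] by (auto simp: unit_function_def n_def)
  have "\<exists>k<n. shift_filter g n k f x0 \<noteq> 0"
  proof (rule ccontr)
    assume "\<not> ?thesis"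
    then have "(\<Sum>k<n. shift_filter g n k f x0) = 0" by simp
    then show False using sum_shift_filter[OF n] f(2) by simp
  qed
  then obtain k where k: "k < n" "shift_filter g n k f x0 \<noteq> 0" by blast
  have "unit_function s (shift_filter g n k f)"
    unfolding unit_function_def
  proof (intro conjI allI impI)
    fix x y assume "[x = y] (mod int s)"
    then have "f (g ^ i * x) = f (g ^ i * y)" for i
      using f(1) by (auto simp: unit_function_def cong_scalar_left)
    then show "shift_filter g n k f x = shift_filter g n k f y" by (simp add: shift_filter_def)
  next
    fix x assume "\<not> coprime x (int s)"
    then have "f (g ^ i * x) = 0" for i using f(1) by (auto simp: unit_function_def)
    then show "shift_filter g n k f x = 0" by (simp add: shift_filter_def)
  qed
  moreover have "shift_eigen (shift_filter g n k f) g (ee (real k / real n))"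
    unfolding shift_eigen_def using shift_filter_eigen[where f = f and g = g, OF n] per by blast
  moreover have "shift_eigen (shift_filter g n k f) h c" if "shift_eigen f h c" for h c
  proof -
    have "f (g ^ i * (h * x)) = c * f (g ^ i * x)" for i x
      using that unfolding shift_eigen_def by (metis mult.left_commute)
    then show ?thesis by (simp add: shift_eigen_def shift_filter_def sum_distrib_left mult_ac)
  qed
  ultimately show ?thesis using k that unfolding n_def by blast
qed

text \<open>Units are added one at a time. The start is the indicator of the class of 1 minus its
  shift by a: the projection of this difference to the eigenvalue 1 telescopes to 0, so a nonzero
  projection has another eigenvalue.\<close>

lemma exists_common_eigenfunction:
  assumes s: "s > 0" and a: "coprime a (int s)" "\<not> [a = 1] (mod int s)"
    and F: "finite F" "\<And>g. g \<in> F \<Longrightarrow> coprime g (int s)"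
  shows "\<exists>f c. unit_function s f \<and> (\<exists>x. f x \<noteq> 0) \<and> shift_eigen f a c \<and> c \<noteq> 1 \<and> (\<forall>g\<in>F. \<exists>d. shift_eigen f g d)"
  using F
proof (induction F rule: finite_induct)
  case empty
  define n where "n = totient s"
  have n: "n > 0" using s by (simp add: n_def)
  define d where "d x = (if [x = 1] (mod int s) then 1 else 0 :: complex)" for x
  define f where "f x = d x - d (a * x)" for x
  have d_cong: "d x = d y" if "[x = y] (mod int s)" for x y
    unfolding d_def using cong_trans[OF that] cong_trans[OF cong_sym[OF that]] by auto
  have d_unit: "d x = 0" if "\<not> coprime x (int s)" for x
    using that cong_imp_coprime[OF cong_sym, of x 1 "int s"] by (auto simp: d_def)
  have uf: "unit_function s f"
    unfolding unit_function_def
  proof (intro conjI allI impI)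
    fix x y assume "[x = y] (mod int s)"
    then show "f x = f y" unfolding f_def using d_cong[of x y] d_cong[of "a * x" "a * y"] cong_scalar_left by auto
  next
    fix x assume "\<not> coprime x (int s)"
    then show "f x = 0" unfolding f_def using d_unit[of x] d_unit[of "a * x"] by auto
  qed
  have "f 1 \<noteq> 0" using a by (simp add: f_def d_def)
  from shift_filter_step[OF s a(1) uf this] obtain k y where
    k: "unit_function s (shift_filter a (totient s) k f)" "shift_filter a (totient s) k f y \<noteq> 0"
    "shift_eigen (shift_filter a (totient s) k f) a (ee (real k / real (totient s)))" "k < totient s"
    by metis
  have "k \<noteq> 0"
  proof
    assume "k = 0"
    then have "shift_filter a n k f y = (\<Sum>i<n. f (a ^ i * y)) / of_nat n" by (simp add: shift_filter_def)
    also have "(\<Sum>i<n. f (a ^ i * y)) = (\<Sum>i<n. d (a ^ i * y) - d (a ^ Suc i * y))" by (simp add: f_def mult_ac)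
    also have "\<dots> = d (a ^ 0 * y) - d (a ^ n * y)" by (rule sum_lessThan_telescope')
    also have "d (a ^ n * y) = d (1 * y)"
      unfolding n_def by (intro d_cong cong_mult unit_power_totient s a cong_refl)
    finally show False using k(2) by (simp add: n_def)
  qed
  have "ee (real k / real n) \<noteq> 1"
    using \<open>k \<noteq> 0\<close> k(4) by (intro ee_fraction_neq_1) (auto simp: n_def)
  then show ?case using k unfolding n_def by blast
next
  case (insert g F)
  then obtain f c x where f: "unit_function s f" "f x \<noteq> 0" "shift_eigen f a c" "c \<noteq> 1" "\<forall>g\<in>F. \<exists>d. shift_eigen f g d"
    by blast
  from shift_filter_step[OF s _ f(1,2), of g] insert.prems obtain k y where
    k: "unit_function s (shift_filter g (totient s) k f)" "shift_filter g (totient s) k f y \<noteq> 0"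
    "shift_eigen (shift_filter g (totient s) k f) g (ee (real k / real (totient s)))"
    "\<And>h c. shift_eigen f h c \<Longrightarrow> shift_eigen (shift_filter g (totient s) k f) h c"
    by (metis insertI1)
  have "\<exists>d. shift_eigen (shift_filter g (totient s) k f) h d" if "h \<in> insert g F" for h
    using that k(3,4) f(5) by blast
  moreover have "shift_eigen (shift_filter g (totient s) k f) a c" using f(3) by (rule k(4))
  ultimately show ?case using k(1,2) f(4) by blast
qed

text \<open>If f is an eigenfunction of every unit shift, the eigenvalue is multiplicative in the
  unit and is a character; its value at a is the eigenvalue that was kept different from 1.\<close>

lemma characters_separate:
  assumes s: "s > 0" and a: "coprime a (int s)" "\<not> [a = 1] (mod int s)"
  shows "\<exists>\<psi>. dirichlet_character s \<psi> \<and> \<psi> a \<noteq> 1"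
proof -
  define U where "U = {u \<in> {0..<int s}. coprime u (int s)}"
  have "finite U" unfolding U_def by (rule finite_subset[of _ "{0..<int s}"]) auto
  moreover have "coprime g (int s)" if "g \<in> U" for g using that by (simp add: U_def)
  ultimately obtain f c x0 where f: "unit_function s f" "f x0 \<noteq> 0" "shift_eigen f a c" "c \<noteq> 1" "\<forall>g\<in>U. \<exists>d. shift_eigen f g d"
    using exists_common_eigenfunction[OF s a, of U] by blast
  have eig: "\<exists>d. shift_eigen f g d" if "coprime g (int s)" for g
  proof -
    have "g mod int s \<in> U" using that s by (auto simp: U_def coprime_mod_left_iff)
    then obtain d where "shift_eigen f (g mod int s) d" using f(5) by blast
    moreover have "f (g mod int s * x) = f (g * x)" for x
      using f(1) unfolding unit_function_def by (metis cong_mod_left cong_refl cong_scalar_right)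
    ultimately show ?thesis by (auto simp: shift_eigen_def)
  qed
  define ev where "ev g = (if coprime g (int s) then f (g * x0) / f x0 else 0)" for g
  have ev: "f (g * x) = ev g * f x" if "coprime g (int s)" for g x
    using eig[OF that] f(2) that by (auto simp: ev_def shift_eigen_def)
  have "dirichlet_character s ev"
    unfolding dirichlet_character_def
  proof (intro conjI allI)
    fix g h
    show "ev (g * h) = ev g * ev h"
    proof (cases "coprime g (int s) \<and> coprime h (int s)")
      case True
      then have "ev (g * h) * f x0 = f ((g * h) * x0)" by (intro ev[symmetric]) simp
      also have "\<dots> = (ev g * ev h) * f x0"
        using True by (simp only: mult.assoc ev)
      finally have "ev (g * h) * f x0 = (ev g * ev h) * f x0" .
      then show ?thesis using f(2) mult_cancel_right by blast
    qed (auto simp: ev_def)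
    have "f ((g + int s) * x0) = f (g * x0)"
    proof -
      have "[(g + int s) * x0 = g * x0] (mod int s)" by (intro cong_scalar_right) (simp add: cong_def)
      then show ?thesis using f(1) unfolding unit_function_def by blast
    qed
    moreover have "coprime (g + int s) (int s) = coprime g (int s)"
      by (metis coprime_iff_gcd_eq_1 gcd_add1)
    ultimately show "ev (g + int s) = ev g" by (simp add: ev_def)
    show "ev g \<noteq> 0 \<longleftrightarrow> coprime g (int s)"
    proof
      assume g: "coprime g (int s)"
      have "f (g ^ n * x0) = ev g ^ n * f x0" for n
        by (induction n) (simp_all add: ev[OF g] mult.assoc)
      moreover have "f (g ^ totient s * x0) = f (1 * x0)"
        using f(1) cong_mult[OF unit_power_totient[OF s g] cong_refl[of x0]] unfolding unit_function_def by blast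
      ultimately have "ev g ^ totient s = 1" using f(2) by simp
      then show "ev g \<noteq> 0" using s by (auto simp: power_0_left)
    qed (simp add: ev_def split: if_splits)
  qed (use s in auto)
  moreover have "ev a \<noteq> 1"
    using f(2-4) a(1) unfolding shift_eigen_def ev_def by simp
  ultimately show ?thesis by blast
qed

definition characters :: "nat \<Rightarrow> (int \<Rightarrow> complex) set" where
  "characters s = {\<psi>. dirichlet_character s \<psi>}"

text \<open>Restriction to one period is injective, and all values are 0 or roots of unity of
  exponent \<open>totient s\<close>.\<close>

lemma finite_characters:
  assumes s: "s > 0" shows "finite (characters s)"
proof (rule finite_imageD)
  have "(\<lambda>\<psi>. restrict \<psi> {0..<int s}) ` characters s \<subseteq> PiE {0..<int s} (\<lambda>_. insert 0 {z. z ^ totient s = 1})"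
  proof (clarsimp simp: characters_def PiE_iff)
    fix \<psi> x assume "dirichlet_character s \<psi>" "\<psi> x ^ totient s \<noteq> 1"
    then show "\<psi> x = 0" using dirichlet_character_power_totient dirichlet_character_simps(3) by blast
  qed
  moreover have "finite (PiE {0..<int s} (\<lambda>_. insert (0::complex) {z. z ^ totient s = 1}))"
    using s by (intro finite_PiE) (auto intro!: finite_roots_unity simp: Suc_le_eq)
  ultimately show "finite ((\<lambda>\<psi>. restrict \<psi> {0..<int s}) ` characters s)" by (rule finite_subset)
  show "inj_on (\<lambda>\<psi>. restrict \<psi> {0..<int s}) (characters s)"
  proof (rule inj_onI, rule ext)
    fix \<psi> \<psi>' x assume *: "\<psi> \<in> characters s" "\<psi>' \<in> characters s" "restrict \<psi> {0..<int s} = restrict \<psi>' {0..<int s}"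
    have "\<psi> (x mod int s) = \<psi>' (x mod int s)"
      using fun_cong[OF *(3), of "x mod int s"] s by (simp split: if_splits)
    moreover have "\<psi> (x mod int s) = \<psi> x" "\<psi>' (x mod int s) = \<psi>' x"
      using *(1,2) by (auto simp: characters_def cong_def intro!: dirichlet_character_cong)
    ultimately show "\<psi> x = \<psi>' x" by simp
  qed
qed

section \<open>Products of characters, orthogonality, and expansion of functions on the
  units\<close>

lemma dirichlet_character_mult:
  assumes "dirichlet_character q \<chi>" "dirichlet_character s \<psi>"
  shows "dirichlet_character (q * s) (\<lambda>a. \<chi> a * \<psi> a)"
  unfolding dirichlet_character_def
proof (intro conjI allI)
  fix a
  have "\<chi> (a + int (q * s)) = \<chi> a" "\<psi> (a + int (q * s)) = \<psi> a"
    using assms by (auto intro!: dirichlet_character_cong simp: cong_def)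
  then show "\<chi> (a + int (q * s)) * \<psi> (a + int (q * s)) = \<chi> a * \<psi> a" by simp
qed (use assms in \<open>auto simp: dirichlet_character_simps\<close>)

lemma dirichlet_character_mult_same:
  assumes "dirichlet_character s \<chi>" "dirichlet_character s \<psi>"
  shows "dirichlet_character s (\<lambda>a. \<chi> a * \<psi> a)"
  using assms by (auto simp: dirichlet_character_def)

lemma principal_dirichlet_character: "s > 0 \<Longrightarrow> dirichlet_character s (principal_character s)"
  unfolding dirichlet_character_def principal_character_def
  by (auto simp: coprime_iff_gcd_eq_1[of "_ + _"])

text \<open>Multiplication by a character \<phi> with \<phi> a \<noteq> 1 permutes
  \<open>characters s\<close>, so the sum equals \<phi> a times itself. The number of characters is
  left as a cardinality; it cancels in \<open>character_expansion\<close>.\<close>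

lemma sum_characters:
  assumes s: "s > 0" and a: "coprime a (int s)"
  shows "(\<Sum>\<psi>\<in>characters s. \<psi> a) = (if [a = 1] (mod int s) then of_nat (card (characters s)) else 0)"
proof (cases "[a = 1] (mod int s)")
  case True
  have "(\<Sum>\<psi>\<in>characters s. \<psi> a) = (\<Sum>\<psi>\<in>characters s. 1)"
  proof (rule sum.cong[OF refl])
    fix \<psi> assume "\<psi> \<in> characters s"
    then show "\<psi> a = 1" using dirichlet_character_cong[OF _ True] by (simp add: characters_def dirichlet_character_simps)
  qed
  then show ?thesis using True by simp
next
  case False
  then obtain \<phi> where \<phi>: "dirichlet_character s \<phi>" "\<phi> a \<noteq> 1" using characters_separate[OF s a] by blast
  define T where "T \<psi> = (\<lambda>a. \<phi> a * \<psi> a)" for \<psi>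
  have "T ` characters s \<subseteq> characters s"
    using \<phi> dirichlet_character_mult_same by (auto simp: T_def characters_def)
  moreover have inj: "inj_on T (characters s)"
  proof (rule inj_onI, rule ext)
    fix \<psi> \<psi>' x assume *: "\<psi> \<in> characters s" "\<psi>' \<in> characters s" "T \<psi> = T \<psi>'"
    show "\<psi> x = \<psi>' x"
    proof (cases "coprime x (int s)")
      case True
      then have "\<phi> x \<noteq> 0" using dirichlet_character_simps(3)[OF \<phi>(1)] by blast
      then show ?thesis using fun_cong[OF *(3), of x] by (simp add: T_def)
    next
      case False
      then have "\<psi> x = 0" "\<psi>' x = 0" using *(1,2) by (auto simp: characters_def dirichlet_character_simps(3))
      then show ?thesis by simp
    qed
  qed
  ultimately have "T ` characters s = characters s" 
    using endo_inj_surj[OF finite_characters[OF s]] by blast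
  then have "(\<Sum>\<psi>\<in>characters s. \<psi> a) = (\<Sum>\<psi>\<in>T ` characters s. \<psi> a)" by simp
  also have "\<dots> = (\<Sum>\<psi>\<in>characters s. T \<psi> a)" by (simp add: sum.reindex[OF inj])
  also have "\<dots> = \<phi> a * (\<Sum>\<psi>\<in>characters s. \<psi> a)" by (simp add: T_def sum_distrib_left)
  finally have "(1 - \<phi> a) * (\<Sum>\<psi>\<in>characters s. \<psi> a) = 0" by (simp add: algebra_simps)
  then show ?thesis using \<phi>(2) False by simp
qed

text \<open>Conjugation inverts a character value, so the summand is the value at x times an inverse
  of h.\<close>

lemma sum_characters_cnj:
  assumes s: "s > 0" and a: "coprime h (int s)" "coprime x (int s)"
  shows "(\<Sum>\<psi>\<in>characters s. cnj (\<psi> h) * \<psi> x) = (if [x = h] (mod int s) then of_nat (card (characters s)) else 0)"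
proof -
  obtain h' where h': "[h * h' = 1] (mod int s)" using a(1) by (metis cong_solve_coprime_int)
  have cop: "coprime h' (int s)" using cong_imp_coprime[OF cong_sym[OF h']] by simp
  have "cnj (\<psi> h) = \<psi> h'" if "\<psi> \<in> characters s" for \<psi>
  proof -
    have d: "dirichlet_character s \<psi>" using that by (simp add: characters_def)
    have 1: "\<psi> h * \<psi> h' = 1"
      using dirichlet_character_cong[OF d h'] by (simp add: dirichlet_character_simps[OF d])
    have "\<psi> h * cnj (\<psi> h) = 1"
      using norm_dirichlet_character[OF d, of h] a(1) by (simp flip: complex_norm_square)
    then show ?thesis using 1 by (metis mult_cancel_left mult_zero_left zero_neq_one)
  qed
  then have "(\<Sum>\<psi>\<in>characters s. cnj (\<psi> h) * \<psi> x) = (\<Sum>\<psi>\<in>characters s. \<psi> (h' * x))"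
    by (intro sum.cong) (auto simp: characters_def dirichlet_character_simps)
  also have "\<dots> = (if [h' * x = 1] (mod int s) then of_nat (card (characters s)) else 0)"
    using s a cop by (intro sum_characters) auto
  also have "[h' * x = 1] (mod int s) \<longleftrightarrow> [x = h] (mod int s)"
  proof
    assume "[h' * x = 1] (mod int s)"
    then have "[h * (h' * x) = h * 1] (mod int s)" by (rule cong_scalar_left)
    moreover have "[h * h' * x = 1 * x] (mod int s)" using h' by (rule cong_scalar_right)
    ultimately show "[x = h] (mod int s)" by (simp add: mult.assoc) (metis cong_sym cong_trans)
  next
    assume "[x = h] (mod int s)"
    then have "[h' * x = h' * h] (mod int s)" by (rule cong_scalar_left)
    then show "[h' * x = 1] (mod int s)" using h' by (metis cong_trans mult.commute)
  qed
  finally show ?thesis .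
qed

text \<open>Fourier expansion on the unit group. With N characters, Parseval gives the sum of |c|^2
  as the sum of |F|^2 over the units divided by N, and Cauchy-Schwarz over the characters returns
  the factor N. What remains is the square root of a sum of at most s terms, each at most 1.\<close>

lemma character_expansion:
  assumes s: "s > 0" and F: "\<And>x y. [x = y] (mod int s) \<Longrightarrow> F x = F y" "\<And>x. norm (F x) \<le> 1"
  shows "\<exists>c. (\<forall>x. coprime x (int s) \<longrightarrow> F x = (\<Sum>\<psi>\<in>characters s. c \<psi> * \<psi> x)) \<and> 
     (\<Sum>\<psi>\<in>characters s. norm (c \<psi>)) \<le> sqrt (real s)"
proof -
  define U where "U = {u \<in> {0..<int s}. coprime u (int s)}"
  define N where "N = card (characters s)"
  define c where "c \<psi> = (\<Sum>h\<in>U. F h * cnj (\<psi> h)) / of_nat N" for \<psi> :: "int \<Rightarrow> complex"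
  have "finite U" unfolding U_def by (rule finite_subset[of _ "{0..<int s}"]) auto
  then have fin: "finite (characters s)" "finite U" using finite_characters[OF s] by auto
  have N: "N > 0" unfolding N_def using fin principal_dirichlet_character[OF s] by (auto simp: card_gt_0_iff characters_def)
  have U: "coprime h (int s)" if "h \<in> U" for h using that by (simp add: U_def)
  have Ueq: "[x = h] (mod int s) \<longleftrightarrow> x mod int s = h" if "h \<in> U" for x h
    using that by (auto simp: U_def cong_def)
  have "F x = (\<Sum>\<psi>\<in>characters s. c \<psi> * \<psi> x)" if x: "coprime x (int s)" for x
  proof -
    have "(\<Sum>\<psi>\<in>characters s. c \<psi> * \<psi> x) = (\<Sum>\<psi>\<in>characters s. \<Sum>h\<in>U. F h * (cnj (\<psi> h) * \<psi> x)) / of_nat N"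
      by (simp add: c_def sum_divide_distrib sum_distrib_right sum_distrib_left mult_ac)
    also have "(\<Sum>\<psi>\<in>characters s. \<Sum>h\<in>U. F h * (cnj (\<psi> h) * \<psi> x)) = (\<Sum>h\<in>U. F h * (\<Sum>\<psi>\<in>characters s. cnj (\<psi> h) * \<psi> x))"
      by (subst sum.swap) (simp add: sum_distrib_left)
    also have "\<dots> = (\<Sum>h\<in>U. if h = x mod int s then F h * of_nat N else 0)"
      using U x by (intro sum.cong refl) (auto simp: sum_characters_cnj[OF s] N_def Ueq)
    also have "\<dots> = F (x mod int s) * of_nat N"
    proof -
      have "x mod int s \<in> U" using x s by (auto simp: U_def coprime_mod_left_iff)
      then show ?thesis using fin by simp
    qed
    also have "F (x mod int s) = F x" by (rule F(1)) (simp add: cong_def)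
    finally show ?thesis using N by simp
  qed
  moreover have "(\<Sum>\<psi>\<in>characters s. norm (c \<psi>)) \<le> sqrt (real s)"
  proof (rule real_le_rsqrt)
    have "complex_of_real (\<Sum>\<psi>\<in>characters s. (norm (c \<psi>))\<^sup>2) = (\<Sum>\<psi>\<in>characters s. c \<psi> * cnj (c \<psi>))"
      by (simp add: complex_norm_square[symmetric] of_real_sum of_real_power)
    also have "\<dots> = (\<Sum>\<psi>\<in>characters s. \<Sum>h\<in>U. \<Sum>k\<in>U. F h * cnj (F k) * (cnj (\<psi> h) * \<psi> k)) / (of_nat N)\<^sup>2"
    proof -
      have "c \<psi> * cnj (c \<psi>) = (\<Sum>h\<in>U. \<Sum>k\<in>U. F h * cnj (F k) * (cnj (\<psi> h) * \<psi> k)) / (of_nat N)\<^sup>2" for \<psi>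
      proof -
        have "c \<psi> * cnj (c \<psi>) = ((\<Sum>h\<in>U. F h * cnj (\<psi> h)) * (\<Sum>k\<in>U. cnj (F k) * \<psi> k)) / (of_nat N)\<^sup>2"
          by (simp add: c_def power2_eq_square)
        also have "(\<Sum>h\<in>U. F h * cnj (\<psi> h)) * (\<Sum>k\<in>U. cnj (F k) * \<psi> k) = (\<Sum>h\<in>U. \<Sum>k\<in>U. F h * cnj (F k) * (cnj (\<psi> h) * \<psi> k))"
          unfolding sum_product by (intro sum.cong refl) (simp only: mult_ac)
        finally show ?thesis .
      qed
      then show ?thesis by (simp add: sum_divide_distrib)
    qed
    also have "(\<Sum>\<psi>\<in>characters s. \<Sum>h\<in>U. \<Sum>k\<in>U. F h * cnj (F k) * (cnj (\<psi> h) * \<psi> k)) = 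
        (\<Sum>h\<in>U. \<Sum>\<psi>\<in>characters s. \<Sum>k\<in>U. F h * cnj (F k) * (cnj (\<psi> h) * \<psi> k))" by (rule sum.swap)
    also have "\<dots> = (\<Sum>h\<in>U. \<Sum>k\<in>U. F h * cnj (F k) * (\<Sum>\<psi>\<in>characters s. cnj (\<psi> h) * \<psi> k))"
      unfolding sum_distrib_left by (intro sum.cong refl sum.swap)
    also have "\<dots> = (\<Sum>h\<in>U. \<Sum>k\<in>U. if k = h then F h * cnj (F k) * of_nat N else 0)"
    proof (intro sum.cong refl)
      fix h k assume hk: "h \<in> U" "k \<in> U"
      have "[k = h] (mod int s) \<longleftrightarrow> k = h" using hk by (auto simp: U_def cong_def)
      then show "F h * cnj (F k) * (\<Sum>\<psi>\<in>characters s. cnj (\<psi> h) * \<psi> k) = (if k = h then F h * cnj (F k) * of_nat N else 0)"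
        using U hk by (simp add: sum_characters_cnj[OF s] N_def)
    qed
    also have "\<dots> = (\<Sum>h\<in>U. F h * cnj (F h) * of_nat N)" using fin by simp
    also have "\<dots> = complex_of_real (\<Sum>h\<in>U. (norm (F h))\<^sup>2) * of_nat N"
      by (simp add: complex_norm_square[symmetric] of_real_sum of_real_power sum_distrib_right)
    also have "\<dots> / (of_nat N)\<^sup>2 = complex_of_real ((\<Sum>h\<in>U. (norm (F h))\<^sup>2) / real N)"
      using N by (simp add: power2_eq_square)
    finally have eq: "(\<Sum>\<psi>\<in>characters s. (norm (c \<psi>))\<^sup>2) = (\<Sum>h\<in>U. (norm (F h))\<^sup>2) / real N"
      by (simp only: of_real_eq_iff)
    have "(\<Sum>h\<in>U. (norm (F h))\<^sup>2) \<le> (\<Sum>h\<in>U. 1)" using F(2) by (intro sum_mono) (simp add: power_le_one)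
    also have "\<dots> \<le> real s"
    proof -
      have "card U \<le> card {0..<int s}" by (intro card_mono) (auto simp: U_def)
      then show ?thesis by simp
    qed
    finally have FU: "(\<Sum>h\<in>U. (norm (F h))\<^sup>2) \<le> real s" .
    have "(\<Sum>\<psi>\<in>characters s. norm (c \<psi>))\<^sup>2 \<le> (\<Sum>\<psi>\<in>characters s. (norm (c \<psi>))\<^sup>2) * real N"
      unfolding N_def by (rule sum_squared_le_sum_of_squares)
    also have "\<dots> = (\<Sum>h\<in>U. (norm (F h))\<^sup>2)" using eq N by simp
    finally show "(\<Sum>\<psi>\<in>characters s. norm (c \<psi>))\<^sup>2 \<le> real s" using FU by simp
  qed
  ultimately show ?thesis by blast
qed

section \<open>Small denominators and the hypothesis\<close>

lemma exp_1_less_3: "exp (1::real) < 3"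
proof -
  have "exp (1::real) = exp (1/4) ^ 4" by (simp flip: exp_of_nat_mult)
  \<comment> \<open>The bound 1 + x + x^2 at x = 1/4; the fourth power of 21/16 is about
    2.97.\<close>
  also have "\<dots> \<le> (21/16) ^ 4"
    using exp_bound[of "1/4::real"] by (intro power_mono) (auto simp: power2_eq_square)
  also have "\<dots> < 3" by (simp add: power_divide)
  finally show ?thesis .
qed

lemma ln_gt_1: "q \<ge> (3::nat) \<Longrightarrow> ln (real q) > 1"
proof -
  assume "q \<ge> 3"
  then have "exp 1 < real q" using exp_1_less_3 by linarith
  then show ?thesis by (metis exp_gt_zero less_trans ln_exp ln_less_cancel_iff)
qed

lemma ln_ln_pos: "q \<ge> (3::nat) \<Longrightarrow> ln (ln (real q)) > 0"
  using ln_gt_1[of q] by simp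

lemma nonprincipal_character_ge_3:
  assumes "nonprincipal_character q \<chi>" shows "q \<ge> 3"
proof (rule ccontr)
  assume "\<not> q \<ge> 3"
  moreover have d: "dirichlet_character q \<chi>" using assms by (simp add: nonprincipal_character_def)
  ultimately have q: "q = 1 \<or> q = 2" using dirichlet_character_simps(1)[OF d] by linarith
  have "\<chi> a = principal_character q a" for a
  proof (cases "coprime a (int q)")
    case True
    have "[a = 1] (mod int q)"
      using q True by (auto simp: cong_def coprime_right_2_iff_odd odd_iff_mod_2_eq_one)
    then have "\<chi> a = 1" using dirichlet_character_cong[OF d, of a 1] dirichlet_character_simps(4)[OF d] by simp
    then show ?thesis using True by (simp add: principal_character_def)
  next
    case False
    then show ?thesis using dirichlet_character_simps(3)[OF d] by (simp add: principal_character_def)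
  qed
  then show False using assms by (auto simp: nonprincipal_character_def)
qed

text \<open>If no threshold \<open>A\<close> worked, the counterexamples for \<open>A = 0, 1, 2, \<dots>\<close> would form a
  family violating the hypothesis at every index.\<close>
lemma short_sum_hypothesis_uniform:
  assumes "short_sum_hypothesis \<epsilon>"
  obtains A K :: real where "A > 0" "K \<ge> 0"
    "\<And>q \<chi> x. nonprincipal_character q \<chi> \<Longrightarrow> x > 0 \<Longrightarrow> A * ln (ln (real q)) \<le> ln x \<Longrightarrow>
       norm (character_sum \<chi> x) \<le> K * (x / ln x powr (3 + \<epsilon>))"
proof -
  obtain K where K: "\<forall>(q :: nat \<Rightarrow> nat) (\<chi> :: nat \<Rightarrow> int \<Rightarrow> complex) (x :: nat \<Rightarrow> real).
        (\<forall>j. nonprincipal_character (q j) (\<chi> j)) \<longrightarrow> (\<forall>j. x j > 0) \<longrightarrow>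
        filterlim (\<lambda>j. ln (x j) / ln (ln (real (q j)))) at_top sequentially \<longrightarrow>
        (\<forall>\<^sub>F j in sequentially. norm (character_sum (\<chi> j) (x j)) \<le> K * (x j / ln (x j) powr (3 + \<epsilon>)))"
    using assms unfolding short_sum_hypothesis_def by blast
  define bad where "bad A q \<chi> x \<longleftrightarrow> nonprincipal_character q \<chi> \<and> x > 0 \<and> A * ln (ln (real q)) \<le> ln x \<and>
      \<not> norm (character_sum \<chi> x) \<le> K * (x / ln x powr (3 + \<epsilon>))" for A q \<chi> and x :: real
  have "\<exists>j::nat. \<forall>q \<chi> x. \<not> bad (real j) q \<chi> x"
  proof (rule ccontr)
    assume "\<not> ?thesis"
    then have "\<forall>j. \<exists>q \<chi> x. bad (real j) q \<chi> x" by blast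
    then obtain q \<chi> x where b: "\<And>j. bad (real j) (q j) (\<chi> j) (x j)" by metis
    have "filterlim (\<lambda>j. ln (x j) / ln (ln (real (q j)))) at_top sequentially"
    proof (rule filterlim_at_top_mono[OF filterlim_real_sequentially], rule always_eventually, rule allI)
      fix j
      have "ln (ln (real (q j))) > 0"
        using b[of j] by (intro ln_ln_pos nonprincipal_character_ge_3) (auto simp: bad_def)
      then show "real j \<le> ln (x j) / ln (ln (real (q j)))"
        using b[of j] by (simp add: bad_def field_simps)
    qed
    then have "\<forall>\<^sub>F j in sequentially. norm (character_sum (\<chi> j) (x j)) \<le> K * (x j / ln (x j) powr (3 + \<epsilon>))"
      using K b unfolding bad_def by blast
    then show False using b by (auto simp: bad_def eventually_sequentially)
  qed
  then obtain j :: nat where j: "\<And>q \<chi> x. \<not> bad (real j) q \<chi> x" by blast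
  show ?thesis
  \<comment> \<open>The shift by 1 makes the threshold positive, harmlessly since ln (ln q) > 0; the
    constant of the hypothesis could be negative and is raised to 0.\<close>
  proof (rule that[of "real j + 1" "max K 0"])
    fix q \<chi> and x :: real
    assume np: "nonprincipal_character q \<chi>" and x: "x > 0" and le: "(real j + 1) * ln (ln (real q)) \<le> ln x"
    have "ln (ln (real q)) > 0" using np by (intro ln_ln_pos nonprincipal_character_ge_3)
    then have "real j * ln (ln (real q)) \<le> ln x" using le by (simp add: algebra_simps)
    then have "norm (character_sum \<chi> x) \<le> K * (x / ln x powr (3 + \<epsilon>))"
      using j[of q \<chi> x] np x by (auto simp: bad_def)
    also have "\<dots> \<le> max K 0 * (x / ln x powr (3 + \<epsilon>))" using x by (intro mult_right_mono) auto
    finally show "norm (character_sum \<chi> x) \<le> max K 0 * (x / ln x powr (3 + \<epsilon>))" .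
  qed auto
qed

section \<open>Primitive characters and sums twisted by a rational phase\<close>

lemma character_sum_of_nat: "character_sum \<chi> (real T) = (\<Sum>m\<in>{0<..T}. \<chi> (int m))"
proof -
  have "{1..\<lfloor>real T\<rfloor>} = int ` {0<..T}"
  proof (intro equalityI subsetI)
    fix z assume "z \<in> {1..\<lfloor>real T\<rfloor>}"
    then show "z \<in> int ` {0<..T}" by (intro image_eqI[of _ _ "nat z"]) auto
  qed auto
  then show ?thesis unfolding character_sum_def by (simp add: sum.reindex)
qed

text \<open>No proper divisor d of q is an induced modulus: the character is nontrivial on the units
  congruent to 1 modulo d. Both the Gauss sum argument and
  \<open>primitive_mult_nonprincipal\<close> start from such a unit.\<close>

definition primitive_character :: "nat \<Rightarrow> (int \<Rightarrow> complex) \<Rightarrow> bool" where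
  "primitive_character q \<chi> \<longleftrightarrow> dirichlet_character q \<chi> \<and>
     (\<forall>d. d dvd q \<and> d < q \<longrightarrow> (\<exists>a. coprime a (int q) \<and> [a = 1] (mod int d) \<and> \<chi> a \<noteq> 1))"

lemma cong_simultaneous:
  fixes a :: int and q s :: nat
  assumes "[a = 1] (mod int (gcd q s))"
  obtains a' where "[a' = a] (mod int q)" "[a' = 1] (mod int s)"
proof -
  obtain u v where uv: "u * int q + v * int s = gcd (int q) (int s)" using bezout_int by blast
  have "int (gcd q s) dvd a - 1" using assms by (simp add: cong_iff_dvd_diff)
  then obtain k where k: "a - 1 = gcd (int q) (int s) * k" by (auto simp: gcd_int_int_eq)
  have eq: "a - u * k * int q = 1 + v * k * int s"
    using k unfolding uv[symmetric] by (simp add: algebra_simps)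
  show ?thesis
  proof (rule that)
    show "[a - u * k * int q = a] (mod int q)" by (simp add: cong_iff_dvd_diff)
    show "[a - u * k * int q = 1] (mod int s)" unfolding eq by (simp add: cong_iff_dvd_diff)
  qed
qed

text \<open>As s < q, gcd q s is a proper divisor of q, so some unit a congruent to 1 modulo this
  gcd has \<chi> a \<noteq> 1. The Chinese remainder theorem for compatible congruences moves a to a
  number that is 1 modulo s, where only \<chi> is seen.\<close>

lemma primitive_mult_nonprincipal:
  assumes prim: "primitive_character q \<chi>" and \<psi>: "dirichlet_character s \<psi>" and "s < q"
  shows "nonprincipal_character (q * s) (\<lambda>a. \<chi> a * \<psi> a)"
proof -
  have \<chi>: "dirichlet_character q \<chi>" using prim by (simp add: primitive_character_def)
  have pos: "q > 0" "s > 0" using \<chi> \<psi> by (auto simp: dirichlet_character_simps)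
  have "gcd q s \<le> s" using pos by (intro dvd_imp_le) auto
  then have "gcd q s dvd q" "gcd q s < q" using \<open>s < q\<close> by simp_all
  then obtain a where a: "coprime a (int q)" "[a = 1] (mod int (gcd q s))" "\<chi> a \<noteq> 1"
    using prim unfolding primitive_character_def by blast
  obtain a' where a': "[a' = a] (mod int q)" "[a' = 1] (mod int s)" using cong_simultaneous[OF a(2)] .
  have "coprime a' (int q)" using a(1) cong_imp_coprime[OF cong_sym[OF a'(1)]] by simp
  moreover have "coprime a' (int s)" using cong_imp_coprime[OF cong_sym[OF a'(2)]] by simp
  ultimately have "principal_character (q * s) a' = 1" by (simp add: principal_character_def)
  moreover have "\<chi> a' * \<psi> a' = \<chi> a"
    using dirichlet_character_cong[OF \<chi> a'(1)] dirichlet_character_cong[OF \<psi> a'(2)]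
    by (simp add: dirichlet_character_simps(4)[OF \<psi>])
  ultimately have "(\<lambda>a. \<chi> a * \<psi> a) \<noteq> principal_character (q * s)" using a(3) by metis
  then show ?thesis using dirichlet_character_mult[OF \<chi> \<psi>] by (simp add: nonprincipal_character_def)
qed

text \<open>The partial sums up to n \<ge> 1 stay below 3 - 2 / sqrt n, since 1 / b^3 \<le> 2 / a -
  2 / b for consecutive square roots a < b.\<close>

lemma sum_inverse_sqrt_cube: "(\<Sum>d\<in>{0<..n}. 1 / (real d * sqrt (real d))) \<le> 3"
proof -
  have "(\<Sum>d\<in>{0<..Suc n}. 1 / (real d * sqrt (real d))) \<le> 3 - 2 / sqrt (real (Suc n))" for n
  proof (induction n)
    case (Suc n)
    define a b where "a = sqrt (real (Suc n))" and "b = sqrt (real (Suc (Suc n)))"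
    have ab: "0 < a" "a \<le> b" "b * b - a * a = 1" "b * b = real (Suc (Suc n))" by (auto simp: a_def b_def)
    then have "(b - a) * (b + a) = 1" by (simp add: algebra_simps)
    have "a * b * (a + b) \<le> 2 * (b * b * b)"
    proof -
      have "a * b * (a + b) \<le> b * b * (b + b)" using ab by (intro mult_mono) auto
      then show ?thesis by simp
    qed
    have "1 / (b * b * b) = 2 / (2 * (b * b * b))" by simp
    also have "\<dots> \<le> 2 / (a * b * (a + b))"
      using ab \<open>a * b * (a + b) \<le> _\<close> by (intro divide_left_mono) auto
    also have "\<dots> = 2 * ((b - a) * (b + a)) / (a * b * (a + b))" using \<open>(b - a) * (b + a) = 1\<close> by simp
    also have "\<dots> = 2 * (b - a) / (a * b)" using ab(1,2) by (simp add: add.commute)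
    also have "\<dots> = 2 / a - 2 / b" using ab(1,2) by (simp add: right_diff_distrib diff_divide_distrib)
    finally have "1 / (b * b * b) \<le> 2 / a - 2 / b" .
    moreover have "{0<..Suc (Suc n)} = insert (Suc (Suc n)) {0<..Suc n}" by auto
    ultimately show ?case using Suc ab(4) by (simp add: a_def b_def)
  next
    case 0
    have "{0<..Suc 0} = {Suc 0}" by auto
    then show ?case by simp
  qed
  from this[of n] have "(\<Sum>d\<in>{0<..Suc n}. 1 / (real d * sqrt (real d))) \<le> 3"
    by (rule order_trans) simp
  moreover have "(\<Sum>d\<in>{0<..n}. 1 / (real d * sqrt (real d))) \<le> (\<Sum>d\<in>{0<..Suc n}. 1 / (real d * sqrt (real d)))"
    by (intro sum_mono2) auto
  ultimately show ?thesis by linarith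
qed

lemma sum_gcd_decomposition:
  fixes h :: "nat \<Rightarrow> complex" and r t :: nat
  assumes "r > 0"
  shows "(\<Sum>k\<in>{0<..t}. h k) = (\<Sum>d | d dvd r. \<Sum>m | m \<in> {0<..t div d} \<and> coprime m (r div d). h (d * m))"
proof -
  have "(\<Sum>k\<in>{0<..t}. h k) = (\<Sum>d | d dvd r. \<Sum>k | k \<in> {0<..t} \<and> gcd k r = d. h k)"
    using assms by (intro sum.group[symmetric]) auto
  also have "\<dots> = (\<Sum>d | d dvd r. \<Sum>m | m \<in> {0<..t div d} \<and> coprime m (r div d). h (d * m))"
  proof (rule sum.cong[OF refl])
    fix d assume "d \<in> {d. d dvd r}"
    then obtain e where r: "r = d * e" by auto
    have d: "d > 0" using assms r by (auto intro: Nat.gr0I)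
    have rd: "r div d = e" using r d by simp
    have le: "m \<le> t div d \<longleftrightarrow> d * m \<le> t" for m
      using less_eq_div_iff_mult_less_eq[OF d, of m t] by (simp only: mult.commute)
    have "{k. k \<in> {0<..t} \<and> gcd k r = d} = (\<lambda>m. d * m) ` {m. m \<in> {0<..t div d} \<and> coprime m (r div d)}"
    proof (intro equalityI subsetI)
      fix k assume "k \<in> {k. k \<in> {0<..t} \<and> gcd k r = d}"
      then have k: "0 < k" "k \<le> t" "gcd k r = d" by simp_all
      then obtain m where m: "k = d * m" by (metis dvd_def gcd_dvd1)
      have "d * gcd m e = d" using k(3) unfolding m r by (simp only: gcd_mult_distrib_nat)
      then have "gcd m e = 1" using d by (metis mult_cancel1 nat_mult_1_right less_not_refl)
      then have "coprime m e" by (simp only: coprime_iff_gcd_eq_1)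
      moreover have "0 < m" using k(1) m by (intro Nat.gr0I) simp
      moreover have "m \<le> t div d" using le[of m] k(2) m by simp
      ultimately have "m \<in> {m. m \<in> {0<..t div d} \<and> coprime m (r div d)}"
        unfolding rd mem_Collect_eq greaterThanAtMost_iff by blast
      then show "k \<in> (\<lambda>m. d * m) ` {m. m \<in> {0<..t div d} \<and> coprime m (r div d)}" using m by (rule rev_image_eqI)
    next
      fix k assume "k \<in> (\<lambda>m. d * m) ` {m. m \<in> {0<..t div d} \<and> coprime m (r div d)}"
      then obtain m where m: "k = d * m" "0 < m" "m \<le> t div d" "coprime m e"
        unfolding rd image_iff mem_Collect_eq greaterThanAtMost_iff by blast
      have "gcd k r = d * gcd m e" unfolding m(1) r by (simp only: gcd_mult_distrib_nat)
      also have "gcd m e = 1" using m(4) by simp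
      finally have "gcd k r = d" by simp
      moreover have "k \<le> t" using le[of m] m by simp
      moreover have "0 < k" using m(1,2) d by simp
      ultimately show "k \<in> {k. k \<in> {0<..t} \<and> gcd k r = d}"
        unfolding mem_Collect_eq greaterThanAtMost_iff by blast
    qed
    then show "(\<Sum>k | k \<in> {0<..t} \<and> gcd k r = d. h k) = (\<Sum>m | m \<in> {0<..t div d} \<and> coprime m (r div d). h (d * m))"
      using d by (simp add: sum.reindex inj_on_def)
  qed
  finally show ?thesis .
qed

text \<open>Sorting k = d m by d = gcd k r makes m coprime to s = r div d and turns the phase into a
  function of period s. Its expansion costs sqrt s, and the hypothesis modulo q s is applied to a
  sum of length t / d. The factors sqrt (r / d) and t / d combine to d^(-3/2), which is summable
  over d. The parameter \<tau> is a lower bound for ln (t div d) valid for all d dividing r.\<close>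

lemma norm_twisted_sum_le:
  assumes prim: "primitive_character q \<chi>" and r: "0 < r" "r < q" and q3: "q \<ge> 3"
    and A: "A > 0" "K \<ge> 0"
    and hyp: "\<And>q \<chi> x. nonprincipal_character q \<chi> \<Longrightarrow> x > 0 \<Longrightarrow> A * ln (ln (real q)) \<le> ln x \<Longrightarrow>
       norm (character_sum \<chi> x) \<le> K * (x / ln x powr (3 + \<epsilon>))"
    and rt: "r \<le> t" and lam: "0 < \<tau>" "\<tau> \<le> ln (real (t div r))" "A * ln (ln (real (q * r))) \<le> \<tau>" and \<epsilon>: "\<epsilon> > 0"
  shows "norm (\<Sum>k\<in>{0<..t}. \<chi> (int k) * ee (real k * (of_int b / real r))) \<le> 3 * K * sqrt (real r) * real t / \<tau> powr (3 + \<epsilon>)"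
proof -
  have \<chi>: "dirichlet_character q \<chi>" using prim by (simp add: primitive_character_def)
  have tr: "t div r \<ge> 1" using r rt by (simp add: less_eq_div_iff_mult_less_eq)
  have part: "norm (\<Sum>m | m \<in> {0<..t div d} \<and> coprime m (r div d). \<chi> (int (d * m)) * ee (real (d * m) * (of_int b / real r))) \<le>
      K * sqrt (real r) * real t / \<tau> powr (3 + \<epsilon>) * (1 / (real d * sqrt (real d)))" if "d dvd r" for d
  proof -
    obtain s where s: "r = d * s" using \<open>d dvd r\<close> by auto
    have pos: "d > 0" "s > 0" using s r by (auto intro: Nat.gr0I)
    have rd: "r div d = s" using s pos by simp
    define T where "T = t div d"
    have T: "real T > 0" "\<tau> \<le> ln (real T)" "real T \<le> real t / real d"
    proof -
      have "t div r \<le> T" unfolding T_def using s pos by (intro div_le_mono2) auto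
      then show "real T > 0" "\<tau> \<le> ln (real T)" using tr lam(2) by (auto intro: order_trans)
      show "real T \<le> real t / real d" unfolding T_def by (rule of_nat_div_le_of_nat)
    qed
    define F where "F x = ee (of_int x * (of_int b / real s))" for x
    have F_cong: "F x = F y" if "[x = y] (mod int s)" for x y
    proof -
      obtain k where "x = y + int s * k" using \<open>[x = y] (mod int s)\<close> by (metis cong_iff_lin cong_sym)
      then have "of_int x * (of_int b / real s) = of_int y * (of_int b / real s) + of_int (k * b)"
        using pos by (simp add: field_simps)
      then show ?thesis unfolding F_def by (simp only: ee_add_int)
    qed
    obtain c where c: "\<And>x. coprime x (int s) \<Longrightarrow> F x = (\<Sum>\<psi>\<in>characters s. c \<psi> * \<psi> x)" 
        "(\<Sum>\<psi>\<in>characters s. norm (c \<psi>)) \<le> sqrt (real s)"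
      using character_expansion[OF pos(2), of F] F_cong by (auto simp: F_def)
    have "(\<Sum>m | m \<in> {0<..t div d} \<and> coprime m (r div d). \<chi> (int (d * m)) * ee (real (d * m) * (of_int b / real r))) =
       (\<Sum>m\<in>{m \<in> {0<..T}. coprime m s}. \<chi> (int d) * (\<chi> (int m) * F (int m)))"
    proof (rule sum.cong)
      fix m
      have "real (d * m) * (of_int b / real r) = of_int (int m) * (of_int b / real s)" using pos by (simp add: s)
      then show "\<chi> (int (d * m)) * ee (real (d * m) * (of_int b / real r)) = \<chi> (int d) * (\<chi> (int m) * F (int m))"
        by (simp add: F_def dirichlet_character_simps(2)[OF \<chi>])
    qed (auto simp: rd T_def)
    also have "\<dots> = (\<Sum>m\<in>{m \<in> {0<..T}. coprime m s}. \<chi> (int d) * (\<Sum>\<psi>\<in>characters s. c \<psi> * (\<chi> (int m) * \<psi> (int m))))"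
      by (intro sum.cong refl) (simp add: c(1) sum_distrib_left mult_ac)
    also have "\<dots> = (\<Sum>m\<in>{0<..T}. \<chi> (int d) * (\<Sum>\<psi>\<in>characters s. c \<psi> * (\<chi> (int m) * \<psi> (int m))))"
    proof (rule sum.mono_neutral_left)
      show "finite {0<..T}" "{m \<in> {0<..T}. coprime m s} \<subseteq> {0<..T}" by auto
      show "\<forall>m\<in>{0<..T} - {m \<in> {0<..T}. coprime m s}. \<chi> (int d) * (\<Sum>\<psi>\<in>characters s. c \<psi> * (\<chi> (int m) * \<psi> (int m))) = 0"
      proof
      fix m assume "m \<in> {0<..T} - {m \<in> {0<..T}. coprime m s}"
      then have "\<not> coprime (int m) (int s)" by auto
      then have "\<psi> (int m) = 0" if "\<psi> \<in> characters s" for \<psi>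
        using that dirichlet_character_simps(3) by (auto simp: characters_def)
      then have "(\<Sum>\<psi>\<in>characters s. c \<psi> * (\<chi> (int m) * \<psi> (int m))) = 0" by (intro sum.neutral) simp
      then show "\<chi> (int d) * (\<Sum>\<psi>\<in>characters s. c \<psi> * (\<chi> (int m) * \<psi> (int m))) = 0" by simp
      qed
    qed
    also have "\<dots> = \<chi> (int d) * (\<Sum>\<psi>\<in>characters s. c \<psi> * character_sum (\<lambda>a. \<chi> a * \<psi> a) (real T))"
      unfolding character_sum_of_nat sum_distrib_left by (rule sum.swap)
    finally have "norm (\<Sum>m | m \<in> {0<..t div d} \<and> coprime m (r div d). \<chi> (int (d * m)) * ee (real (d * m) * (of_int b / real r))) \<le>
       norm (\<Sum>\<psi>\<in>characters s. c \<psi> * character_sum (\<lambda>a. \<chi> a * \<psi> a) (real T))"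
      using norm_dirichlet_character_le[OF \<chi>, of "int d"] by (simp add: norm_mult mult_left_le_one_le)
    also have "\<dots> \<le> (\<Sum>\<psi>\<in>characters s. norm (c \<psi>) * (K * (real t / real d / \<tau> powr (3 + \<epsilon>))))"
    proof (rule sum_norm_le)
      fix \<psi> assume "\<psi> \<in> characters s"
      then have \<psi>: "dirichlet_character s \<psi>" by (simp add: characters_def)
      have "s \<le> r" using s pos by simp
      have "nonprincipal_character (q * s) (\<lambda>a. \<chi> a * \<psi> a)"
        using prim \<psi> \<open>s \<le> r\<close> r by (intro primitive_mult_nonprincipal) auto
      moreover have "A * ln (ln (real (q * s))) \<le> ln (real T)"
      proof -
        have 3: "q * s \<ge> 3" using q3 pos by (metis One_nat_def Suc_leI mult_le_mono nat_mult_1_right)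
        have "q * s \<le> q * r" using \<open>s \<le> r\<close> by simp
        then have le: "real (q * s) \<le> real (q * r)" by (simp only: of_nat_le_iff)
        have "ln (real (q * s)) \<le> ln (real (q * r))" using le by (subst ln_le_cancel_iff) (use pos q3 r in auto)
        then have "ln (ln (real (q * s))) \<le> ln (ln (real (q * r)))"
          using ln_gt_1[OF 3] by (subst ln_le_cancel_iff) auto
        then have "A * ln (ln (real (q * s))) \<le> A * ln (ln (real (q * r)))" using A by simp
        then show ?thesis using lam T by linarith
      qed
      ultimately have "norm (character_sum (\<lambda>a. \<chi> a * \<psi> a) (real T)) \<le> K * (real T / ln (real T) powr (3 + \<epsilon>))"
        using T by (intro hyp) auto
      also have "\<dots> \<le> K * (real t / real d / \<tau> powr (3 + \<epsilon>))"
        using A T lam \<epsilon> by (intro mult_left_mono frac_le powr_mono2) auto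
      finally show "norm (c \<psi> * character_sum (\<lambda>a. \<chi> a * \<psi> a) (real T)) \<le> norm (c \<psi>) * (K * (real t / real d / \<tau> powr (3 + \<epsilon>)))"
        unfolding norm_mult by (intro mult_left_mono) auto
    qed
    also have "\<dots> = (\<Sum>\<psi>\<in>characters s. norm (c \<psi>)) * (K * (real t / real d / \<tau> powr (3 + \<epsilon>)))"
      by (rule sum_distrib_right[symmetric])
    also have "\<dots> \<le> sqrt (real s) * (K * (real t / real d / \<tau> powr (3 + \<epsilon>)))"
      using c(2) A by (intro mult_right_mono) auto
    also have "sqrt (real s) = sqrt (real r) / sqrt (real d)" using pos by (simp add: s real_sqrt_mult)
    finally show ?thesis by (simp add: mult_ac)
  qed
  have "norm (\<Sum>k\<in>{0<..t}. \<chi> (int k) * ee (real k * (of_int b / real r))) \<le> 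
     (\<Sum>d | d dvd r. K * sqrt (real r) * real t / \<tau> powr (3 + \<epsilon>) * (1 / (real d * sqrt (real d))))"
    unfolding sum_gcd_decomposition[OF r(1), of "\<lambda>k. \<chi> (int k) * ee (real k * (of_int b / real r))"]
    by (intro sum_norm_le part) auto
  also have "\<dots> = K * sqrt (real r) * real t / \<tau> powr (3 + \<epsilon>) * (\<Sum>d | d dvd r. 1 / (real d * sqrt (real d)))"
    by (rule sum_distrib_left[symmetric])
  also have "\<dots> \<le> K * sqrt (real r) * real t / \<tau> powr (3 + \<epsilon>) * 3"
  proof (rule mult_left_mono)
    have "(\<Sum>d | d dvd r. 1 / (real d * sqrt (real d))) \<le> (\<Sum>d\<in>{0<..r}. 1 / (real d * sqrt (real d)))"
      using r by (intro sum_mono2) (auto dest: dvd_imp_le intro: Nat.gr0I)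
    then show "(\<Sum>d | d dvd r. 1 / (real d * sqrt (real d))) \<le> 3" using sum_inverse_sqrt_cube[of r] by linarith
  qed (use A in auto)
  finally show ?thesis by (simp add: mult_ac)
qed

text \<open>Partial summation against the phase e(n \<delta>) with \<delta> = \<alpha> - \<beta>:
  its total variation up to x is at most 2 pi |\<delta>| x < 8, and the boundary term adds
  1.\<close>

lemma exp_sum_near_le:
  assumes V: "\<And>t. t \<le> x \<Longrightarrow> norm (exp_sum f \<beta> t) \<le> V" and near: "\<bar>\<alpha> - \<beta>\<bar> * real x \<le> 1"
  shows "norm (exp_sum f \<alpha> x) \<le> 9 * V"
proof -
  define \<delta> where "\<delta> = \<alpha> - \<beta>"
  have V0: "V \<ge> 0" using V[of 0] by (simp add: exp_sum_def)
  have "exp_sum f \<alpha> x = (\<Sum>n\<in>{0<..x}. ee (real n * \<delta>) * (f n * ee (real n * \<beta>)))"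
    unfolding exp_sum_def
  proof (rule sum.cong[OF refl])
    fix n
    have "real n * \<alpha> = real n * \<delta> + real n * \<beta>" by (simp add: \<delta>_def algebra_simps)
    then show "f n * ee (real n * \<alpha>) = ee (real n * \<delta>) * (f n * ee (real n * \<beta>))" by (simp add: ee_add)
  qed
  also have "\<dots> = ee (real x * \<delta>) * exp_sum f \<beta> x - (\<Sum>n\<in>{0..<x}. (ee (real (Suc n) * \<delta>) - ee (real n * \<delta>)) * exp_sum f \<beta> n)"
    unfolding exp_sum_def by (rule abel_summation) simp
  also have "norm \<dots> \<le> V + real x * (2 * pi * \<bar>\<delta>\<bar> * V)"
  proof (rule order_trans[OF norm_triangle_ineq4 add_mono])
    show "norm (ee (real x * \<delta>) * exp_sum f \<beta> x) \<le> V" using V[of x] by (simp add: norm_mult)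
    have "norm (\<Sum>n\<in>{0..<x}. (ee (real (Suc n) * \<delta>) - ee (real n * \<delta>)) * exp_sum f \<beta> n) \<le> (\<Sum>n\<in>{0..<x}. 2 * pi * \<bar>\<delta>\<bar> * V)"
    proof (rule sum_norm_le)
      fix n assume n: "n \<in> {0..<x}"
      have "real (Suc n) * \<delta> = real n * \<delta> + \<delta>" by (simp add: algebra_simps)
      then have "ee (real (Suc n) * \<delta>) - ee (real n * \<delta>) = - (ee (real n * \<delta>) * (1 - ee \<delta>))"
        by (simp add: ee_add algebra_simps)
      then have "norm (ee (real (Suc n) * \<delta>) - ee (real n * \<delta>)) \<le> 2 * pi * \<bar>\<delta>\<bar>"
        using norm_1_minus_ee_le[of \<delta>] by (simp add: norm_mult)
      then show "norm ((ee (real (Suc n) * \<delta>) - ee (real n * \<delta>)) * exp_sum f \<beta> n) \<le> 2 * pi * \<bar>\<delta>\<bar> * V"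
        unfolding norm_mult using V[of n] n by (intro mult_mono) auto
    qed
    then show "norm (\<Sum>n\<in>{0..<x}. (ee (real (Suc n) * \<delta>) - ee (real n * \<delta>)) * exp_sum f \<beta> n) \<le> real x * (2 * pi * \<bar>\<delta>\<bar> * V)" by simp
  qed
  also have "\<dots> = V + 2 * pi * (\<bar>\<delta>\<bar> * real x) * V" by simp
  also have "\<dots> \<le> V + 2 * 4 * 1 * V"
    using near V0 pi_less_4 by (intro add_left_mono mult_right_mono mult_mono) (auto simp: \<delta>_def)
  finally show ?thesis by simp
qed

section \<open>Logarithmic sums for primitive characters\<close>

text \<open>The last inequality is the bound of \<open>norm_exp_sum_large_denominator\<close> with
  \<open>R = l powr (4 + 2 * \<epsilon>)\<close>, where \<open>l = ln n\<close>.\<close>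
definition large_log :: "real \<Rightarrow> real \<Rightarrow> bool" where
  "large_log \<epsilon> l \<longleftrightarrow> 2 \<le> l powr (4 + 2 * \<epsilon>) \<and>
     (l powr (4 + 2 * \<epsilon>)) powr (3 / 2) \<le> exp l \<and> l \<le> exp (l / 4) \<and>
     exp (l / 2) + 1 \<le> exp (3 * l / 4) / l powr (4 + 2 * \<epsilon>) \<and>
     271 + 59 * (l powr (- \<epsilon> / 2)) * ((4 + 2 * \<epsilon>) * ln l + 1) + 16 * ln (ln 4 + (3 / 2) * (4 + 2 * \<epsilon>) * ln l + 5) \<le> ln l powr \<epsilon>"

lemma large_log_eventually:
  assumes "\<epsilon> > 0"
  obtains l0 where "l0 \<ge> 2" "\<And>l. l \<ge> l0 \<Longrightarrow> large_log \<epsilon> l"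
proof -
  have "eventually (\<lambda>l::real. 2 \<le> l powr (4 + 2 * \<epsilon>)) at_top" using assms by real_asymp
  moreover have "eventually (\<lambda>l::real. (l powr (4 + 2 * \<epsilon>)) powr (3 / 2) \<le> exp l) at_top" using assms by real_asymp
  moreover have "eventually (\<lambda>l::real. l \<le> exp (l / 4)) at_top" by real_asymp
  moreover have "eventually (\<lambda>l::real. exp (l / 2) + 1 \<le> exp (3 * l / 4) / l powr (4 + 2 * \<epsilon>)) at_top" using assms by real_asymp
  moreover have "eventually (\<lambda>l::real. 271 + 59 * (l powr (- \<epsilon> / 2)) * ((4 + 2 * \<epsilon>) * ln l + 1) + 16 * ln (ln 4 + (3 / 2) * (4 + 2 * \<epsilon>) * ln l + 5) \<le> ln l powr \<epsilon>) at_top"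
    using assms by real_asymp
  ultimately have "eventually (large_log \<epsilon>) at_top"
    by eventually_elim (simp only: large_log_def simp_thms)
  then obtain l0 where "\<And>l. l \<ge> l0 \<Longrightarrow> large_log \<epsilon> l"
    unfolding eventually_at_top_linorder by blast
  then show ?thesis using that[of "max 2 l0"] by simp
qed

text \<open>All of Z lies between its minimum m and W m; the logarithm accounts for everything but
  the first term, which is at most 1.\<close>

lemma sum_inverse_interval_le:
  fixes Z :: "nat set" and W :: real
  assumes "finite Z" "W \<ge> 1" "\<And>n. n \<in> Z \<Longrightarrow> n > 0" "\<And>m n. m \<in> Z \<Longrightarrow> n \<in> Z \<Longrightarrow> real n \<le> W * real m"
  shows "(\<Sum>n\<in>Z. 1 / real n) \<le> 1 + ln W"
proof (cases "Z = {}")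
  case False
  define m M where "m = Min Z" and "M = Max Z"
  have mM: "m \<in> Z" "M \<in> Z" "Z \<subseteq> {m..M}" using assms False by (auto simp: m_def M_def)
  then have "m \<le> M" "m > 0" using assms by auto
  have sum: "(\<Sum>n\<in>{m..M'}. 1 / real n) \<le> 1 / real m + (ln (real M') - ln (real m))" if "m \<le> M'" for M'
    using that
  proof (induction M' rule: dec_induct)
    case (step k)
    have "ln (real k) - ln (real (Suc k)) \<le> (real k - real (Suc k)) / real (Suc k)"
      using step \<open>m > 0\<close> by (intro ln_diff_le) auto
    then have "1 / real (Suc k) \<le> ln (real (Suc k)) - ln (real k)" by (simp add: field_simps)
    moreover have "{m..Suc k} = insert (Suc k) {m..k}" using step by auto
    ultimately show ?case using step by simp
  qed simp
  have "(\<Sum>n\<in>Z. 1 / real n) \<le> (\<Sum>n\<in>{m..M}. 1 / real n)" using mM by (intro sum_mono2) auto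
  also have "\<dots> \<le> 1 / real m + (ln (real M) - ln (real m))" using \<open>m \<le> M\<close> by (rule sum)
  also have "1 / real m \<le> 1" using \<open>m > 0\<close> by simp
  also have "ln (real M) - ln (real m) = ln (real M / real m)" using \<open>m \<le> M\<close> \<open>m > 0\<close> by (simp add: ln_div)
  also have "\<dots> \<le> ln W"
    using assms(4)[OF mM(1,2)] \<open>m \<le> M\<close> \<open>m > 0\<close> by (subst ln_le_cancel_iff) (use assms(2) in \<open>auto simp: field_simps\<close>)
  finally show ?thesis by simp
qed (use assms in auto)

text \<open>The increments of ln (ln n) dominate the terms; the term n = 3 is covered by the
  constant 1.\<close>

lemma sum_inverse_n_ln_n_le:
  assumes "q \<ge> 3"
  shows "(\<Sum>n\<in>{3..q}. 1 / (real n * ln (real n))) \<le> 1 + ln (ln (real q))"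
  using assms
proof (induction q rule: dec_induct)
  case base
  have "3 * 1 \<le> 3 * ln (3::real)" using ln_gt_1[of 3] by (intro mult_left_mono) auto
  then have "1 / (3 * ln (3::real)) \<le> 1" by simp
  moreover have "(\<Sum>n\<in>{3..3::nat}. 1 / (real n * ln (real n))) = 1 / (3 * ln 3)" by simp
  moreover have "ln (ln (real 3)) > 0" by (rule ln_ln_pos) simp
  ultimately show ?case by linarith
next
  case (step k)
  have l: "ln (real k) > 1" "ln (real (Suc k)) > 1" using step by (intro ln_gt_1; simp)+
  have "ln (real k) - ln (real (Suc k)) \<le> (real k - real (Suc k)) / real (Suc k)"
    using step by (intro ln_diff_le) auto
  then have 1: "ln (real k) - ln (real (Suc k)) \<le> - 1 / real (Suc k)" by simp
  have "ln (ln (real k)) - ln (ln (real (Suc k))) \<le> (ln (real k) - ln (real (Suc k))) / ln (real (Suc k))"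
    using l by (intro ln_diff_le) linarith+
  also have "\<dots> \<le> (- 1 / real (Suc k)) / ln (real (Suc k))" using 1 l by (intro divide_right_mono) auto
  also have "\<dots> = - (1 / (real (Suc k) * ln (real (Suc k))))" by simp
  finally have "1 / (real (Suc k) * ln (real (Suc k))) \<le> ln (ln (real (Suc k))) - ln (ln (real k))" by simp
  moreover have "{3..Suc k} = insert (Suc k) {3..k}" using step by auto
  ultimately show ?case using step by simp
qed

text \<open>Partial summation against 1 / n; the boundary term is at most 1 because the exponential
  sum up to N is at most N.\<close>

lemma norm_log_sum_le:
  assumes "\<And>n. norm (f n) \<le> 1"
  shows "norm (\<Sum>n\<in>{0<..N}. f n * ee (real n * \<alpha>) / of_nat n) \<le> 
    1 + (\<Sum>n\<in>{0<..<N}. norm (exp_sum f \<alpha> n) / (real n * real (Suc n)))"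
proof -
  define g where "g n = complex_of_real (1 / real n)" for n
  have eq: "(\<Sum>n\<in>{0<..N}. f n * ee (real n * \<alpha>) / of_nat n) = (\<Sum>n\<in>{0<..N}. g n * (f n * ee (real n * \<alpha>)))"
    by (intro sum.cong) (auto simp: g_def)
  also have "\<dots> = g N * exp_sum f \<alpha> N - (\<Sum>n\<in>{0..<N}. (g (Suc n) - g n) * exp_sum f \<alpha> n)"
    unfolding exp_sum_def by (rule abel_summation) simp
  also have "norm \<dots> \<le> 1 + (\<Sum>n\<in>{0<..<N}. norm (exp_sum f \<alpha> n) / (real n * real (Suc n)))"
  proof (rule order_trans[OF norm_triangle_ineq4 add_mono])
    have "norm (g N * exp_sum f \<alpha> N) = norm (exp_sum f \<alpha> N) / real N"
      by (simp add: g_def norm_mult norm_divide)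
    also have "\<dots> \<le> 1" using norm_exp_sum_le[of f \<alpha> N] assms by (cases "N = 0") auto
    finally show "norm (g N * exp_sum f \<alpha> N) \<le> 1" .
    have "(\<Sum>n\<in>{0..<N}. (g (Suc n) - g n) * exp_sum f \<alpha> n) = (\<Sum>n\<in>{0<..<N}. (g (Suc n) - g n) * exp_sum f \<alpha> n)"
      by (rule sum.mono_neutral_right) (auto simp: exp_sum_def)
    also have "norm \<dots> \<le> (\<Sum>n\<in>{0<..<N}. norm (exp_sum f \<alpha> n) / (real n * real (Suc n)))"
    proof (rule sum_norm_le)
      fix n assume n: "n \<in> {0<..<N}"
      have "g (Suc n) - g n = complex_of_real (- (1 / (real n * real (Suc n))))"
        using n unfolding g_def of_real_diff[symmetric] by (intro arg_cong[where f = complex_of_real]) (simp add: field_simps)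
      then have "norm (g (Suc n) - g n) = 1 / (real n * real (Suc n))" by (simp only: norm_of_real) simp
      then show "norm ((g (Suc n) - g n) * exp_sum f \<alpha> n) \<le> norm (exp_sum f \<alpha> n) / (real n * real (Suc n))"
        by (simp add: norm_mult)
    qed
    finally show "norm (\<Sum>n\<in>{0..<N}. (g (Suc n) - g n) * exp_sum f \<alpha> n) \<le> (\<Sum>n\<in>{0<..<N}. norm (exp_sum f \<alpha> n) / (real n * real (Suc n)))" .
  qed
  finally show ?thesis .
qed

text \<open>In \<open>hyp\<close> the modulus is universally quantified because it is applied to
  multiples q s of the fixed q. The lower bound on ln q ensures that every n > \<open>y\<close>
  satisfies ln n \<ge> l0, as \<open>y\<close> \<ge> ln q, and that elementary comparisons of powers
  of ln q hold.\<close>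

locale uniform_short_sums =
  fixes \<epsilon> A K l0 :: real and q :: nat and \<chi> :: "int \<Rightarrow> complex"
  assumes \<epsilon>: "\<epsilon> > 0" and A: "A > 0" and K: "K \<ge> 0"
    and hyp: "\<And>q \<chi> x. nonprincipal_character q \<chi> \<Longrightarrow> x > 0 \<Longrightarrow> A * ln (ln (real q)) \<le> ln x \<Longrightarrow>
       norm (character_sum \<chi> x) \<le> K * (x / ln x powr (3 + \<epsilon>))"
    and l02: "l0 \<ge> 2" and asymp: "\<And>l. l \<ge> l0 \<Longrightarrow> large_log \<epsilon> l"
    and prim: "primitive_character q \<chi>" and q: "ln (real q) \<ge> max (exp l0) 4"
begin

definition "L = ln (ln (real q))"
text \<open>The exponent of R, unrelated to the dyadic blocks of
  \<open>mult_exp_sum\<close>.\<close>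

definition "B = 4 + 2 * \<epsilon>"
text \<open>The value of R at n = q, which bounds R for all n in question; \<open>bad\<close> has to
  compare fractions belonging to different n.\<close>

definition "Rq = ln (real q) powr B"
text \<open>The summand 4A makes (ln n) / 2 exceed the threshold 2 A L of the hypothesis for n >
  \<open>y\<close>. The summand 2B + 2 makes \<open>y\<close> larger than 4 Rq^2, which
  \<open>bad_unique\<close> needs.\<close>

definition "A' = 4 * A + 2 * B + 2"
definition "y = ln (real q) powr A'"
text \<open>The 9 comes from \<open>exp_sum_near_le\<close>, the 1 from short initial segments, 3K
  from \<open>norm_twisted_sum_le\<close>, and the power of 2 from using (ln n) / 2 as
  \<tau>.\<close>

definition "C3 = 9 * (1 + 3 * K * 2 powr (3 + \<epsilon>))"
abbreviation "f \<equiv> \<lambda>n::nat. \<chi> (int n)"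

lemma chi: "dirichlet_character q \<chi>" using prim by (simp add: primitive_character_def)

lemma f_le: "norm (f n) \<le> 1" using norm_dirichlet_character_le[OF chi] .

lemma q3: "q \<ge> 3"
proof -
  have "real q > 0" using q dirichlet_character_simps(1)[OF chi] by simp
  moreover have "4 \<le> ln (real q)" using q by simp
  ultimately have "exp 4 \<le> real q" by (subst (asm) ln_ge_iff) auto
  moreover have "exp (4::real) \<ge> 1 + 4" by (rule exp_ge_add_one_self)
  ultimately show ?thesis by linarith
qed

lemma L1: "L \<ge> 1"
proof -
  have "exp 1 \<le> ln (real q)" using q exp_1_less_3 by linarith
  then show ?thesis unfolding L_def using q by (subst ln_ge_iff) auto
qed

lemma y_ge: "ln (real q) \<le> y" "4 * (ln (real q) powr (2 * B)) < y" "ln y = A' * L"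
proof -
  have l: "ln (real q) \<ge> 4" using q by simp
  have "ln (real q) powr 1 \<le> ln (real q) powr A'"
    using l A \<epsilon> by (intro powr_mono) (auto simp: A'_def B_def)
  then show "ln (real q) \<le> y" using l by (simp add: y_def)
  have "4 * (ln (real q) powr (2 * B)) < (ln (real q) * ln (real q)) * ln (real q) powr (2 * B)"
  proof (rule mult_strict_right_mono)
    have "4 * 4 \<le> ln (real q) * ln (real q)" using l by (intro mult_mono) auto
    then show "4 < ln (real q) * ln (real q)" by simp
  qed (use l in auto)
  also have "\<dots> = ln (real q) powr (2 * B + 2)"
    using l by (simp add: powr_add power2_eq_square powr_numeral)
  also have "\<dots> \<le> y" unfolding y_def using l A by (intro powr_mono) (auto simp: A'_def)
  finally show "4 * (ln (real q) powr (2 * B)) < y" .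
  show "ln y = A' * L" unfolding y_def L_def using l by (simp add: ln_powr)
qed

text \<open>The saving that is summable: with weight 1 / n^2 the right-hand sides add up to a
  multiple of L^(1+\<epsilon>).\<close>

definition good :: "real \<Rightarrow> nat \<Rightarrow> bool" where
  "good \<alpha> n \<longleftrightarrow> norm (exp_sum f \<alpha> n) \<le> C3 * real n * L powr \<epsilon> / ln (real n)"

text \<open>\<open>n\<close> is bad if its Dirichlet approximation has a small denominator but is not close enough for the
  hypothesis to apply. Since \<open>n\<close> exceeds a power of \<open>ln q\<close>, one fraction serves all bad \<open>n\<close>, which
  confines them to an interval \<open>[m, 2 * Rq * m]\<close>.\<close>
definition bad :: "real \<Rightarrow> nat \<Rightarrow> int \<Rightarrow> nat \<Rightarrow> bool" where
  "bad \<alpha> n b r \<longleftrightarrow> 0 < r \<and> real r < Rq \<and> 1 < \<bar>\<alpha> - of_int b / real r\<bar> * real n \<and>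
     \<bar>\<alpha> - of_int b / real r\<bar> * (real r * real n) \<le> 2 * Rq"

context
  fixes n :: nat assumes n: "y < real n" "n \<le> q"
begin

definition "ll = ln (real n)"
definition "R = ll powr B"

lemma npos: "real n > 0" using n y_ge q by (smt (verit))

lemma ll: "ll \<ge> l0" "ll \<ge> 2" "exp ll = real n" "ll \<ge> A' * L" "ll \<le> ln (real q)" "ln ll \<le> L"
proof -
  have "exp l0 \<le> ln (real q)" using q by simp
  also have "\<dots> \<le> real n" using y_ge n by simp
  finally have "exp l0 \<le> real n" .
  then show 1: "ll \<ge> l0" unfolding ll_def using npos by (subst ln_ge_iff) auto
  then show 2: "ll \<ge> 2" using l02 by simp
  show "exp ll = real n" unfolding ll_def using npos by simp
  have "y > 0" using y_ge q by (smt (verit))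
  then have "ln y \<le> ll" unfolding ll_def using n npos by (subst ln_le_cancel_iff) auto
  then show "ll \<ge> A' * L" using y_ge by simp
  show 3: "ll \<le> ln (real q)" unfolding ll_def using n npos by (subst ln_le_cancel_iff) auto
  show "ln ll \<le> L" unfolding L_def using 2 3 by (subst ln_le_cancel_iff) auto
qed

lemma R: "R \<ge> 2" "R * sqrt R \<le> real n" "ll \<le> sqrt (sqrt R)" "R \<le> Rq" "sqrt R = ll powr (2 + \<epsilon>)"
   "sqrt (sqrt R) = ll powr (1 + \<epsilon> / 2)" "R \<le> real n"
proof -
  note as = asymp[OF ll(1), unfolded large_log_def]
  show R2: "R \<ge> 2" using as by (simp add: R_def B_def)
  show s: "sqrt R = ll powr (2 + \<epsilon>)" unfolding R_def B_def
    using ll(2) by (simp add: powr_half_sqrt[symmetric] powr_powr add_divide_distrib)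
  show ss: "sqrt (sqrt R) = ll powr (1 + \<epsilon> / 2)" unfolding s
    using ll(2) by (simp add: powr_half_sqrt[symmetric] powr_powr add_divide_distrib)
  have "R powr (3 / 2) = R * sqrt R"
  proof -
    have "R powr (3 / 2) = R powr (1 + 1 / 2)" by simp
    also have "\<dots> = R * sqrt R" using R2 by (subst powr_add) (simp add: powr_half_sqrt)
    finally show ?thesis .
  qed
  then show RR: "R * sqrt R \<le> real n" using as ll(3) by (simp add: R_def B_def)
  have "ll powr 1 \<le> ll powr (1 + \<epsilon> / 2)" using ll(2) \<epsilon> by (intro powr_mono) auto
  then show "ll \<le> sqrt (sqrt R)" unfolding ss using ll(2) by simp
  show "R \<le> Rq" unfolding R_def Rq_def using ll \<epsilon> by (intro powr_mono2) (auto simp: B_def)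
  have "R * 1 \<le> R * sqrt R" using R2 by (intro mult_left_mono) auto
  then show "R \<le> real n" using RR by simp
qed

lemma good_large_denominator:
  assumes r: "coprime b (int r)" "R \<le> real r" "real r * R \<le> real n" "\<bar>\<alpha> - of_int b / real r\<bar> \<le> 1 / (real r)\<^sup>2"
  shows "good \<alpha> n"
proof -
  have r2: "r \<ge> 2" using r(2) R(1) by linarith
  have n3: "n \<ge> 3"
  proof -
    have "4 \<le> real n" using y_ge n q by (smt (verit))
    then show ?thesis by linarith
  qed
  interpret M: mult_exp_sum \<alpha> b r f n R
    using r r2 n3 R f_le by unfold_locales (auto simp: dirichlet_character_simps(2)[OF chi] ll_def)
  have l: "M.l = ll" by (simp add: M.l_def ll_def)
  have lR: "ln R = B * ln ll" unfolding R_def using ll(2) by (simp add: ln_powr)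
  have "ll / sqrt (sqrt R) = ll powr 1 / ll powr (1 + \<epsilon> / 2)" unfolding R(6) using ll(2) by simp
  also have "\<dots> = ll powr (- \<epsilon> / 2)" 
  proof -
    have "ll powr 1 / ll powr (1 + \<epsilon> / 2) = ll powr (1 - (1 + \<epsilon> / 2))" by (rule powr_diff[symmetric])
    then show ?thesis by simp
  qed
  finally have 1: "ll / sqrt (sqrt R) = ll powr (- \<epsilon> / 2)" .
  have "M.lam = ln 4 + (3 / 2) * B * ln ll + 5"
  proof -
    have "ln (4 * R * sqrt R) = ln 4 + ln R + ln (sqrt R)" using R(1) by (simp add: ln_mult)
    also have "ln (sqrt R) = ln R / 2" using R(1) by (simp add: ln_sqrt)
    finally show ?thesis unfolding M.lam_def lR by simp
  qed
  then have "271 + 59 * (ll / sqrt (sqrt R)) * (ln R + 1) + 16 * ln M.lam \<le> ln ll powr \<epsilon>"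
    using asymp[OF ll(1), unfolded large_log_def] unfolding 1 lR B_def by simp
  also have "\<dots> \<le> L powr \<epsilon>" using ll \<epsilon> by (intro powr_mono2) auto
  finally have 2: "271 + 59 * (ll / sqrt (sqrt R)) * (ln R + 1) + 16 * ln M.lam \<le> L powr \<epsilon>" .
  have "norm (exp_sum f \<alpha> n) * ll \<le> real n * (271 + 59 * (ll / sqrt (sqrt R)) * (ln R + 1) + 16 * ln M.lam)"
    using M.norm_exp_sum_large_denominator unfolding l .
  also have "\<dots> \<le> real n * L powr \<epsilon>" using 2 by (intro mult_left_mono) auto
  also have "\<dots> \<le> C3 * (real n * L powr \<epsilon>)"
  proof -
    have "1 \<le> C3" unfolding C3_def using K by simp
    then show ?thesis using mult_right_mono[of 1 C3 "real n * L powr \<epsilon>"] by simp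
  qed
  finally show ?thesis unfolding good_def ll_def[symmetric] using ll(2) by (simp add: field_simps)
qed

text \<open>At the fraction b / r itself the loss sqrt r < (ln n)^(2+\<epsilon>) leaves a saving of
  ln n. The bound is needed for every t \<le> n, since \<open>exp_sum_near_le\<close> passes from b
  / r to \<alpha> by partial summation.\<close>

lemma good_small_denominator:
  assumes r: "0 < r" "real r < R" "\<bar>\<alpha> - of_int b / real r\<bar> * real n \<le> 1"
  shows "good \<alpha> n"
proof -
  define V where "V = (1 + 3 * K * 2 powr (3 + \<epsilon>)) * real n / ll"
  note as = asymp[OF ll(1), unfolded large_log_def]
  have rq: "r < q" using r(2) R(7) n by linarith
  have V: "norm (exp_sum f (of_int b / real r) t) \<le> V" if t: "t \<le> n" for t
  \<comment> \<open>The cut is at n^(3/4). Below it t is already at most n / ln n; above it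
    \<open>t div r\<close> is at least n^(1/2), so (ln n) / 2 can serve as \<tau>.\<close>
  proof (cases "real t \<le> exp (3 * ll / 4)")
    case True
    have "norm (exp_sum f (of_int b / real r) t) \<le> real t" using f_le by (rule norm_exp_sum_le)
    also have "\<dots> \<le> exp (3 * ll / 4)" by fact
    also have "\<dots> = real n / exp (ll / 4)" unfolding ll(3)[symmetric] by (simp add: exp_diff[symmetric])
    also have "\<dots> \<le> real n / ll" using as ll(2) by (intro divide_left_mono) auto
    also have "\<dots> = 1 * real n / ll" by simp
    also have "\<dots> \<le> V" unfolding V_def using K ll(2) by (intro divide_right_mono mult_right_mono) auto
    finally show ?thesis .
  next
    case False
    have tr: "exp (ll / 2) \<le> real (t div r)"
    proof -
      have "exp (ll / 2) + 1 \<le> exp (3 * ll / 4) / R" using as by (simp add: R_def B_def)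
      also have "\<dots> \<le> real t / real r" using False r by (intro frac_le) auto
      also have "\<dots> < real (t div r) + 1"
      proof -
        have "t < r + r * (t div r)" using r(1) by (rule dividend_less_times_div)
        then have "real t < real (r + r * (t div r))" by (simp only: of_nat_less_iff)
        then show ?thesis using r(1) by (simp add: field_simps)
      qed
      finally show ?thesis by simp
    qed
    have 0: "exp (ll / 2) > 0" by simp
    have "exp_sum f (of_int b / real r) t = (\<Sum>k\<in>{0<..t}. \<chi> (int k) * ee (real k * (of_int b / real r)))"
      by (simp add: exp_sum_def)
    also have "norm \<dots> \<le> 3 * K * sqrt (real r) * real t / (ll / 2) powr (3 + \<epsilon>)"
    proof (rule norm_twisted_sum_le[OF prim r(1) rq q3 A K hyp])
      have "real (t div r) > 0" using tr 0 by linarith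
      then have "t div r > 0" by (simp only: of_nat_0_less_iff)
      then show "r \<le> t" by (simp add: div_greater_zero_iff)
      show "0 < ll / 2" using ll(2) by simp
      show "ll / 2 \<le> ln (real (t div r))" using tr 0 by (subst ln_ge_iff) linarith+
      have 3: "q * r \<ge> 3" using q3 r(1) by (metis One_nat_def Suc_leI mult_le_mono nat_mult_1_right)
      \<comment> \<open>As r < q, the modulus q r is below q^2, so its iterated logarithm is at most
        ln 2 + L \<le> 2L; the summand 4A of \<open>A'\<close> allows for this.\<close>
      have "ln (real (q * r)) = ln (real q) + ln (real r)" using q3 r(1) by (simp add: ln_mult)
      also have "ln (real r) \<le> ln (real q)" using rq r(1) by simp
      finally have "ln (real (q * r)) \<le> 2 * ln (real q)" by simp
      then have "ln (ln (real (q * r))) \<le> ln (2 * ln (real q))" using ln_gt_1[OF 3] q by (subst ln_le_cancel_iff) auto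
      also have "\<dots> = ln 2 + L" unfolding L_def using q by (subst ln_mult) auto
      also have "\<dots> \<le> 2 * L" using L1 ln_2_less_1 by simp
      finally have "A * ln (ln (real (q * r))) \<le> A * (2 * L)" using A by (intro mult_left_mono) auto
      also have "\<dots> \<le> ll / 2"
      proof -
        have "4 * A * L \<le> A' * L" unfolding A'_def using \<epsilon> L1 by (intro mult_right_mono) (auto simp: B_def)
        then show ?thesis using ll(4) by simp
      qed
      finally show "A * ln (ln (real (q * r))) \<le> ll / 2" .
    qed (use \<epsilon> in auto)
    also have "\<dots> = 3 * K * 2 powr (3 + \<epsilon>) * (sqrt (real r) * real t) / ll powr (3 + \<epsilon>)"
      using ll(2) by (simp add: powr_divide)
    also have "\<dots> \<le> 3 * K * 2 powr (3 + \<epsilon>) * (ll powr (2 + \<epsilon>) * real n) / ll powr (3 + \<epsilon>)"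
    proof (intro divide_right_mono mult_left_mono mult_mono)
      show "sqrt (real r) \<le> ll powr (2 + \<epsilon>)" using r(2) by (simp add: R(5)[symmetric])
    qed (use K t in auto)
    also have "\<dots> = 3 * K * 2 powr (3 + \<epsilon>) * real n / ll"
    proof -
      have "ll powr (3 + \<epsilon>) = ll powr (1 + (2 + \<epsilon>))" by simp
      also have "\<dots> = ll * ll powr (2 + \<epsilon>)" using ll(2) by (subst powr_add) simp
      finally show ?thesis using ll(2) by simp
    qed
    also have "\<dots> \<le> V" unfolding V_def using ll(2) by (intro divide_right_mono mult_right_mono) auto
    finally show ?thesis .
  qed
  have "norm (exp_sum f \<alpha> n) \<le> 9 * V"
    using V r(3) by (rule exp_sum_near_le)
  also have "\<dots> = C3 * real n / ll" by (simp add: V_def C3_def)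
  also have "\<dots> \<le> C3 * real n * L powr \<epsilon> / ll"
  proof -
    have "1 \<le> L powr \<epsilon>" using L1 \<epsilon> by (simp add: ge_one_powr_ge_zero)
    moreover have "0 \<le> C3 * real n" unfolding C3_def using K by simp
    ultimately have "C3 * real n * 1 \<le> C3 * real n * L powr \<epsilon>" by (rule mult_left_mono)
    then show ?thesis using ll(2) by (intro divide_right_mono) auto
  qed
  finally show ?thesis unfolding good_def ll_def[symmetric] .
qed

text \<open>Dirichlet approximation with denominators up to N0, about n / R. Then r R \<le> n, as
  the large denominator case requires, and since N0 \<ge> n / (2R) the error is at most 2R / (r n),
  which is the second inequality of \<open>bad\<close>.\<close>

lemma good_or_bad: "good \<alpha> n \<or> (\<exists>b r. bad \<alpha> n b r)"
proof -
  define N0 where "N0 = nat \<lfloor>real n / R\<rfloor>"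
  have nR: "real n / R \<ge> 1" using R(1,7) by simp
  have N0: "real N0 \<le> real n / R" "real n / R < real N0 + 1" "N0 > 0"
  proof -
    show "real N0 \<le> real n / R" "real n / R < real N0 + 1" using nR by (auto simp: N0_def of_nat_nat)
    then show "N0 > 0" using nR by (intro Nat.gr0I) auto
  qed
  obtain b k where bk: "coprime b k" "0 < k" "k \<le> int N0" "\<bar>of_int k * \<alpha> - of_int b\<bar> < 1 / real N0"
    using Dirichlet_approx_coprime[OF N0(3), of \<alpha>] by blast
  define r where "r = nat k"
  have k: "k = int r" "of_int k = real r" using bk(2) by (auto simp: r_def)
  have r: "0 < r" "real r \<le> real N0" using bk(2,3) k by auto
  define \<delta> where "\<delta> = \<bar>\<alpha> - of_int b / real r\<bar>"
  have \<delta>: "\<delta> * real r < 1 / real N0"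
  proof -
    have "\<delta> * real r = \<bar>(\<alpha> - of_int b / real r) * real r\<bar>" by (simp add: \<delta>_def abs_mult)
    also have "(\<alpha> - of_int b / real r) * real r = of_int k * \<alpha> - of_int b" using r k by (simp add: field_simps)
    finally show ?thesis using bk(4) by simp
  qed
  show ?thesis
  proof (cases "R \<le> real r")
    case True
    have "1 / real N0 \<le> 1 / real r" using r by (intro divide_left_mono) auto
    then have "\<delta> * real r \<le> 1 / real r" using \<delta> by linarith
    then have "\<delta> \<le> 1 / (real r)\<^sup>2" using r(1) by (simp add: power2_eq_square field_simps)
    moreover have "real r * R \<le> real n" 
    proof -
      have "real r * R \<le> (real n / R) * R" using r(2) N0(1) R(1) by (intro mult_right_mono) auto
      then show ?thesis using R(1) by simp
    qed
    ultimately have "good \<alpha> n"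
      using True bk(1) unfolding \<delta>_def k(1) by (intro good_large_denominator[of b r]) auto
    then show ?thesis ..
  next
    case False
    show ?thesis
    proof (cases "\<delta> * real n \<le> 1")
      case True
      then have "good \<alpha> n" using r False unfolding \<delta>_def by (intro good_small_denominator[of r _ b]) auto
      then show ?thesis ..
    next
      case 2: False
      have "real N0 \<ge> real n / (2 * R)"
      proof -
        have "real N0 \<ge> 1" using N0(3) by simp
        then have "real n / R \<le> 2 * real N0" using N0(2) by linarith
        then show ?thesis using R(1) by (simp add: field_simps)
      qed
      then have "1 / real N0 \<le> 1 / (real n / (2 * R))" using npos R(1) N0(3) by (intro divide_left_mono) auto
      then have "\<delta> * real r \<le> 2 * R / real n" using \<delta> by simp
      then have "\<delta> * real r * real n \<le> 2 * R" using npos by (simp add: field_simps)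
      then have "bad \<alpha> n b r"
        using r False 2 R(4) unfolding bad_def \<delta>_def by (auto simp: mult.assoc)
      then show ?thesis by blast
    qed
  qed
qed

end

text \<open>Two different fractions satisfy 1 \<le> |b r' - b' r|. Both are within 2 Rq / (r y) of
  \<alpha>, with their own r, so this determinant is also at most 4 Rq^2 / y < 1.\<close>

lemma bad_unique:
  assumes "bad \<alpha> n b r" "bad \<alpha> n' b' r'" "y < real n" "y < real n'"
  shows "of_int b / real r = of_int b' / real r'"
proof (rule ccontr)
  assume neq: "of_int b / real r \<noteq> of_int b' / real r'"
  have r: "0 < r" "0 < r'" "real r < Rq" "real r' < Rq" using assms by (auto simp: bad_def)
  have y0: "y > 0" using y_ge q by (smt (verit))
  have R0: "Rq > 0" using r by simp
  have *: "\<bar>\<alpha> - of_int b / real r\<bar> * real r \<le> 2 * Rq / y" if "bad \<alpha> n b r" "y < real n" for n b r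
  proof -
    have "\<bar>\<alpha> - of_int b / real r\<bar> * real r * y \<le> \<bar>\<alpha> - of_int b / real r\<bar> * real r * real n"
      using that by (intro mult_left_mono) auto
    also have "\<dots> \<le> 2 * Rq" using that by (simp add: bad_def mult.assoc)
    finally show ?thesis using y0 by (simp add: field_simps)
  qed
  have "b * int r' \<noteq> b' * int r"
  proof
    assume "b * int r' = b' * int r"
    then have "of_int (b * int r') = (of_int (b' * int r) :: real)" by (rule arg_cong)
    then show False using neq r by (simp add: field_simps)
  qed
  then have "1 \<le> \<bar>b * int r' - b' * int r\<bar>" by linarith
  then have "of_int 1 \<le> (of_int \<bar>b * int r' - b' * int r\<bar> :: real)" by (subst of_int_le_iff)
  also have "\<dots> = \<bar>of_int b * real r' - of_int b' * real r\<bar>" by simp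
  also have "of_int b * real r' - of_int b' * real r = (\<alpha> - of_int b' / real r') * real r' * real r - (\<alpha> - of_int b / real r) * real r * real r'"
    using r by (simp add: field_simps)
  also have "\<bar>\<dots>\<bar> \<le> \<bar>(\<alpha> - of_int b' / real r') * real r' * real r\<bar> + \<bar>(\<alpha> - of_int b / real r) * real r * real r'\<bar>"
    by (rule abs_triangle_ineq4)
  also have "\<dots> = (\<bar>\<alpha> - of_int b' / real r'\<bar> * real r') * real r + (\<bar>\<alpha> - of_int b / real r\<bar> * real r) * real r'"
    by (simp add: abs_mult)
  also have "\<dots> \<le> (2 * Rq / y) * Rq + (2 * Rq / y) * Rq"
    using *[OF assms(1,3)] *[OF assms(2,4)] r y0 R0 by (intro add_mono mult_mono) auto
  also have "\<dots> = 4 * (Rq * Rq) / y" by simp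
  also have "Rq * Rq = ln (real q) powr (2 * B)" unfolding Rq_def by (simp add: powr_add[symmetric])
  also have "4 * (ln (real q) powr (2 * B)) / y < 1" using y_ge(2) y0 by simp
  finally show False by simp
qed

text \<open>\<open>A'\<close> comes from n \<le> \<open>y\<close>, 2 * \<open>C3\<close> from the
  good n with 1 + L \<le> 2L, \<open>B\<close> from the exceptional interval; the constants add up
  to 4 and are covered by the 6.\<close>

definition "C4 = 6 + A' + B + 2 * C3"

lemma norm_log_sum_primitive:
  assumes N: "N \<le> q"
  shows "norm (\<Sum>n\<in>{0<..N}. f n * ee (real n * \<alpha>) / of_nat n) \<le> C4 * L powr (1 + \<epsilon>)"
proof -
  define a where "a n = norm (exp_sum f \<alpha> n) / (real n * real (Suc n))" for n
  define Y where "Y = nat \<lfloor>y\<rfloor>"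
  define Z1 where "Z1 = {n \<in> {0<..<N}. n \<le> Y}"
  define Z2 where "Z2 = {n \<in> {0<..<N}. Y < n \<and> good \<alpha> n}"
  define Z3 where "Z3 = {n \<in> {0<..<N}. Y < n \<and> \<not> good \<alpha> n}"
  have y4: "y \<ge> 4" using y_ge q by (smt (verit))
  have Yy: "y < real n" if "Y < n" for n using that y4 unfolding Y_def by linarith
  have Y: "Y \<ge> 3" "real Y \<le> y" using y4 unfolding Y_def by linarith+
  have C3: "C3 \<ge> 0" using K by (simp add: C3_def)
  have B0: "B > 0" using \<epsilon> by (simp add: B_def)
  have A0: "A' > 0" using A B0 by (simp add: A'_def)
  have a0: "a n \<ge> 0" for n by (simp add: a_def)
  have a_le: "a n \<le> 1 / real n" if "n > 0" for n
  proof -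
    have "a n \<le> real n / (real n * real (Suc n))"
      unfolding a_def using norm_exp_sum_le[of f \<alpha> n] f_le by (intro divide_right_mono) auto
    also have "\<dots> = 1 / real (Suc n)" using that by simp
    also have "\<dots> \<le> 1 / real n" using that by (intro divide_left_mono) auto
    finally show ?thesis .
  qed
  have S1: "(\<Sum>n\<in>Z1. a n) \<le> 1 + A' * L"
  proof -
    have "(\<Sum>n\<in>Z1. a n) \<le> (\<Sum>n\<in>Z1. 1 / real n)" using a_le by (intro sum_mono) (auto simp: Z1_def)
    also have "\<dots> \<le> (\<Sum>n=1..Y. 1 / real n)" by (intro sum_mono2) (auto simp: Z1_def)
    also have "\<dots> \<le> 1 + ln (real (max 1 Y))" by (rule sum_inverse_le)
    also have "ln (real (max 1 Y)) \<le> ln y" using Y by (simp add: max_def)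
    finally show ?thesis using y_ge(3) by simp
  qed
  have S2: "(\<Sum>n\<in>Z2. a n) \<le> C3 * L powr \<epsilon> * (1 + L)"
  proof -
    have "(\<Sum>n\<in>Z2. a n) \<le> (\<Sum>n\<in>Z2. C3 * L powr \<epsilon> * (1 / (real n * ln (real n))))"
    proof (rule sum_mono)
      fix n assume n: "n \<in> Z2"
      then have n3: "n \<ge> 3" using Y by (auto simp: Z2_def)
      have l: "ln (real n) > 0" using ln_gt_1[OF n3] by simp
      have "a n \<le> (C3 * real n * L powr \<epsilon> / ln (real n)) / (real n * real n)"
        unfolding a_def using n n3 l C3 by (intro frac_le) (auto simp: Z2_def good_def)
      also have "\<dots> = C3 * L powr \<epsilon> * (1 / (real n * ln (real n)))" using n3 by (simp add: field_simps)
      finally show "a n \<le> C3 * L powr \<epsilon> * (1 / (real n * ln (real n)))" .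
    qed
    also have "\<dots> = C3 * L powr \<epsilon> * (\<Sum>n\<in>Z2. 1 / (real n * ln (real n)))" by (rule sum_distrib_left[symmetric])
    also have "\<dots> \<le> C3 * L powr \<epsilon> * (1 + L)"
    proof (rule mult_left_mono)
      have "(\<Sum>n\<in>Z2. 1 / (real n * ln (real n))) \<le> (\<Sum>n\<in>{3..q}. 1 / (real n * ln (real n)))"
        using Y N by (intro sum_mono2) (auto simp: Z2_def)
      also have "\<dots> \<le> 1 + L" unfolding L_def using q3 by (rule sum_inverse_n_ln_n_le)
      finally show "(\<Sum>n\<in>Z2. 1 / (real n * ln (real n))) \<le> 1 + L" .
    qed (use C3 in auto)
    finally show ?thesis .
  qed
  have S3: "(\<Sum>n\<in>Z3. a n) \<le> 2 + B * L"
  proof (cases "Z3 = {}")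
    case False
    have bad: "\<exists>b r. bad \<alpha> n b r" if "n \<in> Z3" for n
      using that good_or_bad[of n \<alpha>] Yy[of n] N by (auto simp: Z3_def)
    obtain n0 b0 r0 where n0: "n0 \<in> Z3" "bad \<alpha> n0 b0 r0" using False bad by blast
    define \<delta> where "\<delta> = \<bar>\<alpha> - of_int b0 / real r0\<bar>"
    have \<delta>: "1 < \<delta> * real n \<and> \<delta> * real n \<le> 2 * Rq" if "n \<in> Z3" for n
    proof -
      obtain b r where br: "bad \<alpha> n b r" using bad[OF \<open>n \<in> Z3\<close>] by blast
      \<comment> \<open>Only the values of the fractions agree, since \<open>bad\<close> does not
        ask for lowest terms. The distance \<delta> depends on the value alone, and r \<ge> 1 then
        removes r from the upper bound.\<close>
      have "of_int b / real r = of_int b0 / real r0"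
        using br n0 that by (intro bad_unique[of \<alpha> n b r n0]) (auto simp: Z3_def intro: Yy)
      then have eq: "\<bar>\<alpha> - of_int b / real r\<bar> = \<delta>" by (simp add: \<delta>_def)
      have b: "1 < \<delta> * real n" "\<delta> * (real r * real n) \<le> 2 * Rq" "0 < r" using br by (auto simp: bad_def eq)
      have "\<delta> * (1 * real n) \<le> \<delta> * (real r * real n)"
        using b(3) by (intro mult_left_mono mult_right_mono) (auto simp: \<delta>_def)
      then show ?thesis using b by simp
    qed
    have \<delta>0: "\<delta> > 0" using \<delta>[OF n0(1)] by (smt (verit) mult_nonneg_nonneg mult_nonpos_nonneg of_nat_0_le_iff)
    have Rq1: "Rq \<ge> 1" unfolding Rq_def using q B0 by (intro ge_one_powr_ge_zero) auto
    have "(\<Sum>n\<in>Z3. a n) \<le> (\<Sum>n\<in>Z3. 1 / real n)" using a_le by (intro sum_mono) (auto simp: Z3_def)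
    also have "\<dots> \<le> 1 + ln (2 * Rq)"
    proof (rule sum_inverse_interval_le)
      fix m n assume mn: "m \<in> Z3" "n \<in> Z3"
      have "\<delta> * real n \<le> (2 * Rq) * 1" using \<delta>[OF mn(2)] by simp
      also have "\<dots> \<le> (2 * Rq) * (\<delta> * real m)" using \<delta>[OF mn(1)] Rq1 by (intro mult_left_mono) auto
      finally have "\<delta> * real n \<le> \<delta> * (2 * Rq * real m)" by (simp add: mult_ac)
      then show "real n \<le> 2 * Rq * real m" using \<delta>0 by simp
    qed (use Rq1 in \<open>auto simp: Z3_def\<close>)
    also have "ln (2 * Rq) = ln 2 + B * L"
      unfolding L_def using Rq1 q by (subst ln_mult) (auto simp: Rq_def ln_powr)
    finally show ?thesis using ln_2_less_1 by simp
  qed (use B0 L1 in auto)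
  have "norm (\<Sum>n\<in>{0<..N}. f n * ee (real n * \<alpha>) / of_nat n) \<le> 1 + (\<Sum>n\<in>{0<..<N}. a n)"
    unfolding a_def using f_le by (rule norm_log_sum_le)
  also have "(\<Sum>n\<in>{0<..<N}. a n) = (\<Sum>n\<in>Z1. a n) + ((\<Sum>n\<in>Z2. a n) + (\<Sum>n\<in>Z3. a n))"
  proof -
    have "{0<..<N} = Z1 \<union> (Z2 \<union> Z3)" "Z1 \<inter> (Z2 \<union> Z3) = {}" "Z2 \<inter> Z3 = {}"
      by (auto simp: Z1_def Z2_def Z3_def)
    moreover have "finite Z1" "finite Z2" "finite Z3" by (auto simp: Z1_def Z2_def Z3_def)
    ultimately show ?thesis by (simp add: sum.union_disjoint)
  qed
  also have "\<dots> \<le> (1 + A' * L) + (C3 * L powr \<epsilon> * (1 + L) + (2 + B * L))"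
    using S1 S2 S3 by (intro add_mono)
  also have "1 + ((1 + A' * L) + (C3 * L powr \<epsilon> * (1 + L) + (2 + B * L))) = 4 + (A' + B) * L + C3 * L powr \<epsilon> * (1 + L)"
    by (simp add: algebra_simps)
  also have "\<dots> \<le> 4 * L powr (1 + \<epsilon>) + (A' + B) * L powr (1 + \<epsilon>) + C3 * L powr \<epsilon> * (2 * L)"
  proof (intro add_mono mult_left_mono)
    have 1: "L powr 1 \<le> L powr (1 + \<epsilon>)" using L1 \<epsilon> by (intro powr_mono) auto
    then show "L \<le> L powr (1 + \<epsilon>)" using L1 by simp
    then show "4 \<le> 4 * L powr (1 + \<epsilon>)" using L1 by simp
  qed (use A0 B0 C3 L1 in auto)
  also have "C3 * L powr \<epsilon> * (2 * L) = 2 * C3 * L powr (1 + \<epsilon>)" using L1 by (simp add: powr_add)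
  also have "4 * L powr (1 + \<epsilon>) + (A' + B) * L powr (1 + \<epsilon>) + 2 * C3 * L powr (1 + \<epsilon>) \<le> C4 * L powr (1 + \<epsilon>)"
    unfolding C4_def distrib_right[symmetric] by (intro mult_right_mono) auto
  finally show ?thesis by simp
qed

end

section \<open>Gauss sums and the Polya expansion\<close>

lemma sum_residues_mult:
  fixes F :: "int \<Rightarrow> complex"
  assumes q: "q > 0" and u: "coprime u (int q)" and F: "\<And>x y. [x = y] (mod int q) \<Longrightarrow> F x = F y"
  shows "(\<Sum>a\<in>{0..<int q}. F (u * a)) = (\<Sum>a\<in>{0..<int q}. F a)"
proof -
  have inj: "inj_on (\<lambda>a. u * a mod int q) {0..<int q}"
  proof (rule inj_onI)
    fix a b assume ab: "a \<in> {0..<int q}" "b \<in> {0..<int q}" "u * a mod int q = u * b mod int q"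
    then have "[u * a = u * b] (mod int q)" by (simp add: cong_def)
    then have "[a = b] (mod int q)" using u by (simp add: cong_mult_lcancel)
    then show "a = b" using ab by (simp add: cong_def)
  qed
  have "(\<lambda>a. u * a mod int q) ` {0..<int q} = {0..<int q}"
    using q by (intro endo_inj_surj inj) auto
  then have "(\<Sum>a\<in>{0..<int q}. F a) = (\<Sum>a\<in>(\<lambda>a. u * a mod int q) ` {0..<int q}. F a)" by simp
  also have "\<dots> = (\<Sum>a\<in>{0..<int q}. F (u * a mod int q))" by (simp add: sum.reindex[OF inj])
  also have "\<dots> = (\<Sum>a\<in>{0..<int q}. F (u * a))" by (intro sum.cong refl F) (simp add: cong_def)
  finally show ?thesis ..
qed

lemma ee_fraction_cong:
  assumes "q > 0" "[x = y] (mod int q)" shows "ee (of_int x / real q) = ee (of_int y / real q)"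
proof -
  obtain k where "x = y + int q * k" using assms(2) by (metis cong_iff_lin cong_sym)
  then have "of_int x / real q = of_int y / real q + of_int k" using assms(1) by (simp add: field_simps)
  then show ?thesis by (simp only: ee_add_int)
qed

lemma sum_ee_residues:
  assumes q: "q > 0"
  shows "(\<Sum>k\<in>{0..<int q}. ee (of_int (c * k) / real q)) = (if int q dvd c then of_nat q else 0)"
proof -
  \<comment> \<open>The sign matches \<open>sum_roots_of_unity\<close>, whose phase carries a minus
    sign.\<close>
  define i where "i = nat ((- c) mod int q)"
  have i: "int i = (- c) mod int q" "i < q" using q by (auto simp: i_def nat_less_iff)
  have "[c = - int i] (mod int q)" unfolding i(1) by (simp add: cong_def mod_minus_eq)
  have "(\<Sum>k\<in>{0..<int q}. ee (of_int (c * k) / real q)) = (\<Sum>k\<in>{0..<int q}. ee (of_int (- int i * k) / real q))"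
    using \<open>[c = - int i] (mod int q)\<close> by (intro sum.cong refl ee_fraction_cong q cong_scalar_right)
  also have "\<dots> = (\<Sum>k\<in>int ` {..<q}. ee (of_int (- int i * k) / real q))"
    by (metis image_int_atLeastLessThan lessThan_atLeast0 of_nat_0)
  also have "(\<Sum>k\<in>int ` {..<q}. ee (of_int (- int i * k) / real q)) = (\<Sum>k<q. ee (- (real i * real k / real q)))"
    by (subst sum.reindex) (auto simp: inj_on_def)
  also have "\<dots> = (if i = 0 then of_nat q else 0)" using q i(2) by (rule sum_roots_of_unity)
  also have "i = 0 \<longleftrightarrow> int q dvd c"
  proof -
    have "i = 0 \<longleftrightarrow> int i = 0" by simp
    also have "\<dots> \<longleftrightarrow> int q dvd - c" unfolding i(1) by (simp only: mod_eq_0_iff_dvd)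
    finally show ?thesis by simp
  qed
  finally show ?thesis .
qed

definition gauss_sum :: "nat \<Rightarrow> (int \<Rightarrow> complex) \<Rightarrow> int \<Rightarrow> complex" where
  "gauss_sum q \<chi> k = (\<Sum>a\<in>{0..<int q}. \<chi> a * ee (of_int (k * a) / real q))"

text \<open>For a unit k substitute k a for a. Otherwise k and q share a factor g > 1; primitivity
  gives a unit u congruent to 1 modulo q / g with \<chi> u \<noteq> 1. Since k u is congruent to k
  modulo q, substituting u a shows that the sum equals \<chi> u times itself, so it vanishes like
  \<chi> k.\<close>

lemma gauss_sum_primitive:
  assumes prim: "primitive_character q \<chi>"
  shows "gauss_sum q \<chi> k = cnj (\<chi> k) * gauss_sum q \<chi> 1"
proof -
  have \<chi>: "dirichlet_character q \<chi>" using prim by (simp add: primitive_character_def)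
  have q: "q > 0" using \<chi> by (rule dirichlet_character_simps)
  have per: "\<chi> x * ee (of_int (c * x) / real q) = \<chi> y * ee (of_int (c * y) / real q)" if "[x = y] (mod int q)" for x y c
    using dirichlet_character_cong[OF \<chi> that] ee_fraction_cong[OF q cong_scalar_left[OF that], of c] by simp
  show ?thesis
  proof (cases "coprime k (int q)")
    case True
    have "gauss_sum q \<chi> 1 = (\<Sum>a\<in>{0..<int q}. \<chi> (k * a) * ee (of_int (1 * (k * a)) / real q))"
      unfolding gauss_sum_def by (rule sum_residues_mult[OF q True per, symmetric])
    also have "\<dots> = \<chi> k * gauss_sum q \<chi> k"
      by (simp add: gauss_sum_def dirichlet_character_simps(2)[OF \<chi>] sum_distrib_left mult.assoc)
    finally have "cnj (\<chi> k) * gauss_sum q \<chi> 1 = (\<chi> k * cnj (\<chi> k)) * gauss_sum q \<chi> k" by simp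
    also have "\<chi> k * cnj (\<chi> k) = 1"
      using norm_dirichlet_character[OF \<chi>, of k] True by (simp flip: complex_norm_square)
    finally show ?thesis by simp
  next
    case False
    define g where "g = gcd k (int q)"
    have g: "g dvd k" "g dvd int q" "g > 0" "g \<noteq> 1" using q False by (auto simp: g_def coprime_iff_gcd_eq_1)
    obtain k' d' where kd: "k = g * k'" "int q = g * d'" using g(1,2) by (auto simp: dvd_def)
    have d': "d' > 0" using kd(2) q g(3) by (metis of_nat_0_less_iff zero_less_mult_pos)
    define d where "d = nat d'"
    have d: "int d = d'" using d' by (simp add: d_def)
    have "d dvd q" using kd(2) d by (metis dvd_triv_right of_nat_dvd_iff)
    moreover have "d < q"
    proof -
      have "1 * d' < g * d'" using g d' by (intro mult_strict_right_mono) auto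
      then have "int d < int q" using kd(2) d by simp
      then show ?thesis by simp
    qed
    ultimately obtain u where u: "coprime u (int q)" "[u = 1] (mod int d)" "\<chi> u \<noteq> 1"
      using prim unfolding primitive_character_def by blast
    have ku: "[k * u = k] (mod int q)"
    proof -
      obtain j where "u = 1 + d' * j" using u(2) d by (metis cong_iff_lin cong_sym mult.commute)
      then have "k * u - k = int q * (k' * j)" using kd by (simp add: algebra_simps)
      then show ?thesis by (simp add: cong_iff_dvd_diff)
    qed
    have "gauss_sum q \<chi> k = (\<Sum>a\<in>{0..<int q}. \<chi> (u * a) * ee (of_int (k * (u * a)) / real q))"
      unfolding gauss_sum_def by (rule sum_residues_mult[OF q u(1) per, symmetric])
    also have "\<dots> = (\<Sum>a\<in>{0..<int q}. \<chi> u * (\<chi> a * ee (of_int (k * a) / real q)))"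
    proof (rule sum.cong[OF refl])
      fix a
      have "[k * (u * a) = k * a] (mod int q)" using cong_scalar_right[OF ku, of a] by (simp add: mult.assoc)
      then have "ee (of_int (k * (u * a)) / real q) = ee (of_int (k * a) / real q)" by (rule ee_fraction_cong[OF q])
      then show "\<chi> (u * a) * ee (of_int (k * (u * a)) / real q) = \<chi> u * (\<chi> a * ee (of_int (k * a) / real q))"
        by (simp only: dirichlet_character_simps(2)[OF \<chi>] mult.assoc)
    qed
    also have "\<dots> = \<chi> u * gauss_sum q \<chi> k" by (simp add: gauss_sum_def sum_distrib_left)
    finally have "(1 - \<chi> u) * gauss_sum q \<chi> k = 0" by (simp add: algebra_simps)
    then have "gauss_sum q \<chi> k = 0" using u(3) by simp
    then show ?thesis using False dirichlet_character_simps(3)[OF \<chi>] by simp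
  qed
qed

text \<open>By Parseval the squares of all Gauss sums add up to q S, where S is the sum of |\<chi>
  a|^2 over a period; by \<open>gauss_sum_primitive\<close> they also add up to S times the square
  at 1. Since S > 0 it cancels.\<close>

lemma norm_gauss_sum_primitive:
  assumes prim: "primitive_character q \<chi>"
  shows "norm (gauss_sum q \<chi> 1) \<le> sqrt (real q)"
proof -
  have \<chi>: "dirichlet_character q \<chi>" using prim by (simp add: primitive_character_def)
  have q: "q > 0" using \<chi> by (rule dirichlet_character_simps)
  define I where "I = {0..<int q}"
  define S where "S = (\<Sum>a\<in>I. (norm (\<chi> a))\<^sup>2)"
  have fin: "finite I" by (simp add: I_def)
  have "complex_of_real (\<Sum>k\<in>I. (norm (gauss_sum q \<chi> k))\<^sup>2) = (\<Sum>k\<in>I. gauss_sum q \<chi> k * cnj (gauss_sum q \<chi> k))"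
    by (simp add: complex_norm_square[symmetric] of_real_sum of_real_power)
  also have "\<dots> = (\<Sum>k\<in>I. \<Sum>a\<in>I. \<Sum>b\<in>I. \<chi> a * cnj (\<chi> b) * ee (of_int ((a - b) * k) / real q))"
    unfolding gauss_sum_def I_def[symmetric] cnj_sum sum_product
  proof (intro sum.cong refl)
    fix k a b
    have "of_int ((a - b) * k) / real q = of_int (k * a) / real q - of_int (k * b) / real q"
      by (simp add: algebra_simps diff_divide_distrib)
    then have "ee (of_int ((a - b) * k) / real q) = ee (of_int (k * a) / real q) * cnj (ee (of_int (k * b) / real q))"
      by (simp only: ee_diff)
    then show "\<chi> a * ee (of_int (k * a) / real q) * cnj (\<chi> b * ee (of_int (k * b) / real q)) = \<chi> a * cnj (\<chi> b) * ee (of_int ((a - b) * k) / real q)"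
      by (simp only: complex_cnj_mult mult_ac)
  qed
  also have "\<dots> = (\<Sum>a\<in>I. \<Sum>k\<in>I. \<Sum>b\<in>I. \<chi> a * cnj (\<chi> b) * ee (of_int ((a - b) * k) / real q))" by (rule sum.swap)
  also have "\<dots> = (\<Sum>a\<in>I. \<Sum>b\<in>I. \<chi> a * cnj (\<chi> b) * (\<Sum>k\<in>I. ee (of_int ((a - b) * k) / real q)))"
    unfolding sum_distrib_left by (intro sum.cong refl sum.swap)
  also have "\<dots> = (\<Sum>a\<in>I. \<Sum>b\<in>I. if b = a then \<chi> a * cnj (\<chi> a) * of_nat q else 0)"
  proof (intro sum.cong refl)
    fix a b assume ab: "a \<in> I" "b \<in> I"
    have "int q dvd a - b \<longleftrightarrow> b = a"
    proof
      assume "int q dvd a - b"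
      then have "a mod int q = b mod int q" by (simp add: mod_eq_dvd_iff)
      then show "b = a" using ab by (simp add: I_def)
    qed simp
    then show "\<chi> a * cnj (\<chi> b) * (\<Sum>k\<in>I. ee (of_int ((a - b) * k) / real q)) = (if b = a then \<chi> a * cnj (\<chi> a) * of_nat q else 0)"
      unfolding I_def sum_ee_residues[OF q] by auto
  qed
  also have "\<dots> = (\<Sum>a\<in>I. \<chi> a * cnj (\<chi> a) * of_nat q)" using fin by simp
  also have "\<dots> = complex_of_real (S * real q)"
    by (simp add: S_def complex_norm_square[symmetric] of_real_sum of_real_power sum_distrib_right)
  finally have 1: "(\<Sum>k\<in>I. (norm (gauss_sum q \<chi> k))\<^sup>2) = S * real q" by (simp only: of_real_eq_iff)
  have "(norm (gauss_sum q \<chi> k))\<^sup>2 = (norm (\<chi> k))\<^sup>2 * (norm (gauss_sum q \<chi> 1))\<^sup>2" for k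
    by (subst gauss_sum_primitive[OF prim]) (simp add: norm_mult power_mult_distrib)
  then have "(\<Sum>k\<in>I. (norm (gauss_sum q \<chi> k))\<^sup>2) = (\<Sum>k\<in>I. (norm (\<chi> k))\<^sup>2 * (norm (gauss_sum q \<chi> 1))\<^sup>2)"
    by (rule sum.cong[OF refl])
  then have 2: "(\<Sum>k\<in>I. (norm (gauss_sum q \<chi> k))\<^sup>2) = S * (norm (gauss_sum q \<chi> 1))\<^sup>2"
    unfolding S_def sum_distrib_right .
  have "S * (norm (gauss_sum q \<chi> 1))\<^sup>2 = S * real q" by (rule trans[OF sym[OF 2] 1])
  moreover have "S > 0"
  proof -
    have "(1 mod int q) \<in> I" using q by (simp add: I_def)
    moreover have "\<chi> (1 mod int q) = 1"
      using dirichlet_character_cong[OF \<chi>, of "1 mod int q" 1] dirichlet_character_simps(4)[OF \<chi>] by (simp add: cong_def)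
    ultimately have "1 \<le> S" unfolding S_def using fin
      using member_le_sum[of "1 mod int q" I "\<lambda>a. (norm (\<chi> a))\<^sup>2"] by simp
    then show ?thesis by simp
  qed
  ultimately have "(norm (gauss_sum q \<chi> 1))\<^sup>2 = real q" by (metis less_irrefl mult_cancel_left)
  then show ?thesis by (intro real_le_rsqrt) simp
qed

text \<open>Finite Fourier inversion, in which \<open>gauss_sum_primitive\<close> replaces the k-th
  coefficient by the conjugate character value times a constant.\<close>

lemma character_fourier:
  assumes prim: "primitive_character q \<chi>"
  shows "of_nat q * \<chi> n = gauss_sum q \<chi> 1 * (\<Sum>k\<in>{0..<int q}. cnj (\<chi> k) * ee (- (of_int (k * n) / real q)))"
proof -
  have \<chi>: "dirichlet_character q \<chi>" using prim by (simp add: primitive_character_def)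
  have q: "q > 0" using \<chi> by (rule dirichlet_character_simps)
  have "gauss_sum q \<chi> 1 * (\<Sum>k\<in>{0..<int q}. cnj (\<chi> k) * ee (- (of_int (k * n) / real q))) = 
      (\<Sum>k\<in>{0..<int q}. gauss_sum q \<chi> k * ee (- (of_int (k * n) / real q)))"
    unfolding sum_distrib_left by (intro sum.cong refl, subst (2) gauss_sum_primitive[OF prim]) simp
  also have "\<dots> = (\<Sum>k\<in>{0..<int q}. \<Sum>a\<in>{0..<int q}. \<chi> a * ee (of_int ((a - n) * k) / real q))"
    unfolding gauss_sum_def sum_distrib_right
  proof (intro sum.cong refl)
    fix k a
    have "of_int ((a - n) * k) / real q = of_int (k * a) / real q + - (of_int (k * n) / real q)"
      by (simp add: algebra_simps diff_divide_distrib)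
    then have "ee (of_int ((a - n) * k) / real q) = ee (of_int (k * a) / real q) * ee (- (of_int (k * n) / real q))"
      by (simp only: ee_add)
    then show "\<chi> a * ee (of_int (k * a) / real q) * ee (- (of_int (k * n) / real q)) = \<chi> a * ee (of_int ((a - n) * k) / real q)"
      by (simp only: mult.assoc)
  qed
  also have "\<dots> = (\<Sum>a\<in>{0..<int q}. \<chi> a * (\<Sum>k\<in>{0..<int q}. ee (of_int ((a - n) * k) / real q)))"
    unfolding sum_distrib_left by (rule sum.swap)
  also have "\<dots> = (\<Sum>a\<in>{0..<int q}. if a = n mod int q then \<chi> a * of_nat q else 0)"
  proof (intro sum.cong refl)
    fix a assume a: "a \<in> {0..<int q}"
    have "int q dvd a - n \<longleftrightarrow> a = n mod int q"
    proof -
      have "int q dvd a - n \<longleftrightarrow> a mod int q = n mod int q" by (simp add: mod_eq_dvd_iff)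
      then show ?thesis using a by simp
    qed
    then show "\<chi> a * (\<Sum>k\<in>{0..<int q}. ee (of_int ((a - n) * k) / real q)) = (if a = n mod int q then \<chi> a * of_nat q else 0)"
      unfolding sum_ee_residues[OF q] by auto
  qed
  also have "\<dots> = \<chi> (n mod int q) * of_nat q" using q by simp
  also have "\<chi> (n mod int q) = \<chi> n" by (rule dirichlet_character_cong[OF \<chi>]) (simp add: cong_def)
  finally show ?thesis by (simp add: mult.commute)
qed

text \<open>Subtracts the pole at 0. With u = 2 pi \<theta>, the numerator of the difference is at
  most u^2 by Taylor expansion and the denominator is at least u^2 / pi, so the quotient is at most
  pi. The restriction \<theta> \<le> 1/2 keeps away from the pole at 1.\<close>

lemma inverse_ee_minus_1:
  assumes "0 < \<theta>" "\<theta> \<le> 1 / 2"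
  shows "norm (1 / (ee \<theta> - 1) - 1 / (2 * pi * \<i> * \<theta>)) \<le> 4"
proof -
  define u where "u = 2 * pi * \<theta>"
  have u: "u > 0" using assms by (simp add: u_def)
  have n1: "norm (ee \<theta> - 1) \<ge> u / pi"
  proof -
    have "frac \<theta> = \<theta>" using assms by (simp add: frac_eq)
    then have "int_dist \<theta> = \<theta>" using assms by (simp add: int_dist_def)
    then show ?thesis using norm_1_minus_ee_ge[of \<theta>] by (simp add: u_def norm_minus_commute)
  qed
  have n0: "ee \<theta> - 1 \<noteq> 0" using n1 u by (auto simp: field_simps)
  have sq: "norm (1 + \<i> * u - ee \<theta>) \<le> u\<^sup>2"
  proof -
    have "norm (1 + \<i> * u - ee \<theta>) \<le> \<bar>1 - cos u\<bar> + \<bar>u - sin u\<bar>"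
      using cmod_le[of "1 + \<i> * u - ee \<theta>"] by (simp add: ee_def u_def)
    moreover have "\<bar>1 - cos u\<bar> \<le> u\<^sup>2 / 2"
    proof -
      have "1 - cos u = 2 * (sin (u / 2))\<^sup>2" using cos_double_sin[of "u / 2"] by simp
      also have "(sin (u / 2))\<^sup>2 \<le> (u / 2)\<^sup>2" using abs_sin_x_le_abs_x[of "u / 2"] by (simp only: abs_le_square_iff)
      finally show ?thesis using cos_le_one[of u] by (simp add: power2_eq_square)
    qed
    moreover have "\<bar>u - sin u\<bar> \<le> u\<^sup>2 / 2"
      using Maclaurin_sin_bound[of u 2] by (simp add: numeral_2_eq_2 sin_coeff_def power2_eq_square abs_minus_commute)
    ultimately show ?thesis by simp
  qed
  have "1 / (ee \<theta> - 1) - 1 / (2 * pi * \<i> * \<theta>) = (1 + \<i> * u - ee \<theta>) / ((ee \<theta> - 1) * (\<i> * u))"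
    using n0 u assms by (simp add: u_def field_simps)
  also have "norm \<dots> = norm (1 + \<i> * u - ee \<theta>) / (norm (ee \<theta> - 1) * u)"
    using u by (simp add: norm_divide norm_mult)
  also have "\<dots> \<le> u\<^sup>2 / (u / pi * u)"
    using sq n1 u by (intro frac_le mult_right_mono) auto
  also have "\<dots> = pi" using u by (simp add: power2_eq_square)
  finally show ?thesis using pi_less_4 by simp
qed

lemma sum_ee_negative:
  assumes "ee \<theta> \<noteq> 1"
  shows "(\<Sum>n\<in>{0<..N}. ee (- (\<theta> * real n))) = (1 - ee (- (\<theta> * real N))) / (ee \<theta> - 1)"
proof -
  have "(ee \<theta> - 1) * (\<Sum>n\<in>{0<..N}. ee (- (\<theta> * real n))) = 1 - ee (- (\<theta> * real N))"
  proof (induction N)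
    case (Suc N)
    have "{0<..Suc N} = insert (Suc N) {0<..N}" by auto
    then have "(ee \<theta> - 1) * (\<Sum>n\<in>{0<..Suc N}. ee (- (\<theta> * real n))) = 
       (ee \<theta> - 1) * ee (- (\<theta> * real (Suc N))) + (1 - ee (- (\<theta> * real N)))"
      using Suc by (simp add: distrib_left)
    also have "(ee \<theta> - 1) * ee (- (\<theta> * real (Suc N))) = ee (- (\<theta> * real N)) - ee (- (\<theta> * real (Suc N)))"
    proof -
      have "- (\<theta> * real N) = \<theta> + - (\<theta> * real (Suc N))" by (simp add: algebra_simps)
      then have "ee (- (\<theta> * real N)) = ee \<theta> * ee (- (\<theta> * real (Suc N)))" by (simp only: ee_add)
      then show ?thesis by (simp add: left_diff_distrib)
    qed
    finally show ?case by simp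
  qed simp
  then show ?thesis using assms by (simp add: field_simps)
qed

text \<open>Pairing k with q - k brings all frequencies k / q into the range below 1/2. The unpaired
  residues are 0 and, for even q, q / 2; for q \<ge> 3 neither is a unit, so the two vanishing
  assumptions hold for characters.\<close>

lemma sum_symmetric_residues:
  fixes F :: "int \<Rightarrow> complex"
  assumes q: "q \<ge> 3" and F0: "F 0 = 0" and Fh: "even q \<Longrightarrow> F (int (q div 2)) = 0"
  shows "(\<Sum>k\<in>{0..<int q}. F k) = (\<Sum>k\<in>{0<..(q - 1) div 2}. F (int k) + F (int q - int k))"
proof -
  define H where "H = (q - 1) div 2"
  have "(\<Sum>k\<in>{0..<int q}. F k) = (\<Sum>k\<in>int ` {0<..H} \<union> (\<lambda>k. int q - int k) ` {0<..H}. F k)"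
  proof (rule sum.mono_neutral_right)
    show "int ` {0<..H} \<union> (\<lambda>k. int q - int k) ` {0<..H} \<subseteq> {0..<int q}"
      using q by (auto simp: H_def)
    show "\<forall>k\<in>{0..<int q} - (int ` {0<..H} \<union> (\<lambda>k. int q - int k) ` {0<..H}). F k = 0"
    proof
      fix k assume k: "k \<in> {0..<int q} - (int ` {0<..H} \<union> (\<lambda>k. int q - int k) ` {0<..H})"
      define n where "n = nat k"
      have n: "k = int n" "n < q" using k by (auto simp: n_def)
      have "n \<notin> {0<..H}" using k n by blast
      moreover have "q - n \<notin> {0<..H}"
      proof
        assume "q - n \<in> {0<..H}"
        moreover have "k = int q - int (q - n)" using n by (simp add: of_nat_diff)
        ultimately show False using k by blast
      qed
      ultimately have nH: "n = 0 \<or> H < n" "H < q - n" using n(2) unfolding greaterThanAtMost_iff by linarith+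
      have "n = 0 \<or> even q \<and> n = q div 2"
      proof (cases "even q")
        case True
        then obtain e where e: "q = 2 * e" by (rule evenE)
        then have "H = e - 1" using q unfolding H_def by presburger
        then show ?thesis using nH e by auto
      next
        case False
        then obtain e where e: "q = 2 * e + 1" by (rule oddE)
        then have "H = e" unfolding H_def by simp
        then show ?thesis using nH e by auto
      qed
      then show "F k = 0" using F0 Fh n(1) by auto
    qed
  qed simp
  also have "\<dots> = (\<Sum>k\<in>int ` {0<..H}. F k) + (\<Sum>k\<in>(\<lambda>k. int q - int k) ` {0<..H}. F k)"
  proof (rule sum.union_disjoint)
    show "int ` {0<..H} \<inter> (\<lambda>k. int q - int k) ` {0<..H} = {}"
    proof (rule equals0I, elim IntE imageE)
      fix x k j assume "x = int k" "k \<in> {0<..H}" "x = int q - int j" "j \<in> {0<..H}"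
      then have "k + j = q" "k \<le> (q - 1) div 2" "j \<le> (q - 1) div 2" unfolding H_def greaterThanAtMost_iff by linarith+
      then show False using q by presburger
    qed
  qed auto
  also have "(\<Sum>k\<in>int ` {0<..H}. F k) = (\<Sum>k\<in>{0<..H}. F (int k))" by (simp add: sum.reindex)
  also have "(\<Sum>k\<in>(\<lambda>k. int q - int k) ` {0<..H}. F k) = (\<Sum>k\<in>{0<..H}. F (int q - int k))"
    by (subst sum.reindex) (auto simp: inj_on_def)
  finally show ?thesis by (simp add: H_def sum.distrib)
qed

lemma primitive_character_cnj:
  assumes "primitive_character q \<chi>" shows "primitive_character q (\<lambda>a. cnj (\<chi> a))"
proof -
  have "dirichlet_character q \<chi>" using assms by (simp add: primitive_character_def)
  then have "dirichlet_character q (\<lambda>a. cnj (\<chi> a))" unfolding dirichlet_character_def by simp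
  moreover have "cnj z \<noteq> 1" if "z \<noteq> 1" for z using that by (metis complex_cnj_cnj complex_cnj_one)
  ultimately show ?thesis using assms unfolding primitive_character_def by blast
qed

text \<open>Summing the Fourier expansion over n gives the kernel (1 - e(-k N / q)) / (e(k / q) -
  1), which is q / (2 pi i k) times its numerator up to a bounded error. So logarithmic sums occur
  at the frequencies 0 and -N / q, for both \<chi> and its conjugate; hence \<open>M\<close> bounds
  all primitive characters and all frequencies.\<close>

theorem polya_bound:
  assumes prim: "primitive_character q \<chi>" and q: "q \<ge> 3"
    and M: "\<And>\<psi> \<beta> H. primitive_character q \<psi> \<Longrightarrow> H \<le> q \<Longrightarrow> norm (\<Sum>k\<in>{0<..H}. \<psi> (int k) * ee (real k * \<beta>) / of_nat k) \<le> M"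
  shows "norm (\<Sum>n\<in>{0<..N}. \<chi> (int n)) \<le> 2 * sqrt (real q) * (4 + M)"
proof -
  have \<chi>: "dirichlet_character q \<chi>" using prim by (simp add: primitive_character_def)
  define H where "H = (q - 1) div 2"
  define g where "g k = (\<Sum>n\<in>{0<..N}. ee (- (of_int (k * int n) / real q)))" for k :: int
  define w where "w = 1 / (2 * pi * \<i>)"
  have norm_w: "norm (w * of_nat q) = real q / (2 * pi)" by (simp add: w_def norm_divide norm_mult)
  have half: "norm (\<Sum>k\<in>{0<..H}. \<psi> (int k) * g (int k)) \<le> real q * (4 + M)" if \<psi>: "primitive_character q \<psi>" for \<psi>
  proof -
    define E where "E k = 1 / (ee (real k / real q) - 1) - 1 / (2 * pi * \<i> * (real k / real q))" for k :: nat
    have dpsi: "dirichlet_character q \<psi>" using \<psi> by (simp add: primitive_character_def)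
    have term_eq: "\<psi> (int k) * g (int k) = w * of_nat q * (\<psi> (int k) * ee (real k * 0) / of_nat k - \<psi> (int k) * ee (real k * (- (real N / real q))) / of_nat k)
       + \<psi> (int k) * (1 - ee (- (real k / real q * real N))) * E k" if k: "k \<in> {0<..H}" for k
    proof -
      have "k < q" "0 < k" using k q by (auto simp: H_def)
      then have ne: "ee (real k / real q) \<noteq> 1" by (intro ee_fraction_neq_1)
      have "g (int k) = (\<Sum>n\<in>{0<..N}. ee (- (real k / real q * real n)))" by (simp add: g_def)
      also have "\<dots> = (1 - ee (- (real k / real q * real N))) / (ee (real k / real q) - 1)" by (rule sum_ee_negative[OF ne])
      also have "\<dots> = (1 - ee (- (real k / real q * real N))) * (1 / (2 * pi * \<i> * (real k / real q)) + E k)"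
        by (simp add: E_def)
      also have "1 / (2 * pi * \<i> * (real k / real q)) = w * of_nat q / of_nat k"
        using q by (simp add: w_def)
      finally have gk: "g (int k) = (1 - ee (- (real k / real q * real N))) * (w * of_nat q / of_nat k + E k)" .
      show ?thesis unfolding gk by (simp add: algebra_simps diff_divide_distrib)
    qed
    have "(\<Sum>k\<in>{0<..H}. \<psi> (int k) * g (int k)) = 
        w * of_nat q * ((\<Sum>k\<in>{0<..H}. \<psi> (int k) * ee (real k * 0) / of_nat k) - (\<Sum>k\<in>{0<..H}. \<psi> (int k) * ee (real k * (- (real N / real q))) / of_nat k))
        + (\<Sum>k\<in>{0<..H}. \<psi> (int k) * (1 - ee (- (real k / real q * real N))) * E k)"
      unfolding sum_subtractf[symmetric] sum_distrib_left sum.distrib[symmetric] by (intro sum.cong refl term_eq)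
    \<comment> \<open>The 8 is 2 * 4, from |1 - e(...)| \<le> 2 and the error bound 4 of the kernel;
      as H \<le> q / 2 these errors add up to at most 4q.\<close>
    also have "norm \<dots> \<le> real q / (2 * pi) * (M + M) + real H * 8"
    proof (rule order_trans[OF norm_triangle_ineq add_mono])
      show "norm (w * of_nat q * ((\<Sum>k\<in>{0<..H}. \<psi> (int k) * ee (real k * 0) / of_nat k) - (\<Sum>k\<in>{0<..H}. \<psi> (int k) * ee (real k * (- (real N / real q))) / of_nat k))) \<le> real q / (2 * pi) * (M + M)"
        unfolding norm_mult[of "w * of_nat q"] norm_w
      proof (rule mult_left_mono)
        have "H \<le> q" by (simp add: H_def)
        then show "norm ((\<Sum>k\<in>{0<..H}. \<psi> (int k) * ee (real k * 0) / of_nat k) - (\<Sum>k\<in>{0<..H}. \<psi> (int k) * ee (real k * (- (real N / real q))) / of_nat k)) \<le> M + M"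
          by (intro order_trans[OF norm_triangle_ineq4 add_mono] M \<psi>)
      qed simp
      have "norm (\<Sum>k\<in>{0<..H}. \<psi> (int k) * (1 - ee (- (real k / real q * real N))) * E k) \<le> (\<Sum>k\<in>{0<..H}. 8)"
      proof (rule sum_norm_le)
        fix k assume k: "k \<in> {0<..H}"
        have "2 * k \<le> q" using k by (auto simp: H_def)
        then have "real (2 * k) \<le> real q" by (simp only: of_nat_le_iff)
        then have "norm (E k) \<le> 4" unfolding E_def using k q
          using inverse_ee_minus_1[of "real k / real q"] by (simp add: field_simps)
        moreover have "norm (1 - ee (- (real k / real q * real N))) \<le> 2" by (rule order_trans[OF norm_triangle_ineq4]) simp
        ultimately have "norm (\<psi> (int k)) * norm (1 - ee (- (real k / real q * real N))) * norm (E k) \<le> 1 * 2 * 4"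
          using norm_dirichlet_character_le[OF dpsi, of "int k"] by (intro mult_mono) auto
        then show "norm (\<psi> (int k) * (1 - ee (- (real k / real q * real N))) * E k) \<le> 8" by (simp add: norm_mult)
      qed
      then show "norm (\<Sum>k\<in>{0<..H}. \<psi> (int k) * (1 - ee (- (real k / real q * real N))) * E k) \<le> real H * 8" by simp
    qed
    also have "\<dots> \<le> real q * M + real q * 4"
    proof (rule add_mono)
      have M0: "0 \<le> M" using M[OF \<psi>, of 0 0] by simp
      have "real q / (2 * pi) * (M + M) = real q * M / pi" by simp
      also have "\<dots> \<le> real q * M / 1" using M0 pi_ge_two by (intro divide_left_mono) auto
      finally show "real q / (2 * pi) * (M + M) \<le> real q * M" by simp
      have "2 * H \<le> q" by (simp add: H_def)
      then have "real (2 * H) \<le> real q" by (simp only: of_nat_le_iff)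
      then show "real H * 8 \<le> real q * 4" by simp
    qed
    finally show ?thesis by (simp add: algebra_simps)
  qed
  define F where "F k = cnj (\<chi> k) * g k" for k
  have qpos: "q > 0" using q by simp
  have "of_nat q * (\<Sum>n\<in>{0<..N}. \<chi> (int n)) = (\<Sum>n\<in>{0<..N}. gauss_sum q \<chi> 1 * (\<Sum>k\<in>{0..<int q}. cnj (\<chi> k) * ee (- (of_int (k * int n) / real q))))"
    unfolding sum_distrib_left[of "of_nat q"] by (intro sum.cong refl character_fourier prim)
  also have "\<dots> = gauss_sum q \<chi> 1 * (\<Sum>n\<in>{0<..N}. \<Sum>k\<in>{0..<int q}. cnj (\<chi> k) * ee (- (of_int (k * int n) / real q)))"
    by (rule sum_distrib_left[symmetric])
  also have "(\<Sum>n\<in>{0<..N}. \<Sum>k\<in>{0..<int q}. cnj (\<chi> k) * ee (- (of_int (k * int n) / real q))) = (\<Sum>k\<in>{0..<int q}. F k)"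
    unfolding F_def g_def sum_distrib_left by (rule sum.swap)
  also have "\<dots> = (\<Sum>k\<in>{0<..H}. F (int k) + F (int q - int k))"
    unfolding H_def
  proof (rule sum_symmetric_residues[OF q])
    have "\<not> coprime 0 (int q)" using q by simp
    then show "F 0 = 0" using dirichlet_character_simps(3)[OF \<chi>, of 0] by (simp add: F_def)
    assume "even q"
    then have "q = 2 * (q div 2)" by simp
    then have "q div 2 dvd q" by (metis dvd_triv_right)
    moreover have "q div 2 \<noteq> 1" using q \<open>even q\<close> by presburger
    ultimately have "\<not> coprime (q div 2) q" by (metis coprime_common_divisor_nat dvd_refl)
    then have "\<not> coprime (int (q div 2)) (int q)" by (simp only: coprime_int_iff not_False_eq_True)
    then show "F (int (q div 2)) = 0" using dirichlet_character_simps(3)[OF \<chi>, of "int (q div 2)"] by (simp add: F_def)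
  qed
  \<comment> \<open>Negating k conjugates the kernel, so the residues q - k give, up to a factor
    \<chi>(-1) and conjugation, the sum of \<open>half\<close> for \<chi>, while the residues k give
    the one for its conjugate.\<close>
  also have "\<dots> = (\<Sum>k\<in>{0<..H}. cnj (\<chi> (int k)) * g (int k)) + cnj (\<chi> (-1)) * cnj (\<Sum>k\<in>{0<..H}. \<chi> (int k) * g (int k))"
  proof -
    have "F (int q - int k) = cnj (\<chi> (-1)) * cnj (\<chi> (int k) * g (int k))" for k
    proof -
      have "\<chi> (int q - int k) = \<chi> (-1 * int k)"
        by (rule dirichlet_character_cong[OF \<chi>]) (simp add: cong_iff_dvd_diff)
      then have 1: "\<chi> (int q - int k) = \<chi> (-1) * \<chi> (int k)" by (simp only: dirichlet_character_simps(2)[OF \<chi>])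
      have "g (int q - int k) = cnj (g (int k))"
        unfolding g_def cnj_sum
      proof (rule sum.cong[OF refl])
        fix n
        have "- (of_int ((int q - int k) * int n) / real q) = of_int (int k * int n) / real q + of_int (- int n)"
          using qpos by (simp add: field_simps)
        then have "ee (- (of_int ((int q - int k) * int n) / real q)) = ee (of_int (int k * int n) / real q)" by (simp only: ee_add_int)
        then show "ee (- (of_int ((int q - int k) * int n) / real q)) = cnj (ee (- (of_int (int k * int n) / real q)))"
          by (simp only: cnj_ee minus_minus)
      qed
      then show ?thesis using 1 by (simp add: F_def)
    qed
    then show ?thesis by (simp add: F_def sum.distrib sum_distrib_left cnj_sum)
  qed
  finally have "norm (of_nat q * (\<Sum>n\<in>{0<..N}. \<chi> (int n))) = 
     norm (gauss_sum q \<chi> 1) * norm ((\<Sum>k\<in>{0<..H}. cnj (\<chi> (int k)) * g (int k)) + cnj (\<chi> (-1)) * cnj (\<Sum>k\<in>{0<..H}. \<chi> (int k) * g (int k)))"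
    by (simp add: norm_mult)
  also have "\<dots> \<le> sqrt (real q) * (real q * (4 + M) + real q * (4 + M))"
  proof (rule mult_mono)
    show "norm (gauss_sum q \<chi> 1) \<le> sqrt (real q)" by (rule norm_gauss_sum_primitive[OF prim])
    show "norm ((\<Sum>k\<in>{0<..H}. cnj (\<chi> (int k)) * g (int k)) + cnj (\<chi> (-1)) * cnj (\<Sum>k\<in>{0<..H}. \<chi> (int k) * g (int k))) \<le> real q * (4 + M) + real q * (4 + M)"
    proof (rule order_trans[OF norm_triangle_ineq add_mono])
      show "norm (\<Sum>k\<in>{0<..H}. cnj (\<chi> (int k)) * g (int k)) \<le> real q * (4 + M)"
        using half[OF primitive_character_cnj[OF prim]] .
      have "norm (cnj (\<chi> (-1)) * cnj (\<Sum>k\<in>{0<..H}. \<chi> (int k) * g (int k))) = norm (\<chi> (-1)) * norm (\<Sum>k\<in>{0<..H}. \<chi> (int k) * g (int k))"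
        by (simp only: norm_mult complex_mod_cnj)
      also have "\<dots> \<le> norm (\<Sum>k\<in>{0<..H}. \<chi> (int k) * g (int k))"
        using norm_dirichlet_character_le[OF \<chi>, of "-1"] by (intro mult_left_le_one_le) auto
      also have "\<dots> \<le> real q * (4 + M)" using half[OF prim] .
      finally show "norm (cnj (\<chi> (-1)) * cnj (\<Sum>k\<in>{0<..H}. \<chi> (int k) * g (int k))) \<le> real q * (4 + M)" .
    qed
  qed auto
  finally have "real q * norm (\<Sum>n\<in>{0<..N}. \<chi> (int n)) \<le> real q * (2 * sqrt (real q) * (4 + M))"
    by (simp add: norm_mult algebra_simps)
  then show ?thesis using qpos by simp
qed

section \<open>Imprimitive characters\<close>

text \<open>Take b = a + m t, where t is the product of the primes dividing q but not a. A prime p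
  of q that divides a divides neither m nor t; one that does not divide a divides t. In both cases p
  does not divide b.\<close>

lemma coprime_lift:
  fixes a :: int and m q :: nat
  assumes q: "q > 0" and a: "coprime a (int m)"
  obtains b where "[b = a] (mod int m)" "coprime b (int q)"
proof -
  define T where "T = {p \<in> prime_factors q. \<not> int p dvd a}"
  define t where "t = \<Prod>T"
  have fin: "finite T" by (simp add: T_def)
  have "coprime (a + int m * int t) (int q)"
  proof (rule ccontr)
    assume "\<not> ?thesis"
    then have "gcd (a + int m * int t) (int q) \<noteq> 1" by (simp only: coprime_iff_gcd_eq_1 not_False_eq_True)
    then have "nat (gcd (a + int m * int t) (int q)) \<noteq> 1" by (metis gcd_ge_0_int int_nat_eq of_nat_1)
    then obtain p where p: "prime p" "p dvd nat (gcd (a + int m * int t) (int q))"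
      using prime_factor_nat by blast
    have "int p dvd gcd (a + int m * int t) (int q)"
      using p(2) by (metis gcd_ge_0_int int_nat_eq of_nat_dvd_iff)
    then have pb: "int p dvd a + int m * int t" and "int p dvd int q" by (simp_all only: gcd_greatest_iff)
    then have pq: "p \<in> prime_factors q" using p(1) q by (auto simp: in_prime_factors_iff)
    show False
    proof (cases "int p dvd a")
      case True
      then have "int p dvd int (m * t)" using pb by (simp add: dvd_add_right_iff)
      then have "p dvd m \<or> p dvd t" using p(1) by (simp only: of_nat_dvd_iff prime_dvd_mult_iff)
      moreover have "\<not> p dvd m"
      proof
        assume "p dvd m"
        then have "int p dvd int m" by simp
        then have "int p dvd 1" using True a coprime_common_divisor by blast
        then show False using p(1) by auto
      qed
      moreover have "\<not> p dvd t"
      proof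
        assume "p dvd t"
        then obtain p' where "p' \<in> T" "p dvd p'" using p(1) fin prime_dvd_prod_iff[of T p "\<lambda>x. x"] by (auto simp: t_def)
        then have "p = p'" using p(1) primes_dvd_imp_eq by (auto simp: T_def in_prime_factors_iff)
        then show False using True \<open>p' \<in> T\<close> by (simp add: T_def)
      qed
      ultimately show False by blast
    next
      case False
      then have "p dvd t" unfolding t_def using pq fin by (intro dvd_prodI) (auto simp: T_def)
      then have "int p dvd int m * int t" by simp
      then show False using pb False by (simp add: dvd_add_left_iff)
    qed
  qed
  moreover have "[a + int m * int t = a] (mod int m)" by (simp add: cong_iff_dvd_diff)
  ultimately show ?thesis using that by blast
qed

text \<open>The conductor m is the least divisor of q such that \<chi> is trivial on the units
  congruent to 1 modulo m. The value of \<psi> at a is that of \<chi> at a representative coprime to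
  q; by \<open>\<chi>_cong\<close> the choice is immaterial. Minimality is primitivity, and m \<ge>
  3 because a principal \<psi> would make \<chi> principal.\<close>

lemma primitive_character_inducing:
  assumes np: "nonprincipal_character q \<chi>"
  obtains m \<psi> where "m dvd q" "m \<ge> 3" "primitive_character m \<psi>" "\<And>a. coprime a (int q) \<Longrightarrow> \<chi> a = \<psi> a"
proof -
  have \<chi>: "dirichlet_character q \<chi>" using np by (simp add: nonprincipal_character_def)
  have q: "q > 0" using \<chi> by (rule dirichlet_character_simps)
  define Q where "Q m \<longleftrightarrow> m dvd q \<and> (\<forall>a. coprime a (int q) \<and> [a = 1] (mod int m) \<longrightarrow> \<chi> a = 1)" for m
  define m where "m = (LEAST m. Q m)"
  have "Q q" unfolding Q_def using dirichlet_character_cong[OF \<chi>] dirichlet_character_simps(4)[OF \<chi>] by (metis dvd_refl)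
  then have "Q m" unfolding m_def by (rule LeastI)
  then have mq: "m dvd q" and m1: "\<And>a. coprime a (int q) \<Longrightarrow> [a = 1] (mod int m) \<Longrightarrow> \<chi> a = 1"
    unfolding Q_def by blast+
  have least: "\<not> Q d" if "d < m" for d using not_less_Least that unfolding m_def by blast
  have m0: "m > 0" using mq q by (auto intro: Nat.gr0I)
  have mq': "int m dvd int q" using mq by simp
  have cop_m: "coprime a (int m)" if "coprime a (int q)" for a
    using that mq' by (meson coprime_imp_coprime dvd_trans)
  have \<chi>_cong: "\<chi> a = \<chi> b" if ab: "coprime a (int q)" "coprime b (int q)" "[a = b] (mod int m)" for a b
  proof -
    obtain b' where b': "[b * b' = 1] (mod int q)" using ab(2) by (metis cong_solve_coprime_int)
    have cb': "coprime b' (int q)" using cong_imp_coprime[OF cong_sym[OF b']] by simp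
    have "[a * b' = b * b'] (mod int m)" using ab(3) by (rule cong_scalar_right)
    also have "[b * b' = 1] (mod int m)" using b' mq' by (rule cong_dvd_modulus)
    finally have "\<chi> (a * b') = 1" using ab(1) cb' by (intro m1) auto
    moreover have "\<chi> (b * b') = 1"
      using dirichlet_character_cong[OF \<chi> b'] dirichlet_character_simps(4)[OF \<chi>] by simp
    ultimately have "\<chi> a * \<chi> b' = \<chi> b * \<chi> b'" by (simp add: dirichlet_character_simps(2)[OF \<chi>])
    moreover have "\<chi> b' \<noteq> 0" using cb' dirichlet_character_simps(3)[OF \<chi>] by blast
    ultimately show ?thesis by simp
  qed
  define lift where "lift a = (SOME b. [b = a] (mod int m) \<and> coprime b (int q))" for a
  have lift: "[lift a = a] (mod int m) \<and> coprime (lift a) (int q)" if ca: "coprime a (int m)" for a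
  proof -
    obtain b where "[b = a] (mod int m)" "coprime b (int q)" by (rule coprime_lift[OF q ca])
    then have "[b = a] (mod int m) \<and> coprime b (int q)" by blast
    then show ?thesis unfolding lift_def by (rule someI)
  qed
  define \<psi> where "\<psi> a = (if coprime a (int m) then \<chi> (lift a) else 0)" for a
  have \<psi>_eq: "\<psi> a = \<chi> b" if "coprime b (int q)" "[b = a] (mod int m)" for a b
  proof -
    have ca: "coprime a (int m)" using cop_m[OF that(1)] cong_imp_coprime[OF that(2)] by blast
    then have "[lift a = b] (mod int m)" using lift[OF ca] that(2) by (metis cong_sym cong_trans)
    then show ?thesis using \<chi>_cong[of "lift a" b] lift[OF ca] that(1) ca by (simp add: \<psi>_def)
  qed
  have \<psi>: "dirichlet_character m \<psi>"
    unfolding dirichlet_character_def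
  proof (intro conjI allI)
    fix a b
    show "\<psi> (a * b) = \<psi> a * \<psi> b"
    proof (cases "coprime a (int m) \<and> coprime b (int m)")
      case True
      have "\<psi> (a * b) = \<chi> (lift a * lift b)"
        using lift[of a] lift[of b] True by (intro \<psi>_eq cong_mult) auto
      then show ?thesis using True by (simp add: \<psi>_def dirichlet_character_simps(2)[OF \<chi>])
    qed (auto simp: \<psi>_def)
    show "\<psi> (a + int m) = \<psi> a"
    proof (cases "coprime a (int m)")
      case True
      have "[lift a = a + int m] (mod int m)" using lift[OF True] by (simp add: cong_def)
      then have "\<psi> (a + int m) = \<chi> (lift a)" using lift[OF True] by (intro \<psi>_eq) auto
      then show ?thesis using True by (simp add: \<psi>_def)
    next
      case False
      moreover have "[a + int m = a] (mod int m)" by (simp add: cong_def)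
      then have "coprime (a + int m) (int m) \<Longrightarrow> coprime a (int m)" by (rule cong_imp_coprime)
      ultimately show ?thesis by (auto simp: \<psi>_def)
    qed
    show "\<psi> a \<noteq> 0 \<longleftrightarrow> coprime a (int m)"
      using lift[of a] dirichlet_character_simps(3)[OF \<chi>, of "lift a"] by (auto simp: \<psi>_def)
  qed (rule m0)
  have agree: "\<chi> a = \<psi> a" if "coprime a (int q)" for a
    using \<psi>_eq[OF that cong_refl] by simp
  have "primitive_character m \<psi>"
    unfolding primitive_character_def
  proof (intro conjI allI impI, rule \<psi>)
    fix d assume d: "d dvd m \<and> d < m"
    then have "d dvd q" using mq by (blast intro: dvd_trans)
    then obtain a where a: "coprime a (int q)" "[a = 1] (mod int d)" "\<chi> a \<noteq> 1"
      using least[of d] d by (auto simp: Q_def)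
    then show "\<exists>a. coprime a (int m) \<and> [a = 1] (mod int d) \<and> \<psi> a \<noteq> 1"
      using agree cop_m by (intro exI[of _ a]) auto
  qed
  moreover have "nonprincipal_character m \<psi>"
    unfolding nonprincipal_character_def
  proof (intro conjI notI, rule \<psi>)
    assume eq: "\<psi> = principal_character m"
    have "\<chi> a = principal_character q a" for a
    proof (cases "coprime a (int q)")
      case True
      then show ?thesis using agree cop_m by (simp add: eq principal_character_def)
    next
      case False
      then show ?thesis using dirichlet_character_simps(3)[OF \<chi>] by (simp add: principal_character_def)
    qed
    then show False using np by (auto simp: nonprincipal_character_def)
  qed
  then have "m \<ge> 3" by (rule nonprincipal_character_ge_3)
  ultimately show ?thesis using that mq agree by blast
qed

section \<open>Removing the primes that divide the modulus but not the conductor\<close>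

lemma norm_sifted_sum_le:
  fixes f :: "nat \<Rightarrow> complex"
  assumes f: "\<And>m n. f (m * n) = f m * f n" "\<And>n. norm (f n) \<le> 1"
    and V: "\<And>N. norm (\<Sum>n\<in>{0<..N}. f n) \<le> V"
    and P: "finite P" "\<And>p. p \<in> P \<Longrightarrow> prime p"
  shows "norm (\<Sum>n | n \<in> {0<..N} \<and> (\<forall>p\<in>P. \<not> p dvd n). f n) \<le> 2 ^ card P * V"
  using P
proof (induction P arbitrary: N rule: finite_induct)
  case empty
  have "{n. n \<in> {0<..N} \<and> (\<forall>p\<in>{}. \<not> p dvd n)} = {0<..N}" by blast
  then show ?case using V by (simp only:) simp
next
  case (insert p P)
  define S where "S N = (\<Sum>n | n \<in> {0<..N} \<and> (\<forall>p\<in>P. \<not> p dvd n). f n)" for N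
  have p: "prime p" "p > 0" using insert.prems by (auto simp: prime_gt_0_nat)
  have IH: "norm (S N) \<le> 2 ^ card P * V" for N unfolding S_def using insert by simp
  have "S N = (\<Sum>n | n \<in> {0<..N} \<and> (\<forall>p\<in>insert p P. \<not> p dvd n). f n) + (\<Sum>n | n \<in> {0<..N} \<and> (\<forall>p\<in>P. \<not> p dvd n) \<and> p dvd n. f n)"
    unfolding S_def by (subst sum.union_disjoint[symmetric]) (auto intro!: sum.cong)
  also have "(\<Sum>n | n \<in> {0<..N} \<and> (\<forall>p\<in>P. \<not> p dvd n) \<and> p dvd n. f n) = (\<Sum>n\<in>{n \<in> {0<..N}. p dvd n}. if \<forall>p\<in>P. \<not> p dvd n then f n else 0)"
    by (subst sum.inter_filter[symmetric]) (auto intro!: sum.cong)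
  also have "\<dots> = (\<Sum>m\<in>{0 div p<..N div p}. if \<forall>p'\<in>P. \<not> p' dvd p * m then f (p * m) else 0)"
    by (rule sum_multiples[OF p(2)])
  also have "\<dots> = (\<Sum>m\<in>{0<..N div p}. if \<forall>p'\<in>P. \<not> p' dvd m then f p * f m else 0)"
  proof (intro sum.cong)
    fix m
    have "p' dvd p * m \<longleftrightarrow> p' dvd m" if "p' \<in> P" for p'
    proof -
      have "prime p'" "p' \<noteq> p" using that insert by auto
      then have "coprime p' p" using p(1) by (simp add: primes_coprime)
      then show ?thesis by (rule coprime_dvd_mult_right_iff)
    qed
    then show "(if \<forall>p'\<in>P. \<not> p' dvd p * m then f (p * m) else 0) = (if \<forall>p'\<in>P. \<not> p' dvd m then f p * f m else 0)"
      by (simp add: f(1))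
  qed simp
  also have "\<dots> = f p * S (N div p)"
  proof -
    have "S (N div p) = (\<Sum>m\<in>{0<..N div p}. if \<forall>p'\<in>P. \<not> p' dvd m then f m else 0)"
      unfolding S_def by (rule sum.inter_filter) simp
    then show ?thesis by (simp add: sum_distrib_left if_distrib[of "\<lambda>z. f p * z"] cong: if_cong)
  qed
  finally have "(\<Sum>n | n \<in> {0<..N} \<and> (\<forall>p\<in>insert p P. \<not> p dvd n). f n) = S N - f p * S (N div p)" by simp
  then have "norm (\<Sum>n | n \<in> {0<..N} \<and> (\<forall>p\<in>insert p P. \<not> p dvd n). f n) \<le> norm (S N) + norm (f p * S (N div p))"
    by (simp only: norm_triangle_ineq4)
  also have "norm (f p * S (N div p)) \<le> norm (S (N div p))"
    unfolding norm_mult using f(2)[of p] by (intro mult_left_le_one_le) auto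
  also have "norm (S N) + norm (S (N div p)) \<le> 2 ^ card P * V + 2 ^ card P * V" by (intro add_mono IH)
  also have "\<dots> = 2 ^ card (insert p P) * V" using insert.hyps by simp
  finally show ?case by simp
qed

text \<open>Every prime from 5 on has square root at least 2. Only 2 and 3 can fall short, and each
  is granted an extra factor 2.\<close>

lemma pow2_card_primes_le:
  assumes "finite P" "\<And>p. p \<in> P \<Longrightarrow> prime (p::nat)"
  shows "2 ^ card P \<le> 4 * sqrt (real (\<Prod>P))"
proof -
  have "2 ^ card P \<le> 2 ^ card (P \<inter> {2, 3}) * sqrt (real (\<Prod>P))"
    using assms
  proof (induction P rule: finite_induct)
    case (insert p P)
    have p: "p \<ge> 2" using insert.prems by (auto intro: prime_ge_2_nat)
    have IH: "2 ^ card P \<le> 2 ^ card (P \<inter> {2, 3}) * sqrt (real (\<Prod>P))" using insert by simp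
    have eq: "sqrt (real (\<Prod>(insert p P))) = sqrt (real p) * sqrt (real (\<Prod>P))"
      using insert by (simp add: real_sqrt_mult)
    show ?case
    proof (cases "p \<in> {2, 3}")
      case True
      have "2 ^ card (insert p P) = 2 * (1::real) * 2 ^ card P" using insert by simp
      also have "\<dots> \<le> 2 * sqrt (real p) * (2 ^ card (P \<inter> {2, 3}) * sqrt (real (\<Prod>P)))"
        using IH p by (intro mult_mono) auto
      also have "\<dots> = 2 ^ card (insert p P \<inter> {2, 3}) * sqrt (real (\<Prod>(insert p P)))"
        using True insert unfolding eq by (simp add: Int_insert_left mult_ac)
      finally show ?thesis .
    next
      case False
      then have "4 \<le> p" using p by auto
      then have "2 \<le> sqrt (real p)" by (intro real_le_rsqrt) simp
      have "2 ^ card (insert p P) = 2 * (2::real) ^ card P" using insert by simp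
      also have "\<dots> \<le> sqrt (real p) * (2 ^ card (P \<inter> {2, 3}) * sqrt (real (\<Prod>P)))"
        using IH \<open>2 \<le> sqrt (real p)\<close> by (intro mult_mono) auto
      also have "\<dots> = 2 ^ card (insert p P \<inter> {2, 3}) * sqrt (real (\<Prod>(insert p P)))"
        using False unfolding eq by (simp add: Int_insert_left mult_ac)
      finally show ?thesis .
    qed
  qed simp
  also have "\<dots> \<le> 2 ^ 2 * sqrt (real (\<Prod>P))"
  proof (intro mult_right_mono power_increasing)
    have "card (P \<inter> {2, 3}) \<le> card {2, 3::nat}" by (intro card_mono) auto
    then show "card (P \<inter> {2, 3}) \<le> 2" by simp
  qed (auto intro!: prod_nonneg)
  finally show ?thesis by simp
qed

lemma prod_primes_dvd:
  assumes "finite P" "\<And>p. p \<in> P \<Longrightarrow> prime (p::nat) \<and> p dvd l"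
  shows "\<Prod>P dvd l"
  using assms
proof (induction P rule: finite_induct)
  case (insert p P)
  have "coprime p (\<Prod>P)"
    using insert by (intro prod_coprime_right) (metis insertCI primes_coprime)
  then have "p * \<Prod>P dvd l" using insert by (intro divides_mult) auto
  then show ?case using insert by simp
qed simp

text \<open>Write q = m l with m the conductor. Sifting one prime at most doubles a uniform bound,
  and the sifted primes divide l, so the total loss is at most 4 sqrt l. It is absorbed by the gain
  from sqrt m to sqrt q.\<close>

lemma norm_imprimitive_sum_le:
  assumes np: "nonprincipal_character q \<chi>"
  obtains m \<psi> where "m \<le> q" "m \<ge> 3" "primitive_character m \<psi>"
    "\<And>V N. (\<And>N. norm (\<Sum>n\<in>{0<..N}. \<psi> (int n)) \<le> sqrt (real m) * V) \<Longrightarrow> 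
       norm (\<Sum>n\<in>{0<..N}. \<chi> (int n)) \<le> 4 * sqrt (real q) * V"
proof -
  have \<chi>: "dirichlet_character q \<chi>" using np by (simp add: nonprincipal_character_def)
  have q: "q > 0" using \<chi> by (rule dirichlet_character_simps)
  obtain m \<psi> where m: "m dvd q" "m \<ge> 3" and prim: "primitive_character m \<psi>"
    and agree: "\<And>a. coprime a (int q) \<Longrightarrow> \<chi> a = \<psi> a" using primitive_character_inducing[OF np] by blast
  have \<psi>: "dirichlet_character m \<psi>" using prim by (simp add: primitive_character_def)
  obtain l where l: "q = m * l" using m(1) by (auto simp: dvd_def)
  have l0: "l > 0" using q l by (auto intro: Nat.gr0I)
  \<comment> \<open>Primes of m need no sifting, as \<psi> already vanishes at their
    multiples.\<close>
  define P where "P = {p \<in> prime_factors q. \<not> p dvd m}"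
  have P: "finite P" "prime p \<and> p dvd l" if "p \<in> P" for p
  proof -
    have "prime p" "p dvd m * l" "\<not> p dvd m" using that l by (auto simp: P_def in_prime_factors_iff)
    then show "prime p \<and> p dvd l" by (simp add: prime_dvd_mult_iff)
  qed (simp add: P_def)
  have finP: "finite P" by (simp add: P_def)
  have iff: "coprime (int n) (int q) \<longleftrightarrow> coprime (int n) (int m) \<and> (\<forall>p\<in>P. \<not> p dvd n)" for n
  proof
    assume c: "coprime (int n) (int q)"
    then have c': "coprime n q" by (simp only: coprime_int_iff)
    have "coprime n m" using c' m(1) by (meson coprime_imp_coprime dvd_trans)
    moreover have "\<not> p dvd n" if "p \<in> P" for p
    proof
      assume "p dvd n"
      moreover have "p dvd q" "prime p" using that by (auto simp: P_def in_prime_factors_iff)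
      ultimately have "p dvd 1" using c' coprime_common_divisor by blast
      then show False using \<open>prime p\<close> by auto
    qed
    ultimately show "coprime (int n) (int m) \<and> (\<forall>p\<in>P. \<not> p dvd n)" by (simp only: coprime_int_iff) blast
  next
    assume c: "coprime (int n) (int m) \<and> (\<forall>p\<in>P. \<not> p dvd n)"
    have "coprime n q"
    proof (rule ccontr)
      assume "\<not> coprime n q"
      then have "gcd n q \<noteq> 1" by (simp only: coprime_iff_gcd_eq_1 not_False_eq_True)
      then obtain p where p: "prime p" "p dvd gcd n q" using prime_factor_nat by blast
      then have pn: "p dvd n" "p dvd q" by (simp_all only: gcd_greatest_iff)
      show False
      proof (cases "p dvd m")
        case True
        have "coprime n m" using c by (simp only: coprime_int_iff)
        then have "p dvd 1" using True pn coprime_common_divisor by blast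
        then show False using p(1) by auto
      next
        case False
        then have "p \<in> P" using p(1) pn q by (auto simp: P_def in_prime_factors_iff)
        then show False using c pn by blast
      qed
    qed
    then show "coprime (int n) (int q)" by (simp only: coprime_int_iff)
  qed
  have "norm (\<Sum>n\<in>{0<..N}. \<chi> (int n)) \<le> 4 * sqrt (real q) * V"
    if V: "\<And>N. norm (\<Sum>n\<in>{0<..N}. \<psi> (int n)) \<le> sqrt (real m) * V" for V N
  proof -
    have V0: "V \<ge> 0" using V[of 0] m(2) by (simp add: zero_le_mult_iff)
    have "(\<Sum>n\<in>{0<..N}. \<chi> (int n)) = (\<Sum>n\<in>{0<..N}. if \<forall>p\<in>P. \<not> p dvd n then \<psi> (int n) else 0)"
    proof (rule sum.cong[OF refl])
      fix n
      show "\<chi> (int n) = (if \<forall>p\<in>P. \<not> p dvd n then \<psi> (int n) else 0)"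
        using iff[of n] agree[of "int n"] dirichlet_character_simps(3)[OF \<chi>, of "int n"] 
          dirichlet_character_simps(3)[OF \<psi>, of "int n"] by auto
    qed
    also have "\<dots> = (\<Sum>n\<in>{n \<in> {0<..N}. \<forall>p\<in>P. \<not> p dvd n}. \<psi> (int n))" by (rule sum.inter_filter[symmetric]) simp
    also have "norm \<dots> \<le> 2 ^ card P * (sqrt (real m) * V)"
      using V finP P(2) norm_dirichlet_character_le[OF \<psi>]
      by (intro norm_sifted_sum_le) (auto simp: dirichlet_character_simps(2)[OF \<psi>])
    also have "\<dots> \<le> (4 * sqrt (real l)) * (sqrt (real m) * V)"
    proof (rule mult_right_mono)
      have "\<Prod>P \<le> l" using prod_primes_dvd[OF finP P(2)] l0 by (intro dvd_imp_le) auto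
      then have "sqrt (real (\<Prod>P)) \<le> sqrt (real l)" by (simp only: real_sqrt_le_iff of_nat_le_iff)
      moreover have "2 ^ card P \<le> 4 * sqrt (real (\<Prod>P))" using P(2) by (intro pow2_card_primes_le finP) blast
      ultimately show "2 ^ card P \<le> 4 * sqrt (real l)" by linarith
    qed (use V0 in auto)
    also have "\<dots> = 4 * sqrt (real q) * V" unfolding l by (simp add: real_sqrt_mult)
    finally show ?thesis .
  qed
  moreover have "m \<le> q" using m(1) q by (rule dvd_imp_le)
  ultimately show ?thesis using that m(2) prim by blast
qed

theorem theorem2:
  fixes \<epsilon> :: real
  assumes "\<epsilon> > 0"
    and "short_sum_hypothesis \<epsilon>"
  shows "\<exists>K::real. \<forall>(q :: nat) (\<chi> :: int \<Rightarrow> complex) (x :: real).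
           nonprincipal_character q \<chi> \<longrightarrow>
           norm (character_sum \<chi> x) \<le> K * (sqrt (real q) * ln (ln (real q)) powr (1 + \<epsilon>))"
proof -
  obtain A K where AK: "A > 0" "K \<ge> 0"
    and hyp: "\<And>q \<chi> x. nonprincipal_character q \<chi> \<Longrightarrow> x > 0 \<Longrightarrow> A * ln (ln (real q)) \<le> ln x \<Longrightarrow>
       norm (character_sum \<chi> x) \<le> K * (x / ln x powr (3 + \<epsilon>))"
    using short_sum_hypothesis_uniform[OF assms(2)] by blast
  obtain l0 where l0: "l0 \<ge> 2" and asymp: "\<And>l. l \<ge> l0 \<Longrightarrow> large_log \<epsilon> l"
    using large_log_eventually[OF assms(1)] by blast
  define W where "W = max (exp l0) 4"
  \<comment> \<open>\<open>C4\<close> depends only on \<epsilon>, A and K, so the constant is fixed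
    before q.\<close>
  define C where "C = uniform_short_sums.C4 \<epsilon> A K"
  \<comment> \<open>The least value over q \<ge> 3 of the power of ln (ln q) in the conclusion;
    dividing by it brings the bound for small q into the required form.\<close>
  define c where "c = ln (ln (real 3)) powr (1 + \<epsilon>)"
  have c: "c > 0" using ln_ln_pos[of 3] by (simp add: c_def)
  define K' where "K' = max (2 * (4 + C)) (2 * (5 + W) / c)"
  have "0 < 2 * (5 + W) / c" using c by (simp add: W_def less_max_iff_disj add_pos_pos)
  then have K'0: "0 \<le> K'" by (simp add: K'_def less_imp_le le_max_iff_disj)
  have prim: "norm (\<Sum>n\<in>{0<..N}. \<chi> (int n)) \<le> sqrt (real q) * (K' * ln (ln (real q)) powr (1 + \<epsilon>))"
    if \<chi>: "primitive_character q \<chi>" and q: "q \<ge> 3" for q \<chi> N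
  proof (cases "ln (real q) \<ge> W")
    case True
    define L where "L = ln (ln (real q))"
    have loc: "uniform_short_sums \<epsilon> A K l0 q \<psi>" if "primitive_character q \<psi>" for \<psi>
      using assms(1) AK hyp l0 asymp that True unfolding W_def by unfold_locales
    have L: "L \<ge> 1" using uniform_short_sums.L1[OF loc[OF \<chi>]] by (simp add: L_def uniform_short_sums.L_def[OF loc[OF \<chi>]])
    have "norm (\<Sum>n\<in>{0<..N}. \<chi> (int n)) \<le> 2 * sqrt (real q) * (4 + C * L powr (1 + \<epsilon>))"
    proof (rule polya_bound[OF \<chi> q])
      fix \<psi> \<beta> H assume "primitive_character q \<psi>" "H \<le> q"
      then show "norm (\<Sum>k\<in>{0<..H}. \<psi> (int k) * ee (real k * \<beta>) / of_nat k) \<le> C * L powr (1 + \<epsilon>)"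
        using uniform_short_sums.norm_log_sum_primitive[OF loc] unfolding C_def L_def
        by (simp add: uniform_short_sums.L_def[OF loc])
    qed
    also have "\<dots> \<le> 2 * sqrt (real q) * (4 * L powr (1 + \<epsilon>) + C * L powr (1 + \<epsilon>))"
    proof -
      have "1 \<le> L powr (1 + \<epsilon>)" using L assms(1) by (intro ge_one_powr_ge_zero) auto
      then show ?thesis by (intro mult_left_mono) auto
    qed
    also have "\<dots> = sqrt (real q) * (2 * (4 + C) * L powr (1 + \<epsilon>))" by (simp add: algebra_simps)
    also have "\<dots> \<le> sqrt (real q) * (K' * L powr (1 + \<epsilon>))"
      by (intro mult_left_mono mult_right_mono) (auto simp: K'_def)
    finally show ?thesis unfolding L_def .
  next
    case False
    \<comment> \<open>While ln q < W the harmonic sum, at most 1 + W, bounds the logarithmic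
      sums.\<close>
    have "norm (\<Sum>n\<in>{0<..N}. \<chi> (int n)) \<le> 2 * sqrt (real q) * (4 + (1 + W))"
    proof (rule polya_bound[OF \<chi> q])
      fix \<psi> \<beta> H assume \<psi>: "primitive_character q \<psi>" "H \<le> q"
      have d: "dirichlet_character q \<psi>" using \<psi>(1) by (simp add: primitive_character_def)
      have "norm (\<Sum>k\<in>{0<..H}. \<psi> (int k) * ee (real k * \<beta>) / of_nat k) \<le> (\<Sum>k\<in>{0<..H}. 1 / real k)"
        using norm_dirichlet_character_le[OF d] by (intro sum_norm_le) (auto simp: norm_mult norm_divide intro!: divide_right_mono)
      also have "\<dots> \<le> (\<Sum>k=1..q. 1 / real k)" using \<psi>(2) by (intro sum_mono2) auto
      also have "\<dots> \<le> 1 + ln (real q)" using sum_inverse_le[of q] q by (simp add: max_def)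
      finally show "norm (\<Sum>k\<in>{0<..H}. \<psi> (int k) * ee (real k * \<beta>) / of_nat k) \<le> 1 + W" using False by simp
    qed
    also have "\<dots> = sqrt (real q) * (2 * (5 + W) / c * c)" using c by simp
    also have "\<dots> \<le> sqrt (real q) * (K' * ln (ln (real q)) powr (1 + \<epsilon>))"
    proof (intro mult_left_mono mult_mono)
      have "ln (real 3) \<le> ln (real q)" using q by simp
      then have "ln (ln (real 3)) \<le> ln (ln (real q))"
        using ln_gt_1[of 3] by (subst ln_le_cancel_iff) auto
      then show "c \<le> ln (ln (real q)) powr (1 + \<epsilon>)"
        unfolding c_def using ln_ln_pos[of 3] assms(1) by (intro powr_mono2) auto
    qed (use c K'0 in \<open>auto simp: K'_def\<close>)
    finally show ?thesis .
  qed
  show ?thesis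
  proof (intro exI[of _ "4 * K'"] allI impI)
    fix q \<chi> and x :: real
    assume np: "nonprincipal_character q \<chi>"
    obtain m \<psi> where m: "m \<le> q" "m \<ge> 3" and \<psi>: "primitive_character m \<psi>"
      and red: "\<And>V N. (\<And>N. norm (\<Sum>n\<in>{0<..N}. \<psi> (int n)) \<le> sqrt (real m) * V) \<Longrightarrow> 
       norm (\<Sum>n\<in>{0<..N}. \<chi> (int n)) \<le> 4 * sqrt (real q) * V"
      using norm_imprimitive_sum_le[OF np] by metis
    have sum_eq: "character_sum \<chi> x = (\<Sum>n\<in>{0<..nat \<lfloor>x\<rfloor>}. \<chi> (int n))"
    proof (cases "x \<ge> 0")
      case True
      have "character_sum \<chi> x = character_sum \<chi> (real (nat \<lfloor>x\<rfloor>))" using True by (simp add: character_sum_def)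
      then show ?thesis by (simp only: character_sum_of_nat)
    next
      case False
      \<comment> \<open>For negative x both sums are empty, since \<open>nat\<close> sends the
        negative floor to 0.\<close>
      then have "\<lfloor>x\<rfloor> < 1" by linarith
      then show ?thesis by (simp add: character_sum_def)
    qed
    have "norm (character_sum \<chi> x) \<le> 4 * sqrt (real q) * (K' * ln (ln (real m)) powr (1 + \<epsilon>))"
      unfolding sum_eq by (rule red) (rule prim[OF \<psi> m(2)])
    also have "\<dots> \<le> 4 * sqrt (real q) * (K' * ln (ln (real q)) powr (1 + \<epsilon>))"
    proof (intro mult_left_mono powr_mono2)
      have "ln (real m) \<le> ln (real q)" using m by simp
      then show "ln (ln (real m)) \<le> ln (ln (real q))" using ln_gt_1[OF m(2)] by (subst ln_le_cancel_iff) auto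
      show "0 \<le> ln (ln (real m))" using ln_ln_pos[OF m(2)] by simp
    qed (use assms(1) K'0 in auto)
    finally show "norm (character_sum \<chi> x) \<le> 4 * K' * (sqrt (real q) * ln (ln (real q)) powr (1 + \<epsilon>))"
      by (simp only: mult_ac)
  qed
qed

end
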